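(* Let $\varepsilon>0$. On the event $\{N_\varepsilon\ne-\infty\}=\{\varepsilon\le\zeta\}$, the process $(F(\zeta-\varepsilon t),\,0<t\le\zeta/\varepsilon)$ can be rewritten in the form $$\Bigg(\Bigg\{\prod_{j=0}^{N_\varepsilon+K_\varepsilon(t)}\Theta_j\,,\ \Big(\prod_{j=0}^{N_\varepsilon+i-1}\Theta_j\Big)\Delta_{N_\varepsilon+i,m}\,\bar F_{i,m}^{(\Delta_{N_\varepsilon+i,m}^{\alpha}\Theta_{N_\varepsilon+i}^{-\alpha}Z_{N_\varepsilon+i})}\Big(\varepsilon t\Big(\prod_{j=0}^{N_\varepsilon+i-1}\Theta_j\Big)^{\alpha}\Delta_{N_\varepsilon+i,m}^{\alpha}\Big):\ m\ge1,\ -N_\varepsilon+1\le i\le K_\varepsilon(t)\Bigg\}^{\downarrow},\ 0<t\le\zeta/\varepsilon\Bigg),$$ where $K_\varepsilon(t)$ is the unique integer $k\ge-N_\varepsilon$ such that $R_\varepsilon(k)\ge t>R_\varepsilon(k+1)$, and $\bar F_{i,m}^{(\Delta_{N_\varepsilon+i,m}^{\alpha}\Theta_{N_\varepsilon+i}^{-\alpha}Z_{N_\varepsilon+i})}$, $i\in\mathbb Z$, $m\ge1$, is a collection of time-reversed conditioned fragmentation processes which are independent for distinct $(i,m)$, conditionally on $(Z_n,\Theta_n,\mathbf\Delta_n)_{n\ge0}$.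
   Context: $\mathbb N=\{1,2,\dots\}$. $\mathcal S=\{\mathbf s=(s_1,s_2,\dots): s_1\ge s_2\ge\cdots\ge0,\ \sum_i s_i<\infty\}$ with metric $d(\mathbf s,\mathbf s')=\sum_i|s_i-s_i'|$; $\mathcal S_1=\{\mathbf s\in\mathcal S:\sum_i s_i=1\}$; $\mathbf 0=(0,0,\dots)$, $\mathbf 1=(1,0,0,\dots)$. Fix $\alpha<0$ and a probability measure $\nu$ on $\mathcal S_1$ with $\nu(\{\mathbf 1\})=0$. The fragmentation process $F=(F(t))_{t\ge0}$ (index $\alpha$, dislocation measure $\nu$, started from $\mathbf 1$) is the càdlàg $(\mathcal S,d)$-valued Markov process in which blocks evolve independently and a block of mass $m>0$ waits an exponential time of mean $m^{-\alpha}$ and then splits into blocks of masses $mS_1,mS_2,\dots$ with $(S_1,S_2,\dots)\sim\nu$. Concretely: let $\mathcal U=\bigcup_{n\ge0}\mathbb N^n$, let $(e_u,S^u)_{u\in\mathcal U}$ be i.i.d. with $e_u\sim\mathrm{Exp}(1)$ independent of $S^u\sim\nu$; put $m_\varnothing=1$, $b_\varnothing=0$, $m_{ui}=m_uS^u_i$, $b_{ui}=b_u+m_u^{-\alpha}e_u$; then $F(t)$ is the decreasing rearrangement (padded with zeros) of the $m_u>0$ with $b_u\le t<b_u+m_u^{-\alpha}e_u$. The extinction time $\zeta=\inf\{t\ge0:F(t)=\mathbf 0\}$ is a.s. finite. Last fragment. Almost surely, for each $t<\zeta$ there is exactly one block present at time $t$ whose descendants become extinct exactly at time $\zeta$; $F_*(t)$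 is its mass, and $F_*(t)=0$ for $t\ge\zeta$. Let $T_0=0$ and let $T_1<T_2<\cdots$ be the successive jump times of $F_*$ in $(0,\zeta)$ (there are infinitely many, with $T_n\to\zeta$). For $n\ge0$, $Z_n=F_*(T_n)^{\alpha}(\zeta-T_n)$. Set $\Theta_0=1$, $\mathbf\Delta_0=(0,0,\dots)$, and for $n\ge1$ let $\Theta_n=F_*(T_n)/F_*(T_{n-1})$ and let $\mathbf\Delta_n=(\Delta_{n,1}\ge\Delta_{n,2}\ge\cdots)$ be the relative sizes (divided by $F_*(T_{n-1})$) of the other sub-blocks produced by the split of the last fragment at time $T_n$. Set $Y_0=\zeta^{1/\alpha}$, $Y_n=\big((\zeta-T_n)/(\zeta-T_{n-1})\big)^{1/\alpha}$ for $n\ge1$. $N_\varepsilon=\sup\{n\ge0:\zeta-\varepsilon\ge T_n\}$ ($\sup\varnothing=-\infty$), and for $k\ge-N_\varepsilon$, $R_\varepsilon(k)=\varepsilon^{-1}\prod_{i=0}^{N_\varepsilon+k}Y_i^{\alpha}=\varepsilon^{-1}(\zeta-T_{N_\varepsilon+k})$. For $x>0$, $\bar F^{(x)}=(\bar F^{(x)}(t))_{t\ge0}$ denotes a process with the law of $\big(F(x-t)\mathbf 1_{\{0\le t\le x\}}+\mathbf 0\,\mathbf 1_{\{t>x\}}\big)_{t\ge0}$ under $\mathbb P(\cdot\mid\zeta<x)$. The family $\bar F_{i,m}^{(x_{i,m})}$ with random $x_{i,m}$ means: conditionally on $(Z_n,\Theta_n,\mathbf\Delta_n)_{n\ge0}$,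 the processes are independent with $\bar F_{i,m}^{(x_{i,m})}$ distributed as $\bar F^{(x)}$ at $x=x_{i,m}$. Indices with $\Delta_{N_\varepsilon+i,m}=0$ contribute nothing. $\{\cdot\}^{\downarrow}$ denotes the decreasing rearrangement of all the terms of the listed numbers and sequences. *)

theory Defs
  imports "HOL-Probability.Probability" "HOL-Library.Sublist"
begin

section \<open>Mass sequences\<close>

text \<open>Sequences are indexed from 0: \<open>s k\<close> stands for the $(k+1)$-st term.\<close>

definition mass_seqs :: "(nat \<Rightarrow> real) set" where
  "mass_seqs = {s. decseq s \<and> (\<forall>i. 0 \<le> s i) \<and> summable s}"

definition unit_mass_seqs :: "(nat \<Rightarrow> real) set" where
  "unit_mass_seqs = {s \<in> mass_seqs. (\<Sum>i. s i) = 1}"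

definition zero_seq :: "nat \<Rightarrow> real" where
  "zero_seq = (\<lambda>_. 0)"

definition one_seq :: "nat \<Rightarrow> real" where
  "one_seq = (\<lambda>i. if i = 0 then 1 else 0)"

text \<open>\<^const>\<open>infsum\<close> rather than \<^const>\<open>suminf\<close>: the locale \<^locale>\<open>Metric_space\<close> wants a distance that is
  nonnegative also outside the carrier.\<close>

definition seq_dist :: "(nat \<Rightarrow> real) \<Rightarrow> (nat \<Rightarrow> real) \<Rightarrow> real" where
  "seq_dist s s' = (\<Sum>\<^sub>\<infinity>i. \<bar>s i - s' i\<bar>)"

lemma seq_dist_summable:
  assumes "s \<in> mass_seqs" "s' \<in> mass_seqs"
  shows "(\<lambda>i. \<bar>s i - s' i\<bar>) summable_on UNIV"
proof -
  have "summable (\<lambda>i. \<bar>s i - s' i\<bar>)"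
  proof (rule summable_comparison_test')
    show "summable (\<lambda>i. s i + s' i)"
      using assms by (intro summable_add) (auto simp: mass_seqs_def)
    show "norm \<bar>s i - s' i\<bar> \<le> s i + s' i" if "i \<ge> 0" for i
    proof -
      have "0 \<le> s i" "0 \<le> s' i" using assms by (auto simp: mass_seqs_def)
      then show ?thesis by simp
    qed
  qed
  then show ?thesis by (simp add: summable_on_UNIV_nonneg_real_iff)
qed

lemma Metric_space_mass_seqs: "Metric_space mass_seqs seq_dist"
proof
  fix s s' :: "nat \<Rightarrow> real"
  show "0 \<le> seq_dist s s'"
    by (simp add: seq_dist_def infsum_nonneg)
  show "seq_dist s s' = seq_dist s' s"
    by (simp add: seq_dist_def abs_minus_commute)
next
  fix s s' assume s: "s \<in> mass_seqs" "s' \<in> mass_seqs"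
  show "seq_dist s s' = 0 \<longleftrightarrow> s = s'"
  proof
    assume "seq_dist s s' = 0"
    then have "\<bar>s i - s' i\<bar> = 0" for i
      using nonneg_infsum_le_0D[OF _ seq_dist_summable[OF s], of i]
      by (simp add: seq_dist_def)
    then show "s = s'" by (simp add: fun_eq_iff)
  qed (simp add: seq_dist_def)
next
  fix s s' s'' assume s: "s \<in> mass_seqs" "s' \<in> mass_seqs" "s'' \<in> mass_seqs"
  show "seq_dist s s'' \<le> seq_dist s s' + seq_dist s' s''"
    unfolding seq_dist_def
    by (subst infsum_add[symmetric])
       (use s in \<open>auto intro!: infsum_mono seq_dist_summable summable_on_add\<close>)
qed

text \<open>The Borel $\sigma$-algebra of the metric space of mass sequences.\<close>

definition seq_borel :: "(nat \<Rightarrow> real) measure" where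
  "seq_borel = sigma mass_seqs {U. openin (Metric_space.mtopology mass_seqs seq_dist) U}"

text \<open>
  Decreasing rearrangement of the positive members of a family \<open>(f i)\<close>, \<open>i \<in> I\<close>, padded with zeros.
  The rearrangement is unique if it exists.  It exists as soon as the positive members are summable;
  the default \<open>zero_seq\<close> makes \<open>dec_rearr\<close> take values in \<open>mass_seqs\<close> in all cases.
\<close>

definition is_dec_rearr :: "'i set \<Rightarrow> ('i \<Rightarrow> real) \<Rightarrow> (nat \<Rightarrow> real) \<Rightarrow> bool" where
  "is_dec_rearr I f s \<longleftrightarrow> s \<in> mass_seqs \<and>
     (\<exists>\<pi>. bij_betw \<pi> {k. s k > 0} {i \<in> I. f i > 0} \<and> (\<forall>k. s k > 0 \<longrightarrow> s k = f (\<pi> k)))"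

definition dec_rearr :: "'i set \<Rightarrow> ('i \<Rightarrow> real) \<Rightarrow> nat \<Rightarrow> real" where
  "dec_rearr I f = (if \<exists>s. is_dec_rearr I f s then THE s. is_dec_rearr I f s else zero_seq)"


section \<open>The fragmentation process\<close>

text \<open>
  A realisation \<open>X\<close> of the marks assigns to every node \<open>u\<close> of the Ulam tree the pair \<open>(e_u, S^u)\<close>.
  Nodes are lists with the \<^emph>\<open>last\<close> letter first: the child \<open>ui\<close> of \<open>u\<close> is \<open>i # u\<close>, and \<open>v\<close> descends
  from \<open>u\<close> iff \<open>u\<close> is a suffix of \<open>v\<close>.
  All functionals below are defined realisation by realisation.  Some of them (those using \<open>THE\<close>, or
  \<open>Inf\<close> of a set that may be empty) are meaningful only for almost every realisation.
\<close>

type_synonym marks = "nat list \<Rightarrow> real \<times> (nat \<Rightarrow> real)"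

primrec mass :: "marks \<Rightarrow> nat list \<Rightarrow> real" where
  "mass X [] = 1"
| "mass X (i # u) = mass X u * snd (X u) i"

primrec birth :: "real \<Rightarrow> marks \<Rightarrow> nat list \<Rightarrow> real" where
  "birth \<alpha> X [] = 0"
| "birth \<alpha> X (i # u) = birth \<alpha> X u + mass X u powr (- \<alpha>) * fst (X u)"

definition present :: "real \<Rightarrow> marks \<Rightarrow> real \<Rightarrow> nat list \<Rightarrow> bool" where
  "present \<alpha> X t u \<longleftrightarrow> mass X u > 0 \<and> birth \<alpha> X u \<le> t \<and>
     t < birth \<alpha> X u + mass X u powr (- \<alpha>) * fst (X u)"

definition frag :: "real \<Rightarrow> marks \<Rightarrow> real \<Rightarrow> nat \<Rightarrow> real" where
  "frag \<alpha> X t = dec_rearr {u. present \<alpha> X t u} (mass X)"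

definition ext_time :: "real \<Rightarrow> marks \<Rightarrow> real" where
  "ext_time \<alpha> X = Inf {t. 0 \<le> t \<and> frag \<alpha> X t = zero_seq}"


section \<open>The last fragment\<close>

definition block_ext_time :: "real \<Rightarrow> marks \<Rightarrow> nat list \<Rightarrow> real" where
  "block_ext_time \<alpha> X u = Inf {t. birth \<alpha> X u \<le> t \<and> (\<forall>v. suffix u v \<longrightarrow> \<not> present \<alpha> X t v)}"

definition last_block :: "real \<Rightarrow> marks \<Rightarrow> real \<Rightarrow> nat list" where
  "last_block \<alpha> X t = (THE u. present \<alpha> X t u \<and> block_ext_time \<alpha> X u = ext_time \<alpha> X)"

definition last_mass :: "real \<Rightarrow> marks \<Rightarrow> real \<Rightarrow> real" where
  "last_mass \<alpha> X t = (if t < ext_time \<alpha> X then mass X (last_block \<alpha> X t) else 0)"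

text \<open>The last fragment process is right-continuous with left limits, so its jump times are its
  points of discontinuity.\<close>

primrec jump_time :: "real \<Rightarrow> marks \<Rightarrow> nat \<Rightarrow> real" where
  "jump_time \<alpha> X 0 = 0"
| "jump_time \<alpha> X (Suc n) =
     Inf {t. jump_time \<alpha> X n < t \<and> t < ext_time \<alpha> X \<and> \<not> isCont (last_mass \<alpha> X) t}"

definition Zn :: "real \<Rightarrow> marks \<Rightarrow> nat \<Rightarrow> real" where
  "Zn \<alpha> X n = last_mass \<alpha> X (jump_time \<alpha> X n) powr \<alpha> * (ext_time \<alpha> X - jump_time \<alpha> X n)"

definition Theta :: "real \<Rightarrow> marks \<Rightarrow> nat \<Rightarrow> real" where
  "Theta \<alpha> X n = (if n = 0 then 1
     else last_mass \<alpha> X (jump_time \<alpha> X n) / last_mass \<alpha> X (jump_time \<alpha> X (n - 1)))"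

definition Delta :: "real \<Rightarrow> marks \<Rightarrow> nat \<Rightarrow> nat \<Rightarrow> real" where
  "Delta \<alpha> X n = (if n = 0 then zero_seq
     else let u = last_block \<alpha> X (jump_time \<alpha> X (n - 1)) in
       dec_rearr {i. i # u \<noteq> last_block \<alpha> X (jump_time \<alpha> X n)}
         (\<lambda>i. mass X (i # u) / last_mass \<alpha> X (jump_time \<alpha> X (n - 1))))"

definition Yn :: "real \<Rightarrow> marks \<Rightarrow> nat \<Rightarrow> real" where
  "Yn \<alpha> X n = (if n = 0 then ext_time \<alpha> X powr (1 / \<alpha>)
     else ((ext_time \<alpha> X - jump_time \<alpha> X n) / (ext_time \<alpha> X - jump_time \<alpha> X (n - 1))) powr (1 / \<alpha>))"

text \<open>In \<^typ>\<open>ereal\<close> the supremum of the empty set is \<open>-\<infinity>\<close>.\<close>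

definition N_eps :: "real \<Rightarrow> real \<Rightarrow> marks \<Rightarrow> ereal" where
  "N_eps \<alpha> \<epsilon> X = (SUP n \<in> {n. ext_time \<alpha> X - \<epsilon> \<ge> jump_time \<alpha> X n}. ereal (real n))"

text \<open>The integer value of \<open>N_eps\<close> where it is finite.\<close>

definition N_int :: "real \<Rightarrow> real \<Rightarrow> marks \<Rightarrow> int" where
  "N_int \<alpha> \<epsilon> X = \<lfloor>real_of_ereal (N_eps \<alpha> \<epsilon> X)\<rfloor>"

definition R_eps :: "real \<Rightarrow> real \<Rightarrow> marks \<Rightarrow> int \<Rightarrow> real" where
  "R_eps \<alpha> \<epsilon> X k = inverse \<epsilon> * (\<Prod>i = 0..nat (N_int \<alpha> \<epsilon> X + k). Yn \<alpha> X i powr \<alpha>)"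

definition is_K_eps :: "real \<Rightarrow> real \<Rightarrow> marks \<Rightarrow> real \<Rightarrow> int \<Rightarrow> bool" where
  "is_K_eps \<alpha> \<epsilon> X t k \<longleftrightarrow>
     - N_int \<alpha> \<epsilon> X \<le> k \<and> R_eps \<alpha> \<epsilon> X k \<ge> t \<and> t > R_eps \<alpha> \<epsilon> X (k + 1)"

definition Theta_prod :: "real \<Rightarrow> marks \<Rightarrow> int \<Rightarrow> real" where
  "Theta_prod \<alpha> X n = (\<Prod>j = 0..nat n. Theta \<alpha> X j)"


section \<open>Laws of processes\<close>

text \<open>Paths on $[0,\infty)$, with the product $\sigma$-algebra.\<close>

definition path_space :: "(real \<Rightarrow> nat \<Rightarrow> real) measure" where
  "path_space = (\<Pi>\<^sub>M t \<in> {0..}. seq_borel)"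

text \<open>
  The law of the time-reversed fragmentation conditioned on extinction before \<open>x\<close>;
  \<^const>\<open>uniform_measure\<close> is conditioning on an event.
\<close>

definition rev_cond_law ::
    "'a measure \<Rightarrow> real \<Rightarrow> ('a \<Rightarrow> marks) \<Rightarrow> real \<Rightarrow> (real \<Rightarrow> nat \<Rightarrow> real) measure" where
  "rev_cond_law P \<alpha> X x =
     distr (uniform_measure P {\<omega> \<in> space P. ext_time \<alpha> (X \<omega>) < x}) path_space
       (\<lambda>\<omega>. \<lambda>t\<in>{0..}. if t \<le> x then frag \<alpha> (X \<omega>) (x - t) else zero_seq)"

text \<open>The $\sigma$-algebra generated by $(Z_n, \Theta_n, \Delta_n)$, $n \ge 0$.\<close>

definition spine_algebra :: "'a measure \<Rightarrow> real \<Rightarrow> ('a \<Rightarrow> marks) \<Rightarrow> 'a measure" where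
  "spine_algebra P \<alpha> X =
     vimage_algebra (space P)
       (\<lambda>\<omega> n. (Zn \<alpha> (X \<omega>) n, Theta \<alpha> (X \<omega>) n, Delta \<alpha> (X \<omega>) n))
       (\<Pi>\<^sub>M n \<in> UNIV. borel \<Otimes>\<^sub>M (borel \<Otimes>\<^sub>M seq_borel))"

text \<open>
  Conditionally on \<open>G\<close>, the \<open>Q\<close>-valued variables \<open>(Y j)\<close> are independent with respective conditional
  laws \<open>\<kappa> j \<omega>\<close>.  The index set \<open>act \<omega>\<close> of the family may itself depend on \<open>\<omega>\<close> (through \<open>G\<close>):
  the assertion for a finite set of indices concerns those \<open>\<omega>\<close> at which all of them occur.
\<close>

definition cond_indep_with_laws ::
    "'a measure \<Rightarrow> 'a measure \<Rightarrow> 'b measure \<Rightarrow> ('a \<Rightarrow> 'j set) \<Rightarrow> ('j \<Rightarrow> 'a \<Rightarrow> 'b)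
       \<Rightarrow> ('j \<Rightarrow> 'a \<Rightarrow> 'b measure) \<Rightarrow> bool" where
  "cond_indep_with_laws P G Q act Y \<kappa> \<longleftrightarrow>
     subalgebra P G \<and> (\<forall>j. Y j \<in> measurable P Q) \<and>
     (\<forall>J A. finite J \<longrightarrow> (\<forall>j\<in>J. A j \<in> sets Q) \<longrightarrow>
        (AE \<omega> in P. J \<subseteq> act \<omega> \<longrightarrow>
           real_cond_exp P G (indicator {\<omega> \<in> space P. \<forall>j\<in>J. Y j \<omega> \<in> A j}) \<omega>
             = (\<Prod>j\<in>J. measure (\<kappa> j \<omega>) (A j))))"

end

theory Submission
  imports Defs
begin

text \<open>
  The last fragment follows the ray of the Ulam tree (the spine) which at every node passes to
  the child whose subtree becomes extinct last. Choose \<open>p\<close> with \<open>- \<alpha> p > 1\<close>. Since the children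
  of a node of mass \<open>m\<close> satisfy \<open>E (\<Sum>\<^sub>i m\<^sub>i powr (- \<alpha> p)) = \<rho> m powr (- \<alpha> p)\<close> with \<open>\<rho> < 1\<close>, the
  \<open>p\<close>-th powers of the lifetimes of all blocks, with geometric weights in the generation, have a
  finite expected sum. Hence the extinction time is finite, each maximum over the children of a
  node is attained, and the birth times along the spine tend to the extinction time. The maximum
  is unique because the lifetimes have a density. A block alive at a given time lies on the
  spine or below a sibling of a spine node, and below such a sibling the process is a rescaled
  fragmentation; this is the pathwise part.

  For the conditional law, fix a node \<open>u\<close> and cut off the subtrees of some siblings \<open>w\<close> of the
  path to \<open>u\<close>. The spine passes through \<open>u\<close> iff the spine of the cut tree does and each of the
  subtrees that were removed becomes extinct before the subtree of \<open>u\<close>. The spine data and the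
  thresholds \<open>\<Delta> powr \<alpha> * \<Theta> powr (- \<alpha>) * Z\<close> are then functions of the cut tree, which is
  independent of the removed subtrees, so given the cut tree these are independent
  fragmentations conditioned on extinction before the thresholds. As the conditional laws depend
  on the spine data only, the tower property finishes the proof.
\<close>

section \<open>Decreasing rearrangements\<close>

text \<open>That \<open>\<rho> < 1\<close> is conservation of mass combined with the fact that
  \<open>\<nu>\<close> does not charge \<open>one_seq\<close>: the largest child has relative mass
  below 1 almost surely. Two obstacles shape the rest. The notions of the statement are built with
  \<open>THE\<close> and with infima of sets that may be empty, so their measurability is not
  visible. They are replaced by functionals of the marks that are measurable everywhere and agree
  with them almost surely; the completion of \<open>M\<close> absorbs the difference. Moreover the
  spine is chosen by comparing all subtrees, so it is correlated with the side subtrees, which sit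
  at random nodes and are numbered from the random index \<open>N_int\<close>. Fixing the value of
  \<open>N_int\<close> and a spine node of a deep enough generation makes all these nodes
  deterministic. The threshold arises as the time left until the extinction of everything, measured
  on the clock of a side subtree, whose unit is the mass of its root to the power
  \<open>- \<alpha>\<close>; the mass of the spine node cancels between \<open>Theta\<close> and
  \<open>Zn\<close>.\<close>

lemma decseq_gt_iff_card:
  fixes s :: "nat \<Rightarrow> real"
  assumes "decseq s"
  shows "s k > c \<longleftrightarrow> (\<exists>F. finite F \<and> F \<subseteq> {k. s k > c} \<and> card F = Suc k)"
proof
  assume "s k > c"
  moreover have "s k \<le> s j" if "j \<le> k" for j using assms that by (rule decseqD)
  ultimately show "\<exists>F. finite F \<and> F \<subseteq> {k. s k > c} \<and> card F = Suc k"
    by (intro exI[of _ "{..k}"]) (auto intro: less_le_trans)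
next
  assume "\<exists>F. finite F \<and> F \<subseteq> {k. s k > c} \<and> card F = Suc k"
  then obtain F where F: "finite F" "F \<subseteq> {k. s k > c}" "card F = Suc k" by blast
  have "\<not> F \<subseteq> {..<k}"
    using F card_mono[of "{..<k}" F] by auto
  then obtain j where "j \<in> F" "j \<ge> k" using not_less by blast
  then show "s k > c" using F decseqD[OF assms, of k j] by (auto intro: less_le_trans)
qed

text \<open>The bijection \<open>\<pi>\<close> restricts to the entries and members above any level
  \<open>c \<ge> 0\<close>, and a decreasing sequence is determined by the sizes of its level sets.
  The right-hand side does not mention \<open>s\<close>: this gives uniqueness of the rearrangement,
  and later its measurability.\<close>

lemma is_dec_rearr_gt_iff:
  assumes "is_dec_rearr I f s" "c \<ge> 0"
  shows "s k > c \<longleftrightarrow> (\<exists>F. finite F \<and> F \<subseteq> {i \<in> I. f i > c} \<and> card F = Suc k)"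
proof -
  obtain \<pi> where \<pi>: "bij_betw \<pi> {k. s k > 0} {i \<in> I. f i > 0}" "\<And>k. s k > 0 \<Longrightarrow> s k = f (\<pi> k)"
    using assms(1) by (auto simp: is_dec_rearr_def)
  have "decseq s" using assms(1) by (auto simp: is_dec_rearr_def mass_seqs_def)
  have bij: "bij_betw \<pi> {k. s k > c} {i \<in> I. f i > c}"
  proof (rule bij_betw_subset[OF \<pi>(1)])
    show "{k. c < s k} \<subseteq> {k. 0 < s k}" using assms(2) by auto
    have "i \<in> \<pi> ` {k. c < s k}" if "i \<in> I" "f i > c" for i
    proof -
      have "i \<in> \<pi> ` {k. s k > 0}" using \<pi>(1) that assms(2) by (auto simp: bij_betw_def)
      then show ?thesis using \<pi>(2) that by force
    qed
    moreover have "\<pi> k \<in> I" "f (\<pi> k) > c" if "s k > c" for k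
      using bij_betwE[OF \<pi>(1)] \<pi>(2)[of k] that assms(2) by auto
    ultimately show "\<pi> ` {k. c < s k} = {i \<in> I. c < f i}" by auto
  qed
  have "(\<exists>F. finite F \<and> F \<subseteq> {k. s k > c} \<and> card F = Suc k) \<longleftrightarrow>
        (\<exists>F. finite F \<and> F \<subseteq> {i \<in> I. f i > c} \<and> card F = Suc k)" (is "?l \<longleftrightarrow> ?r")
  proof
    assume ?l
    then obtain F where F: "finite F" "F \<subseteq> {k. s k > c}" "card F = Suc k" by blast
    have "inj_on \<pi> F" using bij F by (meson bij_betw_def inj_on_subset)
    then show ?r using F bij by (intro exI[of _ "\<pi> ` F"]) (auto simp: card_image bij_betw_def)
  next
    assume ?r
    then obtain F where F: "finite F" "F \<subseteq> {i \<in> I. f i > c}" "card F = Suc k" by blast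
    obtain B where B: "B \<subseteq> {k. s k > c}" "F = \<pi> ` B"
      using F bij by (metis bij_betw_def subset_imageE)
    have "inj_on \<pi> B" using bij B by (meson bij_betw_def inj_on_subset)
    then show ?l using B F by (intro exI[of _ B]) (auto simp: card_image finite_image_iff)
  qed
  then show ?thesis using decseq_gt_iff_card[OF \<open>decseq s\<close>] by blast
qed

lemma is_dec_rearr_unique:
  assumes "is_dec_rearr I f s" "is_dec_rearr I f s'"
  shows "s = s'"
proof
  fix k
  have "0 \<le> s k" "0 \<le> s' k" using assms by (auto simp: is_dec_rearr_def mass_seqs_def)
  then show "s k = s' k"
    using is_dec_rearr_gt_iff[OF assms(1), of "s' k" k]
        is_dec_rearr_gt_iff[OF assms(2), of "s' k" k]
      is_dec_rearr_gt_iff[OF assms(1), of "s k" k] is_dec_rearr_gt_iff[OF assms(2), of "s k" k]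
    by (metis less_irrefl linorder_neq_iff)
qed

lemma dec_rearr_eqI: "is_dec_rearr I f s \<Longrightarrow> dec_rearr I f = s"
  unfolding dec_rearr_def using is_dec_rearr_unique by (metis the_equality)

lemma zero_seq_in_mass_seqs [simp]: "zero_seq \<in> mass_seqs"
  by (auto simp: zero_seq_def mass_seqs_def decseq_def)

lemma dec_rearr_in_mass_seqs [simp]: "dec_rearr I f \<in> mass_seqs"
proof (cases "\<exists>s. is_dec_rearr I f s")
  case True
  then obtain s where s: "is_dec_rearr I f s" ..
  then show ?thesis using dec_rearr_eqI[OF s] by (auto simp: is_dec_rearr_def)
qed (simp add: dec_rearr_def)

lemma mass_seqs_nonneg: "s \<in> mass_seqs \<Longrightarrow> 0 \<le> s k"
  by (auto simp: mass_seqs_def)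

text \<open>Composing with \<open>h\<close> or with its inverse shows that both families have the
  same rearrangements, so the equality also covers the default value and no summability has to be
  checked.\<close>

lemma dec_rearr_reindex:
  assumes b: "bij_betw h {i \<in> I. f i > 0} {j \<in> J. g j > 0}"
    and e: "\<And>i. i \<in> I \<Longrightarrow> f i > 0 \<Longrightarrow> g (h i) = f i"
  shows "dec_rearr I f = dec_rearr J g"
proof -
  have "is_dec_rearr J g s" if s: "is_dec_rearr I f s" for s
  proof -
    obtain \<pi> where \<pi>: "bij_betw \<pi> {k. s k > 0} {i \<in> I. f i > 0}" "\<And>k. s k > 0 \<Longrightarrow> s k = f (\<pi> k)"
      using s by (auto simp: is_dec_rearr_def)
    have "g (h (\<pi> k)) = s k" if "s k > 0" for k
      using e[of "\<pi> k"] bij_betwE[OF \<pi>(1)] \<pi>(2)[OF that] that by auto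
    then show ?thesis using s bij_betw_trans[OF \<pi>(1) b]
      by (auto simp: is_dec_rearr_def intro!: exI[of _ "h \<circ> \<pi>"])
  qed
  moreover have "is_dec_rearr I f s" if s: "is_dec_rearr J g s" for s
  proof -
    obtain \<pi> where \<pi>: "bij_betw \<pi> {k. s k > 0} {j \<in> J. g j > 0}" "\<And>k. s k > 0 \<Longrightarrow> s k = g (\<pi> k)"
      using s by (auto simp: is_dec_rearr_def)
    define h' where "h' = the_inv_into {i \<in> I. f i > 0} h"
    have h': "bij_betw h' {j \<in> J. g j > 0} {i \<in> I. f i > 0}"
      unfolding h'_def by (rule bij_betw_the_inv_into[OF b])
    have "f (h' j) = g j" if "j \<in> J" "g j > 0" for j
    proof -
      have "h (h' j) = j" unfolding h'_def
        using b that by (intro f_the_inv_into_f) (auto simp: bij_betw_def)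
      moreover have "h' j \<in> I" "f (h' j) > 0" using bij_betwE[OF h'] that by auto
      ultimately show ?thesis using e by metis
    qed
    then have "f (h' (\<pi> k)) = s k" if "s k > 0" for k
      using bij_betwE[OF \<pi>(1)] \<pi>(2)[OF that] that by auto
    then show ?thesis using s bij_betw_trans[OF \<pi>(1) h']
      by (auto simp: is_dec_rearr_def intro!: exI[of _ "h' \<circ> \<pi>"])
  qed
  ultimately have "is_dec_rearr I f = is_dec_rearr J g" by (intro ext iffI)
  then show ?thesis unfolding dec_rearr_def by (simp only:)
qed

text \<open>
  Rank the indices by value, breaking ties by an injective code; since only finitely many
  indices have a value above a given positive level, the ranks are natural numbers.
\<close>

lemma ex_is_dec_rearr:
  fixes f :: "'i :: countable \<Rightarrow> real"
  assumes bnd: "\<And>F. finite F \<Longrightarrow> F \<subseteq> {i \<in> I. f i > 0} \<Longrightarrow> sum f F \<le> C"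
  shows "\<exists>s. is_dec_rearr I f s"
proof -
  define A where "A = {i \<in> I. f i > 0}"
  define lt where "lt i j \<longleftrightarrow> f i > f j \<or> (f i = f j \<and> to_nat i < to_nat j)" for i j
  have trans: "lt i j \<Longrightarrow> lt j k \<Longrightarrow> lt i k" for i j k by (auto simp: lt_def)
  have irr: "\<not> lt i i" for i by (auto simp: lt_def)
  have tot: "lt i j \<or> lt j i" if "i \<noteq> j" for i j
  proof -
    have "to_nat i \<noteq> to_nat j" using that inj_to_nat by (metis injD)
    then show ?thesis unfolding lt_def by linarith
  qed
  have fin: "finite {i \<in> A. f i \<ge> c}" if c: "c > 0" for c
  proof (rule ccontr)
    assume inf: "infinite {i \<in> A. f i \<ge> c}"
    obtain n :: nat where n: "real n * c > C" using reals_Archimedean3[OF c] by blast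
    obtain F where F: "F \<subseteq> {i \<in> A. f i \<ge> c}" "finite F" "card F = n"
      using infinite_arbitrarily_large[OF inf] by blast
    have "real n * c = (\<Sum>i\<in>F. c)" using F by simp
    also have "\<dots> \<le> sum f F" using F by (intro sum_mono) auto
    also have "\<dots> \<le> C" using F by (intro bnd) (auto simp: A_def)
    finally show False using n by simp
  qed
  define pr where "pr i = {j \<in> A. lt j i}" for i
  define rk where "rk i = card (pr i)" for i
  have finpr: "finite (pr i)" if "i \<in> A" for i
    by (rule finite_subset[OF _ fin[of "f i"]]) (use that in \<open>auto simp: A_def lt_def pr_def\<close>)
  have mono: "rk i < rk j" if "lt i j" "i \<in> A" "j \<in> A" for i j
    unfolding rk_def
  proof (rule psubset_card_mono[OF finpr[OF that(3)]])
    have "pr i \<subseteq> pr j" using trans[OF _ that(1)] by (auto simp: pr_def)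
    moreover have "i \<in> pr j" "i \<notin> pr i" using that irr by (auto simp: pr_def)
    ultimately show "pr i \<subset> pr j" by blast
  qed
  have inj: "inj_on rk A"
    by (rule inj_onI) (metis mono tot less_irrefl)
  \<comment> \<open>The \<open>rk i\<close> predecessors of \<open>i\<close> have distinct ranks
    below \<open>rk i\<close>, so they exhaust these ranks: the ranks form an initial segment, as
    the support of a decreasing sequence must.\<close>
  have down: "k \<in> rk ` A" if "i \<in> A" "k < rk i" for i k
  proof -
    have "rk ` pr i \<subseteq> {..<rk i}" using mono that(1) by (auto simp: pr_def)
    moreover have "card (rk ` pr i) = rk i"
      using inj_on_subset[OF inj, of "pr i"] by (subst card_image) (auto simp: rk_def pr_def)
    ultimately have "rk ` pr i = {..<rk i}" by (intro card_subset_eq) auto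
    then show ?thesis using that(2) by (auto simp: pr_def)
  qed
  define \<pi> where "\<pi> = the_inv_into A rk"
  define s where "s k = (if k \<in> rk ` A then f (\<pi> k) else 0)" for k
  have \<pi>: "bij_betw \<pi> (rk ` A) A" unfolding \<pi>_def
    by (rule bij_betw_the_inv_into) (use inj in \<open>auto simp: bij_betw_def\<close>)
  have rk\<pi>: "rk (\<pi> k) = k" if "k \<in> rk ` A" for k
    unfolding \<pi>_def by (rule f_the_inv_into_f[OF inj that])
  have \<pi>A: "\<pi> k \<in> A" if "k \<in> rk ` A" for k using bij_betwE[OF \<pi>] that by blast
  have spos: "{k. s k > 0} = rk ` A"
    using \<pi>A by (auto simp: s_def A_def split: if_splits)
  have "decseq s"
  proof (rule decseq_SucI)
    fix k
    show "s (Suc k) \<le> s k"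
    proof (cases "Suc k \<in> rk ` A")
      case True
      then have k: "k \<in> rk ` A" using down[OF \<pi>A[OF True], of k] rk\<pi>[OF True] by simp
      have "lt (\<pi> k) (\<pi> (Suc k))"
        using mono[of "\<pi> (Suc k)" "\<pi> k"] tot[of "\<pi> k" "\<pi> (Suc k)"] rk\<pi>[OF k] rk\<pi>[OF True] \<pi>A[OF k]
            \<pi>A[OF True]
        by force
      then show ?thesis using k True by (auto simp: s_def lt_def)
    next
      case False
      then show ?thesis using \<pi>A[of k] by (auto simp: s_def A_def)
    qed
  qed
  moreover have s0: "0 \<le> s k" for k using \<pi>A[of k] by (auto simp: s_def A_def)
  moreover have "summable s"
  proof (rule bounded_imp_summable[OF s0])
    fix n
    define K where "K = {..n} \<inter> rk ` A"
    have "inj_on \<pi> K" using \<pi> by (auto simp: bij_betw_def K_def intro: inj_on_subset)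
    have "sum s {..n} = sum s K" unfolding K_def by (rule sum.mono_neutral_right) (auto simp: s_def)
    also have "\<dots> = sum f (\<pi> ` K)"
      using \<open>inj_on \<pi> K\<close> by (subst sum.reindex) (auto simp: s_def K_def)
    also have "\<dots> \<le> C" using \<pi>A by (intro bnd) (auto simp: K_def A_def)
    finally show "sum s {..n} \<le> C" .
  qed
  ultimately have "s \<in> mass_seqs" by (auto simp: mass_seqs_def)
  then have "is_dec_rearr I f s"
    unfolding is_dec_rearr_def spos using \<pi> by (auto simp: A_def s_def intro!: exI[of _ \<pi>])
  then show ?thesis by (intro exI[of _ s])
qed

lemma dec_rearr_is_dec_rearr: "\<exists>s. is_dec_rearr I f s \<Longrightarrow> is_dec_rearr I f (dec_rearr I f)"
  using dec_rearr_eqI by metis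

lemma is_dec_rearr_eq_zero_iff:
  assumes "is_dec_rearr I f s"
  shows "s = zero_seq \<longleftrightarrow> (\<forall>i\<in>I. f i \<le> 0)"
proof -
  obtain \<pi> where \<pi>: "bij_betw \<pi> {k. s k > 0} {i \<in> I. f i > 0}"
    using assms by (auto simp: is_dec_rearr_def)
  have "s k \<ge> 0" for k using assms by (auto simp: is_dec_rearr_def mass_seqs_def)
  then have "s = zero_seq \<longleftrightarrow> {k. s k > 0} = {}"
    by (auto simp: zero_seq_def fun_eq_iff order_less_le)
  also have "\<dots> \<longleftrightarrow> {i \<in> I. f i > 0} = {}" using \<pi> by (auto simp: bij_betw_def)
  also have "\<dots> \<longleftrightarrow> (\<forall>i\<in>I. f i \<le> 0)" by (auto simp: not_less)
  finally show ?thesis .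
qed

section \<open>Masses and birth times on the Ulam tree\<close>

text \<open>The marks of the subtree at \<open>w\<close>, read as a tree of their own. Since the
  last letter comes first, a path inside the subtree is prepended to \<open>w\<close>.\<close>

definition sub :: "marks \<Rightarrow> nat list \<Rightarrow> marks" where
  "sub X w = (\<lambda>v. X (v @ w))"

definition valid_marks :: "marks \<Rightarrow> bool" where
  "valid_marks X \<longleftrightarrow> (\<forall>u. snd (X u) \<in> unit_mass_seqs)"

lemma unit_mass_seqsD:
  assumes "s \<in> unit_mass_seqs"
  shows "s \<in> mass_seqs" "decseq s" "0 \<le> s i" "summable s" "suminf s = 1" "s i \<le> 1" "0 < s 0"
proof -
  show *: "s \<in> mass_seqs" "decseq s" "0 \<le> s i" "summable s" "suminf s = 1"
    using assms by (auto simp: unit_mass_seqs_def mass_seqs_def)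
  have nn: "0 \<le> s j" for j using assms by (auto simp: unit_mass_seqs_def mass_seqs_def)
  show "s i \<le> 1" using sum_le_suminf[OF *(4), of "{i}"] nn * by auto
  show "0 < s 0"
  proof (rule ccontr)
    assume "\<not> 0 < s 0"
    then have "s j = 0" for j using decseqD[OF *(2), of 0 j] nn[of j] by simp
    then have "s = (\<lambda>_. 0)" by (simp add: fun_eq_iff)
    then show False using *(5) by simp
  qed
qed

lemma valid_sub: "valid_marks X \<Longrightarrow> valid_marks (sub X w)"
  by (auto simp: valid_marks_def sub_def)

lemma valid_nonneg: "valid_marks X \<Longrightarrow> 0 \<le> snd (X u) i"
  using unit_mass_seqsD by (auto simp: valid_marks_def)

lemma mass_nonneg: "valid_marks X \<Longrightarrow> 0 \<le> mass X u"
  by (induction u) (auto simp: valid_nonneg)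

lemma mass_append: "mass X (v @ w) = mass X w * mass (sub X w) v"
  by (induction v) (auto simp: sub_def)

lemma birth_append:
  assumes "valid_marks X"
  shows "birth \<alpha> X (v @ w) = birth \<alpha> X w + mass X w powr (- \<alpha>) * birth \<alpha> (sub X w) v"
  by (induction v)
    (auto simp: sub_def[of X w] mass_append[of X, unfolded sub_def] powr_mult algebra_simps)

lemma mass_sum_children_le:
  assumes "valid_marks X" "finite I"
  shows "(\<Sum>i\<in>I. mass X (i # u)) \<le> mass X u"
proof -
  have "sum (snd (X u)) I \<le> suminf (snd (X u))"
    using assms by (intro sum_le_suminf) (auto simp: valid_marks_def unit_mass_seqsD)
  also have "\<dots> = 1" using assms by (auto simp: valid_marks_def unit_mass_seqsD)
  finally have "mass X u * sum (snd (X u)) I \<le> mass X u"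
    using mass_nonneg[OF assms(1), of u] by (simp add: mult_left_le)
  then show ?thesis by (simp add: sum_distrib_left)
qed

lemma suffix_same_length: "suffix u v \<Longrightarrow> suffix w v \<Longrightarrow> length u = length w \<Longrightarrow> u = w"
  using suffix_length_suffix[of u v w] suffix_length_suffix[of w v u]
      by (simp add: suffix_order.antisym)

lemma suffix_Cons_same: "suffix (i # u) v \<Longrightarrow> suffix (j # u) v \<Longrightarrow> i = j"
  using suffix_same_length[of "i # u" v "j # u"] by simp

lemma suffix_cases_Cons:
  assumes "suffix u v"
  obtains "v = u" | i where "suffix (i # u) v"
proof -
  obtain z where z: "v = z @ u" using assms by (auto simp: suffix_def)
  show thesis
  proof (cases z rule: rev_cases)
    case Nil
    then show ?thesis using z that by simp
  next
    case (snoc y i)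
    then have "v = y @ i # u" using z by simp
    then show ?thesis using that(2) by (metis suffixI)
  qed
qed

text \<open>The members split according to the child of \<open>u\<close> from which they descend,
  and the masses of the children add up to at most that of \<open>u\<close>; the induction is on the
  depth \<open>n\<close> below \<open>u\<close>. The bound is applied to the blocks alive at a
  common time, none of which descends from another.\<close>

lemma mass_sum_antichain_below_le:
  assumes "valid_marks X" "finite F" "\<And>v w. v \<in> F \<Longrightarrow> w \<in> F \<Longrightarrow> suffix v w \<Longrightarrow> v = w"
    and "\<And>v. v \<in> F \<Longrightarrow> suffix u v" "\<And>v. v \<in> F \<Longrightarrow> length v \<le> length u + n"
  shows "(\<Sum>v\<in>F. mass X v) \<le> mass X u"
  using assms(2-)
proof (induction n arbitrary: u F)
  case 0
  then have "F \<subseteq> {u}"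
    by (metis suffix_same_length suffix_length_le le_antisym add_0_right suffix_order.refl
        singletonI subsetI)
  then show ?case using mass_nonneg[OF assms(1), of u]
      by (cases "F = {}") (auto simp: subset_singleton_iff)
next
  case (Suc n)
  show ?case
  proof (cases "u \<in> F")
    case True
    then have "F = {u}" using Suc.prems by blast
    then show ?thesis by simp
  next
    case False
    define I where "I = (\<lambda>v. SOME i. suffix (i # u) v) ` F"
    define G where "G i = {v \<in> F. suffix (i # u) v}" for i
    have *: "\<exists>i\<in>I. v \<in> G i" if "v \<in> F" for v
    proof -
      have "\<exists>i. suffix (i # u) v"
        using Suc.prems(3)[OF that] False that by (metis suffix_cases_Cons)
      then have "suffix ((SOME i. suffix (i # u) v) # u) v" by (rule someI_ex)
      then show ?thesis using that by (auto simp: I_def G_def)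
    qed
    have disj: "G i \<inter> G j = {}" if "i \<noteq> j" for i j using that suffix_Cons_same[of i u _ j]
        by (auto simp: G_def)
    have "F = (\<Union>i\<in>I. G i)" using * by (auto simp: G_def)
    then have "(\<Sum>v\<in>F. mass X v) = (\<Sum>i\<in>I. \<Sum>v\<in>G i. mass X v)"
      using Suc.prems(1) disj by (subst sum.UNION_disjoint[symmetric]) (auto simp: I_def G_def)
    also have "\<dots> \<le> (\<Sum>i\<in>I. mass X (i # u))"
      using Suc.prems by (intro sum_mono Suc.IH) (auto simp: G_def)
    also have "\<dots> \<le> mass X u"
      using Suc.prems(1) by (intro mass_sum_children_le assms(1)) (auto simp: I_def)
    finally show ?thesis .
  qed
qed

lemma mass_sum_antichain_le:
  assumes "valid_marks X" "finite F" "\<And>v w. v \<in> F \<Longrightarrow> w \<in> F \<Longrightarrow> suffix v w \<Longrightarrow> v = w"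
  shows "(\<Sum>v\<in>F. mass X v) \<le> 1"
  using mass_sum_antichain_below_le[OF assms, of "[]" "Max (length ` F)"] assms(2)
  by (auto intro: Max_ge)

section \<open>Extinction times of subtrees and the spine\<close>

text \<open>
  The guard makes this a supremum of a bounded family at every realisation, which gives
  measurability on the whole space of marks.
\<close>

definition subtree_ext :: "real \<Rightarrow> marks \<Rightarrow> nat list \<Rightarrow> real" where
  "subtree_ext \<alpha> X u = (SUP v. if bdd_above (range (birth \<alpha> X)) then birth \<alpha> X (v @ u) else 0)"

text \<open>The strict inequalities hold for at most one index, so \<open>LEAST\<close> only serves
  to name it in a form whose measurability is immediate.\<close>

definition lead :: "real \<Rightarrow> marks \<Rightarrow> nat list \<Rightarrow> nat" where
  "lead \<alpha> X u = (LEAST i. \<forall>j. j \<noteq> i \<longrightarrow> subtree_ext \<alpha> X (j # u) < subtree_ext \<alpha> X (i # u))"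

primrec spine :: "real \<Rightarrow> marks \<Rightarrow> nat \<Rightarrow> nat list" where
  "spine \<alpha> X 0 = []"
| "spine \<alpha> X (Suc n) = lead \<alpha> X (spine \<alpha> X n) # spine \<alpha> X n"

text \<open>Asks that every step of the path to \<open>u\<close> be the strict maximum among the
  siblings. The recursion of \<open>spine\<close> picks a node of every generation even where no
  strict maximum exists, so \<open>on_spine\<close> is the stronger notion in general; it is the one
  that can be compared between a tree and its cut version.\<close>

primrec on_spine :: "real \<Rightarrow> marks \<Rightarrow> nat list \<Rightarrow> bool" where
  "on_spine \<alpha> X [] \<longleftrightarrow> True"
| "on_spine \<alpha> X (i # u) \<longleftrightarrow> on_spine \<alpha> X u \<and>
     (\<forall>j. j \<noteq> i \<longrightarrow> subtree_ext \<alpha> X (j # u) < subtree_ext \<alpha> X (i # u))"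

lemma length_spine [simp]: "length (spine \<alpha> X n) = n"
  by (induction n) auto

lemma suffix_spine: "m \<le> n \<Longrightarrow> suffix (spine \<alpha> X m) (spine \<alpha> X n)"
  by (induction n rule: dec_induct) (auto intro: suffix_ConsI)

text \<open>The regularity that survives both passing to a subtree of positive mass and cutting.
  Removed nodes receive lifetime 0 and do not split, so lifetimes are only required to be
  nonnegative and nothing is said about ties.\<close>

locale bounded_marks =
  fixes \<alpha> :: real and X :: marks
  assumes valid: "valid_marks X"
    and fst_nonneg: "0 \<le> fst (X u)"
    and bdd: "bdd_above (range (birth \<alpha> X))"
begin

abbreviation "B \<equiv> birth \<alpha> X"
abbreviation "\<M> \<equiv> mass X"
abbreviation "E \<equiv> subtree_ext \<alpha> X"

lemma birth_Cons_ge: "B u \<le> B (i # u)"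
  using fst_nonneg[of u] by simp

lemma birth_mono: "suffix u v \<Longrightarrow> B u \<le> B v"
proof -
  have "B u \<le> B (w @ u)" for w
  proof (induction w)
    case (Cons i w)
    then show ?case using birth_Cons_ge[of "w @ u" i] by simp
  qed simp
  then show "suffix u v \<Longrightarrow> B u \<le> B v" by (auto simp: suffix_def)
qed

lemma birth_nonneg: "0 \<le> B u"
  using birth_mono[of "[]" u] by simp

lemma E_eq: "E u = (SUP v. B (v @ u))"
  using bdd by (simp add: subtree_ext_def)

lemma bdd_below_node: "bdd_above (range (\<lambda>v. B (v @ u)))"
  using bdd by (rule bdd_above_mono) auto

lemma birth_le_E: "suffix u v \<Longrightarrow> B v \<le> E u"
  unfolding E_eq suffix_def using bdd_below_node by (auto intro: cSUP_upper)

lemma E_least: "(\<And>v. suffix u v \<Longrightarrow> B v \<le> c) \<Longrightarrow> E u \<le> c"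
  unfolding E_eq by (rule cSUP_least) (auto simp: suffixI)

lemma less_E: "t < E u \<Longrightarrow> \<exists>v. suffix u v \<and> t < B v"
  using E_least[of u t] by (meson not_less)

lemma E_antimono: "suffix u v \<Longrightarrow> E v \<le> E u"
  by (rule E_least) (auto intro: birth_le_E suffix_order.trans)

lemma mass_pos_of_birth_less: "B u < B (i # u) \<Longrightarrow> 0 < \<M> u"
  using mass_nonneg[OF valid, of u] by (cases "\<M> u = 0") auto

text \<open>A block dies when its children are born, and child \<open>0\<close> stands for that
  instant. A lifetime of positive length forces positive mass, since a block of mass 0 contributes
  no time.\<close>

lemma present_iff: "present \<alpha> X t u \<longleftrightarrow> B u \<le> t \<and> t < B (0 # u)"
  unfolding present_def using mass_pos_of_birth_less[of u 0] by auto

text \<open>On the path from \<open>u\<close> down to \<open>v\<close>, the last node born by time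
  \<open>t\<close> has its children born after \<open>t\<close>, hence is alive at
  \<open>t\<close>.\<close>

lemma present_crossing:
  assumes "suffix u v" "B u \<le> t" "t < B v"
  shows "\<exists>w. suffix u w \<and> present \<alpha> X t w"
  using assms
proof (induction v)
  case Nil
  then show ?case by simp
next
  case (Cons i v)
  show ?case
  proof (cases "suffix u v \<and> t < B v")
    case True
    then show ?thesis using Cons by blast
  next
    case False
    have "u \<noteq> i # v" using Cons.prems by auto
    then have "suffix u v" using Cons.prems(1) by (auto simp: suffix_Cons)
    then show ?thesis using False Cons.prems by (auto simp: present_iff)
  qed
qed

text \<open>Both extinction times of the statement are infima of sets of times at which no
  descendant is present. By this equivalence these sets are half-lines starting at
  \<open>E u\<close>, so the infima turn into suprema of birth times.\<close>

lemma ex_present_below_iff: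
  assumes "B u \<le> t"
  shows "(\<exists>v. suffix u v \<and> present \<alpha> X t v) \<longleftrightarrow> t < E u"
proof
  assume "\<exists>v. suffix u v \<and> present \<alpha> X t v"
  then obtain v where "suffix u v" "t < B (0 # v)" by (auto simp: present_iff)
  then show "t < E u" using birth_le_E[OF suffix_ConsI, of u v 0] by simp
next
  assume "t < E u"
  then show "\<exists>v. suffix u v \<and> present \<alpha> X t v"
    using less_E present_crossing[OF _ assms] by blast
qed

lemma block_ext_time_eq: "block_ext_time \<alpha> X u = E u"
proof -
  have "{t. B u \<le> t \<and> (\<forall>v. suffix u v \<longrightarrow> \<not> present \<alpha> X t v)} = {E u..}"
  proof (rule set_eqI)
    fix t show "t \<in> {t. B u \<le> t \<and> (\<forall>v. suffix u v \<longrightarrow> \<not> present \<alpha> X t v)} \<longleftrightarrow> t \<in> {E u..}"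
      using ex_present_below_iff[of u t] birth_le_E[of u u]
          by (cases "B u \<le> t") (auto simp: not_less)
  qed
  then show ?thesis by (simp add: block_ext_time_def)
qed

lemma present_suffix_eq:
  assumes "present \<alpha> X t u" "present \<alpha> X t v" "suffix u v"
  shows "u = v"
proof (rule suffix_cases_Cons[OF assms(3)])
  fix i assume "suffix (i # u) v"
  then have "B (i # u) \<le> B v" by (rule birth_mono)
  then show ?thesis using assms by (auto simp: present_def)
qed auto

lemma ex_is_dec_rearr_frag: "\<exists>s. is_dec_rearr {u. present \<alpha> X t u} \<M> s"
  by (rule ex_is_dec_rearr[where C = 1])
    (auto intro!: mass_sum_antichain_le[OF valid] present_suffix_eq[of t])

lemma frag_is_dec_rearr: "is_dec_rearr {u. present \<alpha> X t u} \<M> (frag \<alpha> X t)"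
  unfolding frag_def by (rule dec_rearr_is_dec_rearr[OF ex_is_dec_rearr_frag])

lemma frag_eq_zero_iff: "frag \<alpha> X t = zero_seq \<longleftrightarrow> (\<forall>u. \<not> present \<alpha> X t u)"
  using is_dec_rearr_eq_zero_iff[OF frag_is_dec_rearr, of t] by (force simp: present_def)

lemma ext_time_eq: "ext_time \<alpha> X = E []"
proof -
  have "{t. 0 \<le> t \<and> frag \<alpha> X t = zero_seq} = {E []..}"
  proof (rule set_eqI)
    fix t show "t \<in> {t. 0 \<le> t \<and> frag \<alpha> X t = zero_seq} \<longleftrightarrow> t \<in> {E []..}"
      using ex_present_below_iff[of "[]" t] birth_le_E[of "[]" "[]"]
      by (cases "0 \<le> t") (auto simp: frag_eq_zero_iff not_less)
  qed
  then show ?thesis by (simp add: ext_time_def)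
qed

lemma E_lead:
  assumes "\<And>j. j \<noteq> i \<Longrightarrow> E (j # u) < E (i # u)"
  shows "E u = E (i # u)"
proof (rule antisym)
  show "E u \<le> E (i # u)"
  proof (rule E_least)
    fix v assume "suffix u v"
    then show "B v \<le> E (i # u)"
    proof (cases rule: suffix_cases_Cons)
      case 1
      then show ?thesis using birth_Cons_ge[of u i] birth_le_E[of "i # u" "i # u"] by simp
    next
      case (2 j)
      then have "B v \<le> E (j # u)" by (rule birth_le_E)
      also have "\<dots> \<le> E (i # u)" using assms[of j] by (cases "j = i") auto
      finally show ?thesis .
    qed
  qed
qed (auto intro: E_antimono suffix_ConsI)

lemma lead_eqI:
  assumes "\<And>j. j \<noteq> i \<Longrightarrow> E (j # u) < E (i # u)"
  shows "lead \<alpha> X u = i"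
  unfolding lead_def
proof (rule Least_equality)
  fix k assume "\<forall>j. j \<noteq> k \<longrightarrow> E (j # u) < E (k # u)"
  then have "k = i" using assms[of k] by (metis less_asym)
  then show "i \<le> k" by simp
qed (use assms in auto)

lemma E_mass_0:
  assumes "\<M> u = 0"
  shows "E u = B u"
proof -
  have "B (v @ u) = B u" for v
    using birth_append[OF valid, of \<alpha> v u] assms by simp
  then show ?thesis by (simp add: E_eq)
qed

lemma on_spine_E: "on_spine \<alpha> X u \<Longrightarrow> E u = E []"
proof (induction u)
  case (Cons i u)
  then show ?case using E_lead[of i u] by auto
qed simp

lemma on_spine_spine: "on_spine \<alpha> X u \<Longrightarrow> spine \<alpha> X (length u) = u"
proof (induction u)
  case (Cons i u)
  then show ?case using lead_eqI[of i u] by auto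
qed simp

text \<open>The subtree of a child of mass 0 is extinct at its birth. As siblings are born together,
  such a child cannot strictly outlast another one, for instance \<open>Suc i\<close>.\<close>

lemma on_spine_mass_pos: "on_spine \<alpha> X u \<Longrightarrow> 0 < \<M> u"
proof (induction u)
  case (Cons i u)
  show ?case
  proof (rule ccontr)
    assume "\<not> 0 < \<M> (i # u)"
    then have "\<M> (i # u) = 0" using mass_nonneg[OF valid, of "i # u"]
        by (simp add: order_less_le del: mass.simps)
    then have "E (i # u) = B (i # u)" by (rule E_mass_0)
    also have "\<dots> \<le> E (Suc i # u)" using birth_le_E[of "Suc i # u" "Suc i # u"] by simp
    also have "\<dots> < E (i # u)" using Cons.prems by simp
    finally show False by simp
  qed
qed simp

lemma on_spine_suffix: "on_spine \<alpha> X u \<Longrightarrow> suffix v u \<Longrightarrow> on_spine \<alpha> X v"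
proof (induction u)
  case (Cons i u)
  then show ?case by (auto simp: suffix_Cons)
qed simp

end

text \<open>A node has infinitely many children, so \<open>osc\<close> acts as a compactness
  property: apart from finitely many nodes and their ancestors, every subtree lasts at most
  \<open>\<eta>\<close>. \<open>no_ties\<close> is restricted to positive masses because siblings of
  mass 0 all become extinct together, at their birth.\<close>

locale good_marks = bounded_marks +
  assumes alpha: "\<alpha> < 0"
    and fst_pos: "0 < fst (X u)"
    and snd_less_1: "snd (X u) i < 1"
    and osc: "0 < \<eta> \<Longrightarrow> \<exists>F. finite F \<and> (\<forall>u. (\<forall>w\<in>F. \<not> suffix u w) \<longrightarrow> (\<forall>v. B (v @ u) \<le> B u + \<eta>))"
    and no_ties: "i \<noteq> j \<Longrightarrow> 0 < \<M> (i # u) \<Longrightarrow> 0 < \<M> (j # u) \<Longrightarrow> E (i # u) \<noteq> E (j # u)"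
begin

lemma mass_0_pos: "0 < \<M> u \<Longrightarrow> 0 < \<M> (0 # u)"
  using valid unit_mass_seqsD(7) by (auto simp: valid_marks_def)

lemma birth_Cons_gt: "0 < \<M> u \<Longrightarrow> B u < B (i # u)"
  using fst_pos[of u] by simp

lemma E_gt_birth: "0 < \<M> u \<Longrightarrow> B u < E u"
  using birth_Cons_gt[of u 0] birth_le_E[OF suffix_ConsI, of u u 0] by simp

lemma osc_suffix:
  assumes "0 < \<eta>"
  shows "\<exists>F. finite F \<and> (\<forall>u. (\<forall>w\<in>F. \<not> suffix u w) \<longrightarrow> E u \<le> B u + \<eta>)"
proof -
  obtain F where "finite F" "\<And>u v. \<forall>w\<in>F. \<not> suffix u w \<Longrightarrow> B (v @ u) \<le> B u + \<eta>"
    using osc[OF assms] by blast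
  then show ?thesis by (intro exI[of _ F]) (auto simp: E_eq intro!: cSUP_least)
qed

text \<open>The obstacle is that a supremum over infinitely many children might not be attained. The
  constant \<open>\<eta>\<close> is half the time that the subtree of child \<open>0\<close> lasts;
  by \<open>osc\<close> all but finitely many children are then beaten by child \<open>0\<close>, so
  a maximum over finitely many candidates is a global one.\<close>

lemma ex_lead:
  assumes u: "0 < \<M> u"
  shows "\<exists>i. 0 < \<M> (i # u) \<and> (\<forall>j. j \<noteq> i \<longrightarrow> E (j # u) < E (i # u))"
proof -
  define d where "d = B (0 # u)"
  have d: "B (j # u) = d" for j by (simp add: d_def)
  define \<eta> where "\<eta> = (E (0 # u) - d) / 2"
  have E0: "d < E (0 # u)" using E_gt_birth[OF mass_0_pos[OF u]] by (simp add: d_def)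
  then have "0 < \<eta>" by (simp add: \<eta>_def)
  then obtain F where F: "finite F" "\<And>u. \<forall>w\<in>F. \<not> suffix u w \<Longrightarrow> E u \<le> B u + \<eta>"
    using osc_suffix by blast
  define I where "I = {i. \<exists>w\<in>F. suffix (i # u) w}"
  have "I = (\<Union>w\<in>F. {i. suffix (i # u) w})" by (auto simp: I_def)
  moreover have "finite {i. suffix (i # u) w}" for w
  proof (cases "\<exists>i. suffix (i # u) w")
    case True
    then obtain i where i: "suffix (i # u) w" by blast
    have "{i. suffix (i # u) w} \<subseteq> {i}" using suffix_Cons_same[OF _ i] by auto
    then show ?thesis by (rule finite_subset) simp
  qed simp
  ultimately have "finite I" using F(1) by simp
  define m where "m = Max ((\<lambda>i. E (i # u)) ` insert 0 I)"
  have "m \<in> (\<lambda>i. E (i # u)) ` insert 0 I" unfolding m_def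
    using \<open>finite I\<close> by (intro Max_in) auto
  then obtain i where i: "m = E (i # u)" by blast
  have m0: "E (j # u) \<le> m" if "j \<in> insert 0 I" for j
    unfolding m_def using that \<open>finite I\<close> by (intro Max_ge) auto
  have *: "E (j # u) \<le> E (i # u)" for j
  proof (cases "j \<in> insert 0 I")
    case True
    then show ?thesis using m0 i by simp
  next
    case False
    then have "E (j # u) \<le> d + \<eta>" using F(2)[of "j # u"] d[of j] by (auto simp: I_def)
    also have "\<dots> \<le> E (0 # u)" using E0 by (simp add: \<eta>_def field_simps)
    finally show ?thesis using m0[of 0] i by simp
  qed
  have gt: "d < E (i # u)" using E0 *[of 0] by simp
  have "0 < \<M> (i # u)"
  proof (rule ccontr)
    assume "\<not> 0 < \<M> (i # u)"
    then have "\<M> (i # u) = 0" using mass_nonneg[OF valid, of "i # u"] by (auto simp: order_less_le)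
    then show False using E_mass_0[of "i # u"] d[of i] gt by simp
  qed
  moreover have "E (j # u) < E (i # u)" if "j \<noteq> i" for j
  proof (cases "0 < \<M> (j # u)")
    case True
    then show ?thesis using no_ties[of j i u] that \<open>0 < \<M> (i # u)\<close> *[of j]
        by (auto simp: order_less_le)
  next
    case False
    then have "\<M> (j # u) = 0" using mass_nonneg[OF valid, of "j # u"] by (auto simp: order_less_le)
    then show ?thesis using E_mass_0[of "j # u"] d[of j] gt by simp
  qed
  ultimately show ?thesis by blast
qed

lemma lead:
  assumes "0 < \<M> u"
  shows "0 < \<M> (lead \<alpha> X u # u)" "j \<noteq> lead \<alpha> X u \<Longrightarrow> E (j # u) < E (lead \<alpha> X u # u)"
proof -
  obtain i where i: "0 < \<M> (i # u)" "\<And>j. j \<noteq> i \<Longrightarrow> E (j # u) < E (i # u)" using ex_lead[OF assms]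
      by blast
  then have "lead \<alpha> X u = i" by (intro lead_eqI)
  then show "0 < \<M> (lead \<alpha> X u # u)" "j \<noteq> lead \<alpha> X u \<Longrightarrow> E (j # u) < E (lead \<alpha> X u # u)"
    using i by auto
qed

abbreviation "sp \<equiv> spine \<alpha> X"
abbreviation "T n \<equiv> B (sp n)"
abbreviation "\<zeta> \<equiv> E []"

lemma mass_spine_pos: "0 < \<M> (sp n)"
  by (induction n) (use lead in \<open>auto simp del: mass.simps(2)\<close>)

lemma on_spine_sp: "on_spine \<alpha> X (sp n)"
  by (induction n) (use lead[OF mass_spine_pos] in auto)

lemma E_spine: "E (sp n) = \<zeta>"
  using on_spine_E[OF on_spine_sp] .

lemma on_spine_iff: "on_spine \<alpha> X u \<longleftrightarrow> spine \<alpha> X (length u) = u"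
  using on_spine_spine on_spine_sp by metis

lemma T_strict_mono: "strict_mono T"
proof -
  have "T n < T (Suc n)" for n
    using birth_Cons_gt[OF mass_spine_pos] by (simp del: birth.simps(2))
  then show ?thesis by (simp add: strict_mono_Suc_iff)
qed

lemma T_less: "T n < \<zeta>"
  using E_gt_birth[OF mass_spine_pos[of n]] by (simp add: E_spine)

text \<open>A spine node deeper than the finitely many exceptional nodes is an ancestor of none of
  them, so its subtree lasts at most \<open>\<eta>\<close>; but that subtree becomes extinct at
  \<open>\<zeta>\<close>.\<close>

lemma T_close:
  assumes "0 < \<eta>"
  shows "\<exists>n. \<zeta> \<le> T n + \<eta>"
proof -
  obtain F where F: "finite F" "\<And>u. \<forall>w\<in>F. \<not> suffix u w \<Longrightarrow> E u \<le> B u + \<eta>"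
    using osc_suffix[OF assms] by blast
  define n where "n = Suc (Max (insert 0 (length ` F)))"
  have "length w < n" if "w \<in> F" for w
    using F(1) that by (auto simp: n_def less_Suc_eq_le intro: Max_ge)
  then have "\<forall>w\<in>F. \<not> suffix (sp n) w" using suffix_length_le by fastforce
  then show ?thesis using F(2)[of "sp n"] E_spine[of n] by auto
qed

lemma ex_spine_interval:
  assumes "0 \<le> t" "t < \<zeta>"
  shows "\<exists>n. T n \<le> t \<and> t < T (Suc n)"
proof -
  obtain m where "\<zeta> \<le> T m + (\<zeta> - t) / 2" using T_close[of "(\<zeta> - t) / 2"] assms by auto
  then have m: "t < T m" using assms by (simp add: field_simps)
  define n where "n = (LEAST n. t < T (Suc n))"
  have "m \<noteq> 0" using m assms by (cases m) auto
  then have "\<exists>n. t < T (Suc n)" using m by (metis not0_implies_Suc)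
  then have n: "t < T (Suc n)" unfolding n_def by (rule LeastI_ex)
  have "T n \<le> t"
  proof (cases n)
    case 0
    then show ?thesis using assms by simp
  next
    case (Suc k)
    then show ?thesis using not_less_Least[of k "\<lambda>n. t < T (Suc n)"]
        by (simp add: n_def[symmetric] not_less del: spine.simps birth.simps)
  qed
  then show ?thesis using n by blast
qed

lemma not_spine_below_sibling:
  "u = sp (length u) \<or> (\<exists>k j. j \<noteq> lead \<alpha> X (sp k) \<and> suffix (j # sp k) u \<and> k < length u)"
proof (induction u)
  case (Cons i u)
  then show ?case
  proof
    assume u: "u = sp (length u)"
    show ?thesis
    proof (cases "i = lead \<alpha> X u")
      case True
      then have "i # u = sp (length (i # u))" using u by (simp add: u[symmetric])
      then show ?thesis by (rule disjI1)
    next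
      case False
      then show ?thesis
        by (intro disjI2 exI[of _ "length u"] exI[of _ i]) (simp add: u[symmetric])
    qed
  next
    assume "\<exists>k j. j \<noteq> lead \<alpha> X (sp k) \<and> suffix (j # sp k) u \<and> k < length u"
    then show ?thesis by (intro disjI2) (metis length_Cons less_SucI suffix_ConsI)
  qed
qed simp

lemma E_eq_ext_imp_spine:
  assumes "E u = \<zeta>"
  shows "u = sp (length u)"
proof (rule ccontr)
  assume "u \<noteq> sp (length u)"
  then obtain k j where j: "j \<noteq> lead \<alpha> X (sp k)" "suffix (j # sp k) u"
    using not_spine_below_sibling[of u] by blast
  have "E u \<le> E (j # sp k)" using E_antimono[OF j(2)] .
  also have "\<dots> < E (sp (Suc k))" using lead(2)[OF mass_spine_pos j(1)] by simp
  finally show False using assms E_spine[of "Suc k"] by simp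
qed

lemma interval_unique:
  assumes "T n \<le> t" "t < T (Suc n)" "T m \<le> t" "t < T (Suc m)"
  shows "n = m"
proof -
  have "n < Suc m" using assms strict_mono_less[OF T_strict_mono, of n "Suc m"] by linarith
  moreover have "m < Suc n" using assms strict_mono_less[OF T_strict_mono, of m "Suc n"] by linarith
  ultimately show ?thesis by simp
qed

lemma present_spine_iff: "present \<alpha> X t (sp n) \<longleftrightarrow> T n \<le> t \<and> t < T (Suc n)"
  by (simp add: present_iff)

lemma last_block_eq:
  assumes "T n \<le> t" "t < T (Suc n)"
  shows "last_block \<alpha> X t = sp n"
  unfolding last_block_def
proof (rule the_equality)
  show "present \<alpha> X t (sp n) \<and> block_ext_time \<alpha> X (sp n) = ext_time \<alpha> X"
    using assms by (simp only: present_spine_iff block_ext_time_eq ext_time_eq E_spine)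
next
  fix u assume u: "present \<alpha> X t u \<and> block_ext_time \<alpha> X u = ext_time \<alpha> X"
  then have "u = sp (length u)"
      by (intro E_eq_ext_imp_spine) (simp add: block_ext_time_eq ext_time_eq)
  then have "T (length u) \<le> t" "t < T (Suc (length u))" using u present_spine_iff[of t "length u"]
      by metis+
  then have "length u = n" using interval_unique[OF _ _ assms] by blast
  then show "u = sp n" using \<open>u = sp (length u)\<close> by metis
qed

lemma last_mass_eq:
  assumes "T n \<le> t" "t < T (Suc n)"
  shows "last_mass \<alpha> X t = \<M> (sp n)"
  using last_block_eq[OF assms] assms T_less[of "Suc n"] by (simp add: last_mass_def ext_time_eq)

lemma last_block_T: "last_block \<alpha> X (T n) = sp n"
  using last_block_eq[of n "T n"] T_strict_mono by (simp add: strict_mono_Suc_iff del: spine.simps)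

lemma last_mass_T: "last_mass \<alpha> X (T n) = \<M> (sp n)"
  using last_mass_eq[of n "T n"] T_strict_mono by (simp add: strict_mono_Suc_iff del: spine.simps)

text \<open>The strict inequality makes every split of the last fragment visible as a discontinuity
  of its mass, so that the jump times are exactly the birth times along the spine.\<close>

lemma mass_spine_decreasing: "\<M> (sp (Suc n)) < \<M> (sp n)"
  using mass_spine_pos[of n] snd_less_1 by simp

lemma isCont_last_mass:
  assumes "T n < t" "t < T (Suc n)"
  shows "isCont (last_mass \<alpha> X) t"
proof -
  have "\<forall>\<^sub>F s in nhds t. s \<in> {T n<..<T (Suc n)}" using assms by (intro eventually_nhds_in_open) auto
  then have "\<forall>\<^sub>F s in nhds t. last_mass \<alpha> X s = \<M> (sp n)"
    by eventually_elim (rule last_mass_eq, auto)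
  then have "isCont (last_mass \<alpha> X) t \<longleftrightarrow> isCont (\<lambda>_. \<M> (sp n)) t" by (rule isCont_cong)
  then show ?thesis by simp
qed

lemma not_isCont_last_mass: "\<not> isCont (last_mass \<alpha> X) (T (Suc n))"
proof
  assume "isCont (last_mass \<alpha> X) (T (Suc n))"
  then have 1: "(last_mass \<alpha> X \<longlongrightarrow> \<M> (sp (Suc n))) (at_left (T (Suc n)))"
    unfolding isCont_def last_mass_T by (rule tendsto_within_subset) simp
  have "T n < T (Suc n)" using T_strict_mono by (simp add: strict_mono_Suc_iff)
  then have "\<forall>\<^sub>F s in at_left (T (Suc n)). s \<in> {T n<..<T (Suc n)}"
    by (intro eventually_at_leftI[of "T n"]) auto
  then have "\<forall>\<^sub>F s in at_left (T (Suc n)). last_mass \<alpha> X s = \<M> (sp n)"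
    by eventually_elim (rule last_mass_eq, auto)
  then have "(last_mass \<alpha> X \<longlongrightarrow> \<M> (sp n)) (at_left (T (Suc n)))"
    by (rule tendsto_eventually)
  then have "\<M> (sp n) = \<M> (sp (Suc n))"
    using 1 by (intro tendsto_unique[OF trivial_limit_at_left_real])
  then show False using mass_spine_decreasing[of n] by (simp del: spine.simps mass.simps)
qed

lemma jump_time_eq: "jump_time \<alpha> X n = T n"
proof (induction n)
  case (Suc n)
  have less: "T n < T (Suc n)" using T_strict_mono by (simp add: strict_mono_Suc_iff)
  have "Inf {t. T n < t \<and> t < ext_time \<alpha> X \<and> \<not> isCont (last_mass \<alpha> X) t} = T (Suc n)"
  proof (rule cInf_eq_minimum)
    show "T (Suc n) \<in> {t. T n < t \<and> t < ext_time \<alpha> X \<and> \<not> isCont (last_mass \<alpha> X) t}"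
      using less T_less[of "Suc n"] not_isCont_last_mass[of n]
          by (simp add: ext_time_eq del: spine.simps)
  next
    fix t assume "t \<in> {t. T n < t \<and> t < ext_time \<alpha> X \<and> \<not> isCont (last_mass \<alpha> X) t}"
    then show "T (Suc n) \<le> t" using isCont_last_mass[of n t]
        by (auto simp del: spine.simps simp flip: not_less)
  qed
  then show ?case using Suc by (simp del: spine.simps)
qed simp

end

section \<open>Data read off the spine\<close>

definition skip :: "nat \<Rightarrow> nat \<Rightarrow> nat" where
  "skip j m = (if m < j then m else Suc m)"

lemma skip_neq: "skip j m \<noteq> j"
  by (auto simp: skip_def)

lemma inj_skip: "inj (skip j)"
  by (auto simp: skip_def inj_def split: if_splits)

lemma range_skip: "range (skip j) = UNIV - {j}"
proof -
  have "i \<in> range (skip j)" if ij: "i \<noteq> j" for i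
  proof (cases "i < j")
    case False
    then obtain k where "i = Suc k" "j \<le> k" using ij False by (cases i) auto
    then show ?thesis by (intro range_eqI[of _ _ k]) (simp add: skip_def)
  qed (auto simp: skip_def intro: range_eqI[of _ _ i])
  then show ?thesis by (auto simp: skip_neq)
qed

text \<open>\<open>skip j\<close> enumerates the indices other than \<open>j\<close> in increasing
  order, so deleting one entry keeps the sequence decreasing and no new sorting is required.\<close>

lemma skip_mass_seqs:
  assumes s: "s \<in> unit_mass_seqs"
  shows "(\<lambda>m. s (skip j m)) \<in> mass_seqs"
proof -
  have "skip j m \<le> skip j m'" if "m \<le> m'" for m m' using that by (auto simp: skip_def)
  then have "decseq (\<lambda>m. s (skip j m))"
    using unit_mass_seqsD(2)[OF s] by (auto simp: decseq_def)
  moreover have "summable (\<lambda>m. s (skip j m))"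
  proof (rule summable_comparison_test'[OF unit_mass_seqsD(4)[OF s]])
    fix m show "norm (s (skip j m)) \<le> s m"
      using unit_mass_seqsD(3)[OF s] decseqD[OF unit_mass_seqsD(2)[OF s], of m "skip j m"]
      by (auto simp: skip_def)
  qed
  ultimately show ?thesis
    using unit_mass_seqsD(3)[OF s] by (auto simp: mass_seqs_def)
qed

text \<open>This and the next two definitions mirror \<open>Zn\<close>, \<open>Theta\<close> and
  \<open>Delta\<close>, with jump times replaced by birth times along the spine. They are measurable
  on the whole space of marks and agree with the originals on good realisations.\<close>

definition spine_Z :: "real \<Rightarrow> marks \<Rightarrow> nat \<Rightarrow> real" where
  "spine_Z \<alpha> X n = mass X (spine \<alpha> X n) powr \<alpha> * (subtree_ext \<alpha> X [] - birth \<alpha> X (spine \<alpha> X n))"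

definition spine_Theta :: "real \<Rightarrow> marks \<Rightarrow> nat \<Rightarrow> real" where
  "spine_Theta \<alpha> X n = (if n = 0 then 1 else mass X (spine \<alpha> X n) / mass X (spine \<alpha> X (n - 1)))"

definition spine_Delta :: "real \<Rightarrow> marks \<Rightarrow> nat \<Rightarrow> nat \<Rightarrow> real" where
  "spine_Delta \<alpha> X n = (if n = 0 then zero_seq else
     (\<lambda>m. snd (X (spine \<alpha> X (n - 1))) (skip (lead \<alpha> X (spine \<alpha> X (n - 1))) m)))"

text \<open>On good realisations with \<open>\<epsilon> \<le> \<zeta>\<close> this is the last index
  whose jump time is at most \<open>\<zeta> - \<epsilon>\<close>. For
  \<open>\<epsilon> > \<zeta>\<close> it is 0, which is also the value that \<open>N_int\<close>
  takes where \<open>N_eps\<close> is \<open>- \<infinity>\<close>.\<close>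

definition spine_N :: "real \<Rightarrow> real \<Rightarrow> marks \<Rightarrow> nat" where
  "spine_N \<alpha> \<epsilon> X = (LEAST n. subtree_ext \<alpha> X [] - birth \<alpha> X (spine \<alpha> X (Suc n)) < \<epsilon>)"

definition side_node :: "real \<Rightarrow> marks \<Rightarrow> nat \<Rightarrow> nat \<Rightarrow> nat list" where
  "side_node \<alpha> X n m = skip (lead \<alpha> X (spine \<alpha> X (n - 1))) m # spine \<alpha> X (n - 1)"

text \<open>The threshold of the statement: the time from the birth of the side node to the
  extinction of the whole tree, on the clock of the side subtree.\<close>

definition side_span :: "real \<Rightarrow> marks \<Rightarrow> nat \<Rightarrow> nat \<Rightarrow> real" where
  "side_span \<alpha> X n m =
     spine_Delta \<alpha> X n m powr \<alpha> * spine_Theta \<alpha> X n powr (- \<alpha>) * spine_Z \<alpha> X n"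

definition rev_path :: "real \<Rightarrow> real \<Rightarrow> marks \<Rightarrow> real \<Rightarrow> nat \<Rightarrow> real" where
  "rev_path \<alpha> x X = (\<lambda>t\<in>{0..}. if t \<le> x then frag \<alpha> X (x - t) else zero_seq)"

definition side_path :: "real \<Rightarrow> marks \<Rightarrow> nat \<Rightarrow> nat \<Rightarrow> real \<Rightarrow> nat \<Rightarrow> real" where
  "side_path \<alpha> X n m = rev_path \<alpha> (side_span \<alpha> X n m) (sub X (side_node \<alpha> X n m))"

section \<open>Subtrees as rescaled fragmentations\<close>

context bounded_marks
begin

lemma bounded_sub:
  assumes "0 < \<M> w"
  shows "bounded_marks \<alpha> (sub X w)"
proof
  show "valid_marks (sub X w)" by (rule valid_sub[OF valid])
  show "0 \<le> fst (sub X w u)" for u by (simp add: sub_def fst_nonneg)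
  obtain C where C: "\<And>v. B v \<le> C" using bdd by (auto simp: bdd_above_def)
  show "bdd_above (range (birth \<alpha> (sub X w)))"
  proof (rule bdd_aboveI2)
    fix v
    have "\<M> w powr - \<alpha> * birth \<alpha> (sub X w) v \<le> C - B w"
      using C[of "v @ w"] birth_append[OF valid, of \<alpha> v w] by simp
    then show "birth \<alpha> (sub X w) v \<le> (C - B w) / \<M> w powr - \<alpha>"
      using assms by (simp add: field_simps)
  qed
qed

lemma birth_sub:
  assumes "0 < \<M> w"
  shows "birth \<alpha> (sub X w) v = \<M> w powr \<alpha> * (B (v @ w) - B w)"
  using assms birth_append[OF valid, of \<alpha> v w] by (simp add: powr_minus field_simps)

text \<open>A time lag after the birth of \<open>w\<close> is multiplied by
  \<open>mass X w powr \<alpha>\<close> on the clock of the subtree, and the supremum of the birth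
  times scales with it.\<close>

lemma E_sub:
  assumes w: "0 < \<M> w"
  shows "subtree_ext \<alpha> (sub X w) [] = \<M> w powr \<alpha> * (E w - B w)"
proof -
  interpret s: bounded_marks \<alpha> "sub X w" by (rule bounded_sub[OF w])
  have p: "0 < \<M> w powr \<alpha>" using w by simp
  show ?thesis
  proof (rule antisym)
    show "subtree_ext \<alpha> (sub X w) [] \<le> \<M> w powr \<alpha> * (E w - B w)"
      by (rule s.E_least) (use p birth_le_E[OF suffixI[OF refl]] in \<open>simp add: birth_sub[OF w]\<close>)
    have "E w \<le> B w + subtree_ext \<alpha> (sub X w) [] / \<M> w powr \<alpha>"
    proof (rule E_least)
      fix v assume "suffix w v"
      then obtain z where z: "v = z @ w" by (auto simp: suffix_def)
      have "\<M> w powr \<alpha> * (B v - B w) \<le> subtree_ext \<alpha> (sub X w) []"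
        using s.birth_le_E[of "[]" z] by (simp add: birth_sub[OF w] z)
      then show "B v \<le> B w + subtree_ext \<alpha> (sub X w) [] / \<M> w powr \<alpha>"
        using p by (simp add: field_simps)
    qed
    then show "\<M> w powr \<alpha> * (E w - B w) \<le> subtree_ext \<alpha> (sub X w) []"
      using p by (simp add: field_simps)
  qed
qed

lemma present_sub_iff:
  assumes w: "0 < \<M> w"
  shows "present \<alpha> (sub X w) (\<M> w powr \<alpha> * (t - B w)) v \<longleftrightarrow> present \<alpha> X t (v @ w)"
proof -
  interpret s: bounded_marks \<alpha> "sub X w" by (rule bounded_sub[OF w])
  have p: "0 < \<M> w powr \<alpha>" using w by simp
  show ?thesis
    unfolding s.present_iff present_iff birth_sub[OF w] using p
    by (simp del: birth.simps)
qed

lemma spine_Delta_Suc: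
  "spine_Delta \<alpha> X (Suc n) m = snd (X (spine \<alpha> X n)) (skip (lead \<alpha> X (spine \<alpha> X n)) m)"
  by (simp add: spine_Delta_def)

text \<open>In the threshold the mass of the spine node of generation \<open>Suc k\<close> occurs in
  \<open>spine_Theta\<close> and in \<open>spine_Z\<close> with opposite exponents and cancels; what
  remains is the mass of the side node. Positivity of two spine masses suffices, which allows the
  use for cut trees, where the marks are only bounded.\<close>

lemma side_node_props_of_pos:
  assumes pos: "0 < \<M> (spine \<alpha> X k)" "0 < \<M> (spine \<alpha> X (Suc k))"
    and D: "0 < spine_Delta \<alpha> X (Suc k) m"
  shows "\<M> (side_node \<alpha> X (Suc k) m) = \<M> (spine \<alpha> X k) * spine_Delta \<alpha> X (Suc k) m"
    "0 < \<M> (side_node \<alpha> X (Suc k) m)"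
    "B (side_node \<alpha> X (Suc k) m) = B (spine \<alpha> X (Suc k))"
    "side_span \<alpha> X (Suc k) m = \<M> (side_node \<alpha> X (Suc k) m) powr \<alpha> * (E [] - B (spine \<alpha> X (Suc k)))"
proof -
  show *: "\<M> (side_node \<alpha> X (Suc k) m) = \<M> (spine \<alpha> X k) * spine_Delta \<alpha> X (Suc k) m"
    by (simp add: side_node_def spine_Delta_Suc)
  show "0 < \<M> (side_node \<alpha> X (Suc k) m)" using * D pos by simp
  show "B (side_node \<alpha> X (Suc k) m) = B (spine \<alpha> X (Suc k))" by (simp add: side_node_def)
  show "side_span \<alpha> X (Suc k) m = \<M> (side_node \<alpha> X (Suc k) m) powr \<alpha> * (E [] - B (spine \<alpha> X (Suc
      k)))"
    unfolding * using D pos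
    by (simp add: side_span_def spine_Theta_def spine_Z_def powr_mult powr_divide powr_minus
        field_simps
        del: spine.simps mass.simps)
qed

end

section \<open>The quantities of the statement in terms of the spine\<close>

context good_marks
begin

lemma Zn_eq: "Zn \<alpha> X n = spine_Z \<alpha> X n"
  by (simp only: Zn_def spine_Z_def jump_time_eq last_mass_T ext_time_eq)

lemma Theta_eq: "Theta \<alpha> X n = spine_Theta \<alpha> X n"
  by (simp only: Theta_def spine_Theta_def jump_time_eq last_mass_T)

text \<open>Dividing by the mass of the parent returns the child sequence \<open>s\<close> itself.
  Deleting its entry at \<open>lead\<close> leaves a decreasing sequence, which is therefore its own
  rearrangement.\<close>

lemma Delta_eq: "Delta \<alpha> X n = spine_Delta \<alpha> X n"
proof (cases n)
  case 0
  then show ?thesis by (simp add: Delta_def spine_Delta_def)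
next
  case (Suc k)
  define s where "s = snd (X (sp k))"
  define j where "j = lead \<alpha> X (sp k)"
  have s: "s \<in> unit_mass_seqs" using valid by (simp add: valid_marks_def s_def)
  have 1: "(\<lambda>m. s (skip j m)) \<in> mass_seqs" by (rule skip_mass_seqs[OF s])
  have 2: "bij_betw (skip j) {m. 0 < s (skip j m)} {i \<in> {i. i \<noteq> j}. 0 < s i}"
  proof (rule bij_betw_imageI)
    show "inj_on (skip j) {m. 0 < s (skip j m)}" using inj_skip by (rule inj_on_subset) simp
    have "i \<in> skip j ` {m. 0 < s (skip j m)}" if "i \<noteq> j" "0 < s i" for i
    proof -
      have "i \<in> range (skip j)" using that(1) by (simp add: range_skip)
      then obtain m where "i = skip j m" by (rule rangeE)
      then show ?thesis using that by auto
    qed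
    then show "skip j ` {m. 0 < s (skip j m)} = {i \<in> {i. i \<noteq> j}. 0 < s i}"
      using skip_neq by auto
  qed
  have "is_dec_rearr {i. i \<noteq> j} s (\<lambda>m. s (skip j m))"
    unfolding is_dec_rearr_def using 1 2 by (auto intro!: exI[of _ "skip j"])
  then have "dec_rearr {i. i \<noteq> j} s = (\<lambda>m. s (skip j m))" by (rule dec_rearr_eqI)
  moreover have "(\<lambda>i. \<M> (i # sp k) / \<M> (sp k)) = s"
    using mass_spine_pos[of k] by (simp add: fun_eq_iff s_def)
  moreover have "{i. i # sp k \<noteq> sp (Suc k)} = {i. i \<noteq> j}" by (simp add: j_def)
  ultimately show ?thesis
    unfolding Suc Delta_def jump_time_eq Let_def
    by (simp del: mass.simps spine.simps
        add: jump_time_eq last_block_T last_mass_T s_def j_def spine_Delta_Suc fun_eq_iff)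
qed

lemma spine_N_props:
  assumes "0 < \<epsilon>"
  shows "\<zeta> - T (Suc (spine_N \<alpha> \<epsilon> X)) < \<epsilon>" "n < spine_N \<alpha> \<epsilon> X \<Longrightarrow> \<epsilon> \<le> \<zeta> - T (Suc n)"
proof -
  obtain n where "\<zeta> \<le> T n + \<epsilon> / 2" using T_close[of "\<epsilon> / 2"] assms by auto
  moreover have "T n < T (Suc n)" using T_strict_mono by (simp add: strict_mono_Suc_iff)
  ultimately have "\<zeta> - T (Suc n) < \<epsilon>" using assms by (simp add: field_simps del: spine.simps)
  then have "\<exists>n. \<zeta> - T (Suc n) < \<epsilon>" by blast
  then show "\<zeta> - T (Suc (spine_N \<alpha> \<epsilon> X)) < \<epsilon>" unfolding spine_N_def by (rule LeastI_ex)
  show "\<epsilon> \<le> \<zeta> - T (Suc n)" if "n < spine_N \<alpha> \<epsilon> X" for n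
    using not_less_Least[OF that[unfolded spine_N_def]] by (simp only: not_less)
qed

lemma jump_set_eq:
  assumes "0 < \<epsilon>" "\<epsilon> \<le> \<zeta>"
  shows "{n. jump_time \<alpha> X n \<le> \<zeta> - \<epsilon>} = {..spine_N \<alpha> \<epsilon> X}"
proof (rule set_eqI)
  fix n
  show "n \<in> {n. jump_time \<alpha> X n \<le> \<zeta> - \<epsilon>} \<longleftrightarrow> n \<in> {..spine_N \<alpha> \<epsilon> X}"
  proof (cases "n \<le> spine_N \<alpha> \<epsilon> X")
    case True
    have "T n \<le> \<zeta> - \<epsilon>"
    proof (cases n)
      case 0
      then show ?thesis using assms by simp
    next
      case (Suc k)
      then show ?thesis using spine_N_props(2)[OF assms(1), of k] True by (simp del: spine.simps)
    qed
    then show ?thesis using True by (simp add: jump_time_eq)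
  next
    case False
    then have "T (Suc (spine_N \<alpha> \<epsilon> X)) \<le> T n" using T_strict_mono
        by (subst strict_mono_less_eq) auto
    then show ?thesis using spine_N_props(1)[OF assms(1)] False
        by (simp add: jump_time_eq del: spine.simps)
  qed
qed

lemma N_eps_eq:
  assumes "0 < \<epsilon>"
  shows "N_eps \<alpha> \<epsilon> X = (if \<epsilon> \<le> \<zeta> then ereal (real (spine_N \<alpha> \<epsilon> X)) else - \<infinity>)"
proof (cases "\<epsilon> \<le> \<zeta>")
  case True
  have "(SUP n\<in>{..spine_N \<alpha> \<epsilon> X}. ereal (real n)) = ereal (real (spine_N \<alpha> \<epsilon> X))"
    by (intro antisym SUP_least) (auto intro: SUP_upper2)
  then show ?thesis using True jump_set_eq[OF assms True] by (simp add: N_eps_def ext_time_eq)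
next
  case False
  then have "{n. jump_time \<alpha> X n \<le> \<zeta> - \<epsilon>} = {}"
    using birth_nonneg[of "sp n" for n]
        by (auto simp: jump_time_eq not_le intro: less_le_trans[of _ 0])
  then show ?thesis using False by (simp add: N_eps_def ext_time_eq bot_ereal_def)
qed

lemma N_int_eq:
  assumes "0 < \<epsilon>"
  shows "N_int \<alpha> \<epsilon> X = int (spine_N \<alpha> \<epsilon> X)"
proof (cases "\<epsilon> \<le> \<zeta>")
  case False
  then have "\<zeta> - T (Suc 0) < \<epsilon>" using birth_nonneg[of "sp (Suc 0)"] by simp
  then have "spine_N \<alpha> \<epsilon> X = 0" unfolding spine_N_def by (intro Least_eq_0)
  then show ?thesis using False by (simp add: N_int_def N_eps_eq[OF assms])
qed (simp add: N_int_def N_eps_eq[OF assms])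

lemma prod_Yn: "(\<Prod>i = 0..n. Yn \<alpha> X i powr \<alpha>) = \<zeta> - T n"
proof (induction n)
  case 0
  have "0 < \<zeta>" using T_less[of 0] by simp
  then show ?case using alpha by (simp add: Yn_def powr_powr ext_time_eq)
next
  case (Suc n)
  have "0 < \<zeta> - T (Suc n)" "0 < \<zeta> - T n" using T_less by (simp_all del: spine.simps)
  then have "Yn \<alpha> X (Suc n) powr \<alpha> = (\<zeta> - T (Suc n)) / (\<zeta> - T n)"
    using alpha
        by (simp add: Yn_def powr_powr ext_time_eq jump_time_eq del: jump_time.simps spine.simps)
  then show ?case using Suc \<open>0 < \<zeta> - T n\<close> by (simp del: spine.simps)
qed

lemma prod_Theta: "(\<Prod>j = 0..n. Theta \<alpha> X j) = \<M> (sp n)"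
proof (induction n)
  case (Suc n)
  have "0 < \<M> (sp n)" by (rule mass_spine_pos)
  then show ?case using Suc by (simp add: Theta_eq spine_Theta_def del: spine.simps mass.simps)
qed (simp add: Theta_eq spine_Theta_def)

text \<open>By telescoping, \<open>R_eps\<close> at \<open>k\<close> is the time left at the jump
  \<open>N_int + k\<close>, divided by \<open>\<epsilon>\<close>. So \<open>k\<close> locates the
  interval between jump times that contains \<open>\<zeta> - \<epsilon> * t\<close>; the orientation
  of the strict inequality matches intervals closed on the left.\<close>

lemma is_K_eps_iff:
  assumes "0 < \<epsilon>"
  shows "is_K_eps \<alpha> \<epsilon> X t k \<longleftrightarrow> 0 \<le> N_int \<alpha> \<epsilon> X + k \<and>
     T (nat (N_int \<alpha> \<epsilon> X + k)) \<le> \<zeta> - \<epsilon> * t \<and> \<zeta> - \<epsilon> * t < T (Suc (nat (N_int \<alpha> \<epsilon> X + k)))"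
proof (cases "0 \<le> N_int \<alpha> \<epsilon> X + k")
  case True
  then have "nat (N_int \<alpha> \<epsilon> X + (k + 1)) = Suc (nat (N_int \<alpha> \<epsilon> X + k))" by simp
  then show ?thesis unfolding is_K_eps_def R_eps_def prod_Yn
    using True assms by (auto simp: field_simps simp del: spine.simps)
qed (auto simp: is_K_eps_def)

lemma ex1_K_eps:
  assumes "0 < \<epsilon>" "0 < t" "t \<le> \<zeta> / \<epsilon>"
  shows "\<exists>!k. is_K_eps \<alpha> \<epsilon> X t k"
proof -
  have "0 \<le> \<zeta> - \<epsilon> * t" "\<zeta> - \<epsilon> * t < \<zeta>" using assms by (auto simp: field_simps)
  then obtain n where n: "T n \<le> \<zeta> - \<epsilon> * t" "\<zeta> - \<epsilon> * t < T (Suc n)" using ex_spine_interval by blast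
  show ?thesis
  proof (rule ex1I)
    show "is_K_eps \<alpha> \<epsilon> X t (int n - N_int \<alpha> \<epsilon> X)" unfolding is_K_eps_iff[OF assms(1)] using n
        by simp
    fix k assume k: "is_K_eps \<alpha> \<epsilon> X t k"
    then have "nat (N_int \<alpha> \<epsilon> X + k) = n" unfolding is_K_eps_iff[OF assms(1)]
        using interval_unique n by blast
    moreover have "0 \<le> N_int \<alpha> \<epsilon> X + k" using k unfolding is_K_eps_iff[OF assms(1)] by simp
    ultimately show "k = int n - N_int \<alpha> \<epsilon> X" by simp
  qed
qed

lemma side_node_not_below_spine:
  assumes "suffix (side_node \<alpha> X (Suc k) m) u"
  shows "\<not> suffix (sp (Suc k)) u"
  using assms suffix_Cons_same[of _ "sp k" u] skip_neq by (auto simp: side_node_def)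

text \<open>If \<open>k < k'\<close>, a node below the side node of level \<open>k'\<close> lies
  below the spine node of level \<open>Suc k\<close>, which the subtree of the side node of level
  \<open>k\<close> avoids. Within a level, siblings have disjoint subtrees.\<close>

lemma side_node_unique:
  assumes "suffix (side_node \<alpha> X (Suc k) m) u" "suffix (side_node \<alpha> X (Suc k') m') u"
  shows "k = k' \<and> m = m'"
proof -
  have sp: "suffix (sp k) (side_node \<alpha> X (Suc k) m)" for k m
      by (simp add: side_node_def suffix_ConsI)
  have le: "\<not> k < k'" if "suffix (side_node \<alpha> X (Suc k) m) u"
      "suffix (side_node \<alpha> X (Suc k') m') u" for k k' m m'
    using side_node_not_below_spine[OF that(1)] suffix_spine[of "Suc k" k' \<alpha> X] sp[of k' m'] that(2)
    by (meson Suc_leI suffix_order.trans)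
  have "k = k'" using le[OF assms] le[OF assms(2,1)] by simp
  then show ?thesis using assms suffix_Cons_same[of _ "sp k" u] inj_skip
      by (auto simp: side_node_def dest: injD)
qed

lemmas side_node_props = side_node_props_of_pos[OF mass_spine_pos mass_spine_pos]

text \<open>A block off the spine descends from a sibling of some spine node of generation
  \<open>Suc k\<close>. That sibling is born at \<open>T (Suc k)\<close>, hence by time
  \<open>s\<close>, which forces \<open>k < n\<close>; it has positive mass because its descendant
  does.\<close>

lemma present_decomposition:
  assumes "T n \<le> s" "s < T (Suc n)" "present \<alpha> X s u"
  shows "u = sp n \<or> (\<exists>k<n. \<exists>m v. 0 < spine_Delta \<alpha> X (Suc k) m \<and> u = v @ side_node \<alpha> X (Suc k) m)"
proof (cases "u = sp (length u)")
  case True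
  then have "T (length u) \<le> s" "s < T (Suc (length u))"
    using assms(3) present_spine_iff[of s "length u"] by metis+
  then have "length u = n" using interval_unique assms by blast
  then show ?thesis using True by metis
next
  case False
  then obtain k j where j: "j \<noteq> lead \<alpha> X (sp k)" "suffix (j # sp k) u"
    using not_spine_below_sibling[of u] by blast
  have "j \<in> range (skip (lead \<alpha> X (sp k)))" using j(1) by (simp add: range_skip)
  then obtain m where m: "j = skip (lead \<alpha> X (sp k)) m" by (rule rangeE)
  have node: "side_node \<alpha> X (Suc k) m = j # sp k" by (simp add: side_node_def m)
  obtain v where v: "u = v @ (j # sp k)" using j(2) by (auto simp: suffix_def)
  have "0 < \<M> u" using assms(3) by (simp add: present_def)
  then have "\<M> (j # sp k) \<noteq> 0" unfolding v mass_append[of X v] by auto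
  then have "0 < spine_Delta \<alpha> X (Suc k) m"
    using valid_nonneg[OF valid, of "sp k" j] by (auto simp: spine_Delta_Suc m)
  moreover have "k < n"
  proof -
    have "T (Suc k) = B (j # sp k)" by simp
    also have "\<dots> \<le> s" using birth_mono[OF j(2)] assms(3) by (simp add: present_def)
    finally show ?thesis
      using assms(2) strict_mono_less[OF T_strict_mono, of "Suc k" "Suc n"] by linarith
  qed
  ultimately show ?thesis using v node by metis
qed

text \<open>An explicit bijection \<open>h\<close> from the positive terms of the listed family to
  the living blocks does it: \<open>None\<close> goes to the spine node, and
  \<open>(i, m, l)\<close> to the block that occupies rank \<open>l\<close> in the fragmentation
  issued from the side node \<open>(N + i, m)\<close>. Ranks inside the side fragmentations are then
  absorbed by \<open>dec_rearr_reindex\<close>.\<close>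

lemma frag_decomposition:
  assumes \<epsilon>: "0 < \<epsilon>" and k: "is_K_eps \<alpha> \<epsilon> X t K" and t: "0 < t"
  defines "N \<equiv> N_int \<alpha> \<epsilon> X"
  shows "frag \<alpha> X (\<zeta> - \<epsilon> * t) =
    dec_rearr (insert None (Some ` {(i, m, l). - N + 1 \<le> i \<and> i \<le> K}))
     (\<lambda>p. case p of
        None \<Rightarrow> Theta_prod \<alpha> X (N + K)
      | Some (i, m, l) \<Rightarrow>
          Theta_prod \<alpha> X (N + i - 1) * Delta \<alpha> X (nat (N + i)) m *
          side_path \<alpha> X (nat (N + i)) m
            (\<epsilon> * t * Theta_prod \<alpha> X (N + i - 1) powr \<alpha> * Delta \<alpha> X (nat (N + i)) m powr \<alpha>) l)"
    (is "_ = dec_rearr ?I ?f")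
proof -
  define n where "n = nat (N + K)"
  define s where "s = \<zeta> - \<epsilon> * t"
  have NK: "N + K = int n" and n: "T n \<le> s" "s < T (Suc n)"
    using k unfolding is_K_eps_iff[OF \<epsilon>] n_def s_def N_def by auto
  define W where "W k m = side_node \<alpha> X (Suc k) m" for k m
  define D where "D k m = spine_Delta \<alpha> X (Suc k) m" for k m
  \<comment> \<open>Time \<open>s\<close> on the clock of the side subtree, counted from the birth
    of its root.\<close>
  define \<sigma> where "\<sigma> k m = \<M> (W k m) powr \<alpha> * (s - B (W k m))" for k m
  \<comment> \<open>The rearrangement of each side fragmentation comes with some bijection from
    ranks to blocks; one is chosen for all side nodes at once.\<close>
  have "\<exists>\<pi>. \<forall>k m. 0 < D k m \<longrightarrow>
      bij_betw (\<pi> k m) {l. frag \<alpha> (sub X (W k m)) (\<sigma> k m) l > 0} {v. present \<alpha> X s (v @ W k m)} \<and>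
      (\<forall>l. frag \<alpha> (sub X (W k m)) (\<sigma> k m) l > 0 \<longrightarrow>
        frag \<alpha> (sub X (W k m)) (\<sigma> k m) l = mass (sub X (W k m)) (\<pi> k m l))"
  proof (intro choice allI)
    fix k m
    show "\<exists>\<pi>. 0 < D k m \<longrightarrow>
      bij_betw \<pi> {l. frag \<alpha> (sub X (W k m)) (\<sigma> k m) l > 0} {v. present \<alpha> X s (v @ W k m)} \<and>
      (\<forall>l. frag \<alpha> (sub X (W k m)) (\<sigma> k m) l > 0 \<longrightarrow>
        frag \<alpha> (sub X (W k m)) (\<sigma> k m) l = mass (sub X (W k m)) (\<pi> l))"
    proof (cases "0 < D k m")
      case True
      then have w: "0 < \<M> (W k m)" using side_node_props(2) by (simp add: W_def D_def)
      interpret s: bounded_marks \<alpha> "sub X (W k m)" by (rule bounded_sub[OF w])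
      have "{v \<in> {v. present \<alpha> (sub X (W k m)) (\<sigma> k m) v}. 0 < mass (sub X (W k m)) v}
          = {v. present \<alpha> X s (v @ W k m)}"
        using present_sub_iff[OF w, of s] by (auto simp: \<sigma>_def) (auto simp: present_def)
      then show ?thesis using s.frag_is_dec_rearr[of "\<sigma> k m"] unfolding is_dec_rearr_def by auto
    qed simp
  qed
  then obtain \<pi> where \<pi>: "\<And>k m. 0 < D k m \<Longrightarrow>
      bij_betw (\<pi> k m) {l. frag \<alpha> (sub X (W k m)) (\<sigma> k m) l > 0} {v. present \<alpha> X s (v @ W k m)}"
    "\<And>k m l. 0 < D k m \<Longrightarrow> frag \<alpha> (sub X (W k m)) (\<sigma> k m) l > 0 \<Longrightarrow>
        frag \<alpha> (sub X (W k m)) (\<sigma> k m) l = mass (sub X (W k m)) (\<pi> k m l)"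
    by blast
  \<comment> \<open>The reversed time \<open>\<tau>\<close> lies between 0 and the threshold,
    because the side node was born by time \<open>s\<close>. Hence \<open>rev_path\<close> takes its
    main branch, and the threshold minus \<open>\<tau>\<close> is the forward time
    \<open>\<sigma> j m\<close>.\<close>
  have fSome: "?f (Some (i, m, l)) = \<M> (sp j) * D j m * frag \<alpha> (sub X (W j m)) (\<sigma> j m) l"
    if j: "N + i = int (Suc j)" "j < n" and D: "0 < D j m" for i m l j
  proof -
    have nat1: "nat (N + i) = Suc j" and nat2: "Theta_prod \<alpha> X (N + i - 1) = \<M> (sp j)"
      using j by (simp_all add: Theta_prod_def prod_Theta)
    have w: "\<M> (W j m) = \<M> (sp j) * D j m" "B (W j m) = T (Suc j)"
        "side_span \<alpha> X (Suc j) m = \<M> (W j m) powr \<alpha> * (\<zeta> - T (Suc j))" "0 < \<M> (W j m)"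
      using side_node_props[of j m] D by (simp_all add: W_def D_def)
    have "T (Suc j) \<le> T n" using j(2) T_strict_mono by (subst strict_mono_less_eq) auto
    then have "T (Suc j) \<le> s" using n by linarith
    then have le: "\<epsilon> * t \<le> \<zeta> - T (Suc j)" by (simp add: s_def)
    define \<tau> where "\<tau> = \<epsilon> * t * \<M> (sp j) powr \<alpha> * D j m powr \<alpha>"
    have \<tau>: "\<tau> = \<M> (W j m) powr \<alpha> * (\<epsilon> * t)"
      using mass_spine_pos[of j] D by (simp add: \<tau>_def w powr_mult)
    have "0 \<le> \<tau>" using \<epsilon> t by (simp add: \<tau>)
    moreover have "\<tau> \<le> side_span \<alpha> X (Suc j) m" unfolding \<tau> w(3) using le
        by (intro mult_left_mono) auto
    moreover have "side_span \<alpha> X (Suc j) m - \<tau> = \<sigma> j m"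
      unfolding \<sigma>_def w(2,3) \<tau> s_def by (simp add: algebra_simps)
    ultimately have "side_path \<alpha> X (Suc j) m \<tau> l = frag \<alpha> (sub X (W j m)) (\<sigma> j m) l"
      by (simp add: side_path_def rev_path_def W_def)
    then show ?thesis by (simp add: nat1 nat2 Delta_eq D_def[symmetric] \<tau>_def)
  qed
  have idx: "\<exists>j. N + i = int (Suc j) \<and> j < n" if "- N + 1 \<le> i" "i \<le> K" for i
    using that NK by (intro exI[of _ "nat (N + i - 1)"]) auto
  have D_pos: "0 < D j m" if "N + i = int (Suc j)" "0 < ?f (Some (i, m, l))" for i m l j
  proof (rule ccontr)
    assume "\<not> 0 < D j m"
    then have "D j m = 0" using valid_nonneg[OF valid]
        by (auto simp: D_def spine_Delta_Suc order_less_le)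
    moreover have "nat (N + i) = Suc j" using that(1) by simp
    ultimately show False using that(2) by (simp add: Delta_eq D_def[symmetric])
  qed
  define h where "h p = (case p of None \<Rightarrow> sp n
     | Some (i, m, l) \<Rightarrow> \<pi> (nat (N + i - 1)) m l @ W (nat (N + i - 1)) m)" for p
  have inI: "\<exists>j. N + i = int (Suc j) \<and> j < n \<and> 0 < D j m \<and> h (Some (i, m, l)) = \<pi> j m l @ W j m \<and>
      0 < frag \<alpha> (sub X (W j m)) (\<sigma> j m) l \<and> present \<alpha> X s (\<pi> j m l @ W j m) \<and>
      ?f (Some (i, m, l)) = \<M> (\<pi> j m l @ W j m)"
    if i: "Some (i, m, l) \<in> ?I" and pos: "0 < ?f (Some (i, m, l))" for i m l
  proof -
    obtain j where j: "N + i = int (Suc j)" "j < n" using i idx[of i] by auto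
    have D: "0 < D j m" using D_pos[OF j(1) pos] .
    have "nat (N + i - 1) = j" using j by simp
    then have h: "h (Some (i, m, l)) = \<pi> j m l @ W j m" by (simp add: h_def)
    have e: "?f (Some (i, m, l)) = \<M> (sp j) * D j m * frag \<alpha> (sub X (W j m)) (\<sigma> j m) l"
      by (rule fSome[OF j D])
    have fp: "0 < frag \<alpha> (sub X (W j m)) (\<sigma> j m) l"
      using pos mass_spine_pos[of j] D unfolding e
          by (auto simp: zero_less_mult_iff mult_less_0_iff)
    have "present \<alpha> X s (\<pi> j m l @ W j m)" using bij_betwE[OF \<pi>(1)[OF D]] fp by auto
    moreover have "?f (Some (i, m, l)) = \<M> (\<pi> j m l @ W j m)"
      unfolding e mass_append[of X "\<pi> j m l"] \<pi>(2)[OF D fp]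
      using side_node_props(1)[of j m] D by (simp add: W_def D_def)
    ultimately show ?thesis using j D h fp by blast
  qed
  have fNone: "?f None = \<M> (sp n)" by (simp add: NK Theta_prod_def prod_Theta)
  have suffW: "suffix (W j m) (v @ W j m)" for j m v by (simp add: suffixI)
  have not_sp: "v @ W j m \<noteq> sp n" if "j < n" for j m v
    using side_node_not_below_spine[of j m "sp n"] suffW[of j m v] suffix_spine[of "Suc j" n \<alpha> X]
        that
    by (auto simp: W_def)
  have inj: "inj_on h {p \<in> ?I. 0 < ?f p}"
  proof (rule inj_onI)
    fix p q assume p: "p \<in> {p \<in> ?I. 0 < ?f p}" and q: "q \<in> {p \<in> ?I. 0 < ?f p}" and eq: "h p = h q"
    show "p = q"
    proof (cases p)
      case None
      show ?thesis
      proof (cases q)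
        case (Some b)
        obtain i m l where b: "b = (i, m, l)" by (cases b) auto
        have "h q \<noteq> sp n" using inI[of i m l] q not_sp unfolding Some b by fastforce
        then show ?thesis using eq None by (simp add: h_def)
      qed (use None in simp)
    next
      case (Some a)
      obtain i m l where a: "a = (i, m, l)" by (cases a) auto
      obtain j where j: "N + i = int (Suc j)" "j < n" "0 < D j m" "h p = \<pi> j m l @ W j m"
          "0 < frag \<alpha> (sub X (W j m)) (\<sigma> j m) l"
        using inI[of i m l] p unfolding Some a by blast
      show ?thesis
      proof (cases q)
        case None
        then show ?thesis using eq j not_sp by (auto simp: h_def)
      next
        case (Some b)
        obtain i' m' l' where b: "b = (i', m', l')" by (cases b) auto
        obtain j' where j': "N + i' = int (Suc j')" "j' < n" "h q = \<pi> j' m' l' @ W j' m'"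
            "0 < frag \<alpha> (sub X (W j' m')) (\<sigma> j' m') l'"
          using inI[of i' m' l'] q unfolding Some b by blast
        have "suffix (W j m) (h p)" unfolding j(4) by (rule suffW)
        moreover have "suffix (W j' m') (h p)" unfolding eq j'(3) by (rule suffW)
        ultimately have "j = j' \<and> m = m'" unfolding W_def by (rule side_node_unique)
        then have jm: "j' = j" "m' = m" by auto
        have "\<pi> j m l = \<pi> j m l'" using eq j(4) j'(3) jm by simp
        then have "l = l'" using \<pi>(1)[OF j(3)] j(5) j'(4) jm
            by (auto simp: bij_betw_def dest: inj_onD)
        then show ?thesis using \<open>p = Some a\<close> Some a b jm j(1) j'(1) by simp
      qed
    qed
  qed
  have h_present: "h p \<in> {u. present \<alpha> X s u} \<and> \<M> (h p) = ?f p" if p: "p \<in> ?I" "0 < ?f p" for p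
  proof (cases p)
    case None
    then show ?thesis using n fNone by (simp add: h_def present_spine_iff del: spine.simps)
  next
    case (Some a)
    obtain i m l where a: "a = (i, m, l)" by (cases a) auto
    show ?thesis using inI[of i m l] p unfolding Some a by force
  qed
  have h_onto: "\<exists>p \<in> ?I. 0 < ?f p \<and> h p = u" if u: "present \<alpha> X s u" for u
    using present_decomposition[OF n u]
  proof
    assume "u = sp n"
    then show ?thesis using mass_spine_pos[of n] fNone by (intro bexI[of _ None]) (auto simp: h_def)
  next
    assume "\<exists>k<n. \<exists>m v. 0 < spine_Delta \<alpha> X (Suc k) m \<and> u = v @ side_node \<alpha> X (Suc k) m"
    then obtain j m v where j: "j < n" "0 < D j m" "u = v @ W j m" by (auto simp: D_def W_def)
    then have "v \<in> {v. present \<alpha> X s (v @ W j m)}" using u by simp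
    then obtain l where l: "0 < frag \<alpha> (sub X (W j m)) (\<sigma> j m) l" "v = \<pi> j m l"
      using \<pi>(1)[OF j(2)] by (auto simp: bij_betw_def)
    define i where "i = int (Suc j) - N"
    have i: "N + i = int (Suc j)" by (simp add: i_def)
    have "0 < ?f (Some (i, m, l))"
      unfolding fSome[OF i j(1,2)] using mass_spine_pos[of j] j(2) l(1) by simp
    moreover have "Some (i, m, l) \<in> ?I" using j(1) NK by (auto simp: i_def)
    moreover have "h (Some (i, m, l)) = u" using j l by (simp add: h_def i_def)
    ultimately show ?thesis by blast
  qed
  have "h ` {p \<in> ?I. 0 < ?f p} = {u \<in> {u. present \<alpha> X s u}. 0 < \<M> u}"
  proof (rule equalityI; rule subsetI)
    fix u assume "u \<in> h ` {p \<in> ?I. 0 < ?f p}"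
    then obtain p where p: "p \<in> ?I" "0 < ?f p" "u = h p" by blast
    show "u \<in> {u \<in> {u. present \<alpha> X s u}. 0 < \<M> u}"
      using h_present[OF p(1,2)] p(2,3) by (simp del: mass.simps)
  next
    fix u assume "u \<in> {u \<in> {u. present \<alpha> X s u}. 0 < \<M> u}"
    then have "present \<alpha> X s u" by blast
    then obtain p where "p \<in> ?I" "0 < ?f p" "h p = u" using h_onto by blast
    then show "u \<in> h ` {p \<in> ?I. 0 < ?f p}" by blast
  qed
  then have "dec_rearr ?I ?f = dec_rearr {u. present \<alpha> X s u} \<M>"
    using inj h_present by (intro dec_rearr_reindex[of h] bij_betw_imageI) blast+
  then show ?thesis by (simp only: frag_def s_def)
qed

end

section \<open>Measurability\<close>

lemma is_dec_rearr_sum_le: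
  assumes "is_dec_rearr I f s" "finite F" "F \<subseteq> {i \<in> I. f i > 0}"
  shows "sum f F \<le> suminf s"
proof -
  obtain \<pi> where \<pi>: "bij_betw \<pi> {k. s k > 0} {i \<in> I. f i > 0}" "\<And>k. s k > 0 \<Longrightarrow> s k = f (\<pi> k)"
    using assms(1) by (auto simp: is_dec_rearr_def)
  have "F \<subseteq> \<pi> ` {k. s k > 0}" using assms(3) \<pi>(1) by (simp add: bij_betw_def)
  then obtain A where A: "A \<subseteq> {k. s k > 0}" "F = \<pi> ` A" by (rule subset_imageE)
  have inj: "inj_on \<pi> A" using \<pi>(1) A by (meson bij_betw_def inj_on_subset)
  have "finite A" using assms(2) A(2) inj by (simp add: finite_image_iff)
  have "sum f F = sum s A" unfolding A(2) using A(1) \<pi>(2)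
      by (subst sum.reindex[OF inj]) (auto intro!: sum.cong)
  also have "\<dots> \<le> suminf s"
    using assms(1) \<open>finite A\<close> by (intro sum_le_suminf) (auto simp: is_dec_rearr_def mass_seqs_def)
  finally show ?thesis .
qed

text \<open>The first conjunct says that a rearrangement exists, namely that the finite sums of
  positive members are bounded; the second counts the members above \<open>c\<close>. Without a
  rearrangement the default \<open>zero_seq\<close> makes both sides false. Lists replace finite
  sets so that all quantifiers range over countable types.\<close>

lemma dec_rearr_gt_iff:
  fixes f :: "'i :: countable \<Rightarrow> real"
  assumes "c \<ge> 0"
  shows "dec_rearr I f k > c \<longleftrightarrow>
    (\<exists>C::nat. \<forall>xs. (\<forall>i\<in>set xs. i \<in> I \<and> f i > 0) \<longrightarrow> sum f (set xs) \<le> real C) \<and>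
    (\<exists>xs. (\<forall>i\<in>set xs. i \<in> I \<and> f i > c) \<and> card (set xs) = Suc k)"
proof (cases "\<exists>s. is_dec_rearr I f s")
  case True
  then have d: "is_dec_rearr I f (dec_rearr I f)" by (rule dec_rearr_is_dec_rearr)
  obtain C :: nat where "suminf (dec_rearr I f) \<le> real C" using real_arch_simple by blast
  then have "\<forall>xs. (\<forall>i\<in>set xs. i \<in> I \<and> f i > 0) \<longrightarrow> sum f (set xs) \<le> real C"
    using is_dec_rearr_sum_le[OF d finite_set] by (auto intro: order_trans simp: subset_iff)
  moreover have "dec_rearr I f k > c \<longleftrightarrow> (\<exists>xs. (\<forall>i\<in>set xs. i \<in> I \<and> f i > c) \<and> card (set xs) = Suc k)"
    unfolding is_dec_rearr_gt_iff[OF d assms] subset_iff mem_Collect_eq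
    using finite_list finite_set by metis
  ultimately show ?thesis by blast
next
  case False
  then have "dec_rearr I f = zero_seq" unfolding dec_rearr_def by (simp only: if_False)
  moreover have "\<not> (\<exists>C::nat. \<forall>xs. (\<forall>i\<in>set xs. i \<in> I \<and> f i > 0) \<longrightarrow> sum f (set xs) \<le> real C)"
  proof
    assume "\<exists>C::nat. \<forall>xs. (\<forall>i\<in>set xs. i \<in> I \<and> f i > 0) \<longrightarrow> sum f (set xs) \<le> real C"
    then obtain C :: nat
      where C: "\<And>xs. \<forall>i\<in>set xs. i \<in> I \<and> f i > 0 \<Longrightarrow> sum f (set xs) \<le> real C" by auto
    have "\<exists>s. is_dec_rearr I f s"
    proof (rule ex_is_dec_rearr[where C = "real C"])
      fix F assume F: "finite F" "F \<subseteq> {i \<in> I. 0 < f i}"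
      obtain xs where "set xs = F" using finite_list[OF F(1)] by blast
      then show "sum f F \<le> real C" using C[of xs] F(2) by auto
    qed
    then show False using False by simp
  qed
  ultimately show ?thesis using assms by (simp add: zero_seq_def)
qed

lemma space_seq_borel: "space seq_borel = mass_seqs"
  unfolding seq_borel_def by (simp add: space_measure_of_conv)

lemma seq_dist_eq_suminf:
  assumes "s \<in> mass_seqs" "s' \<in> mass_seqs"
  shows "summable (\<lambda>i. \<bar>s i - s' i\<bar>)" "seq_dist s s' = (\<Sum>i. \<bar>s i - s' i\<bar>)"
proof -
  show *: "summable (\<lambda>i. \<bar>s i - s' i\<bar>)"
    using seq_dist_summable[OF assms] by (simp add: summable_on_UNIV_nonneg_real_iff)
  then have "((\<lambda>i. \<bar>s i - s' i\<bar>) has_sum (\<Sum>i. \<bar>s i - s' i\<bar>)) UNIV"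
    by (intro sums_nonneg_imp_has_sum summable_sums) auto
  then show "seq_dist s s' = (\<Sum>i. \<bar>s i - s' i\<bar>)" unfolding seq_dist_def by (rule infsumI)
qed

lemma seq_borel_opens_subset: "{U. openin (Metric_space.mtopology mass_seqs seq_dist) U} \<subseteq> Pow
    mass_seqs"
  using Metric_space.openin_mtopology[OF Metric_space_mass_seqs] by auto

lemma measurable_seq_borel_component [measurable]: "(\<lambda>s. s i) \<in> borel_measurable seq_borel"
  unfolding borel_measurable_iff_greater
proof
  fix c
  interpret m: Metric_space mass_seqs seq_dist by (rule Metric_space_mass_seqs)
  have "openin m.mtopology {s \<in> mass_seqs. c < s i}"
    unfolding m.openin_mtopology
  proof (intro conjI allI impI)
    fix s assume s: "s \<in> {s \<in> mass_seqs. c < s i}"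
    have "m.mball s (s i - c) \<subseteq> {s \<in> mass_seqs. c < s i}"
    proof
      fix s' assume "s' \<in> m.mball s (s i - c)"
      then have s': "s' \<in> mass_seqs" "seq_dist s s' < s i - c" by auto
      have "\<bar>s i - s' i\<bar> \<le> seq_dist s s'"
        using sum_le_suminf[OF seq_dist_eq_suminf(1), of s s' "{i}"]
            seq_dist_eq_suminf(2)[of s s'] s s' by simp
      then show "s' \<in> {s \<in> mass_seqs. c < s i}" using s' by auto
    qed
    then show "\<exists>r>0. m.mball s r \<subseteq> {s \<in> mass_seqs. c < s i}" using s
        by (intro exI[of _ "s i - c"]) auto
  qed auto
  then have "{s \<in> mass_seqs. c < s i} \<in> sets seq_borel"
    unfolding seq_borel_def sets_measure_of[OF seq_borel_opens_subset]
    by (intro sigma_sets.Basic) auto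
  then show "{w \<in> space seq_borel. c < w i} \<in> sets seq_borel" by (simp add: space_seq_borel)
qed

definition rat_seq :: "rat list \<Rightarrow> nat \<Rightarrow> real" where
  "rat_seq xs i = (if i < length xs then real_of_rat (xs ! i) else 0)"

lemma summable_rat_seq:
  assumes "s \<in> mass_seqs"
  shows "summable (\<lambda>i. \<bar>s i - rat_seq xs i\<bar>)"
proof (rule summable_comparison_test_ev)
  show "\<forall>\<^sub>F n in sequentially. norm \<bar>s n - rat_seq xs n\<bar> \<le> s n"
    using eventually_ge_at_top[of "length xs"]
    by eventually_elim (use assms in \<open>auto simp: rat_seq_def mass_seqs_def\<close>)
qed (use assms in \<open>auto simp: mass_seqs_def\<close>)

lemma rat_seq_dense:
  assumes s: "s \<in> mass_seqs" and r: "0 < r"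
  shows "\<exists>xs. (\<Sum>i. \<bar>s i - rat_seq xs i\<bar>) < r"
proof -
  have sm: "summable s" and nn: "\<And>i. 0 \<le> s i" using s by (auto simp: mass_seqs_def)
  obtain n where n: "\<And>m. m \<ge> n \<Longrightarrow> norm (\<Sum>i. s (i + m)) < r / 2"
    using suminf_exist_split[OF _ sm, of "r / 2"] r by auto
  have "\<exists>q. \<bar>s i - real_of_rat q\<bar> < r / (2 * (real n + 1))" for i
  proof -
    have "s i < s i + r / (2 * (real n + 1))" using r by (simp add: add_pos_nonneg)
    then obtain q where "s i < real_of_rat q" "real_of_rat q < s i + r / (2 * (real n + 1))"
      using of_rat_dense by blast
    then show ?thesis by (intro exI[of _ q]) auto
  qed
  then obtain q where q: "\<And>i. \<bar>s i - real_of_rat (q i)\<bar> < r / (2 * (real n + 1))" by metis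
  define xs where "xs = map q [0..<n]"
  have "(\<Sum>i. \<bar>s i - rat_seq xs i\<bar>) = (\<Sum>i. \<bar>s (i + n) - rat_seq xs (i + n)\<bar>) + (\<Sum>i<n. \<bar>s i -
      rat_seq xs i\<bar>)"
    by (rule suminf_split_initial_segment[OF summable_rat_seq[OF s]])
  also have "(\<lambda>i. \<bar>s (i + n) - rat_seq xs (i + n)\<bar>) = (\<lambda>i. s (i + n))"
    using nn by (auto simp: rat_seq_def xs_def)
  also have "(\<Sum>i<n. \<bar>s i - rat_seq xs i\<bar>) \<le> (\<Sum>i<n. r / (2 * (real n + 1)))"
    using q by (intro sum_mono) (auto simp: rat_seq_def xs_def intro: less_imp_le)
  also have "\<dots> \<le> r / 2" using r by (simp add: field_simps)
  also have "(\<Sum>i. s (i + n)) < r / 2" using n[of n] by auto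
  finally show ?thesis by (intro exI[of _ xs]) simp
qed

text \<open>By separability, an open set is within \<open>mass_seqs\<close> a countable union of
  sets of points close to some \<open>rat_seq\<close>, and the distance to a fixed sequence is
  measurable in the coordinates. So coordinates suffice to test measurability.\<close>

lemma measurable_seq_borelI:
  assumes f: "\<And>x. x \<in> space M \<Longrightarrow> f x \<in> mass_seqs"
    and c[measurable]: "\<And>i. (\<lambda>x. f x i) \<in> borel_measurable M"
  shows "f \<in> measurable M seq_borel"
  unfolding seq_borel_def
proof (rule measurable_measure_of[OF seq_borel_opens_subset])
  show "f \<in> space M \<rightarrow> mass_seqs" using f by auto
  interpret m: Metric_space mass_seqs seq_dist by (rule Metric_space_mass_seqs)
  fix U assume "U \<in> {U. openin m.mtopology U}"
  then have U: "U \<subseteq> mass_seqs" "\<And>s. s \<in> U \<Longrightarrow> \<exists>r>0. m.mball s r \<subseteq> U"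
    unfolding m.openin_mtopology mem_Collect_eq by auto
  define D where "D s xs = (\<Sum>i. \<bar>s i - rat_seq xs i\<bar>)" for s xs
  \<comment> \<open>The rational balls whose trace on \<open>mass_seqs\<close> lies in
    \<open>U\<close>; the radius \<open>1 / (k + 1)\<close> is chosen with twice its value below the
    radius of a ball contained in \<open>U\<close>.\<close>
  define P where "P = {(xs, k :: nat). \<forall>s\<in>mass_seqs. D s xs < 1 / (real k + 1) \<longrightarrow> s \<in> U}"
  have "s \<in> U \<longleftrightarrow> (\<exists>(xs, k)\<in>P. D s xs < 1 / (real k + 1))" if s: "s \<in> mass_seqs" for s
  proof
    assume "s \<in> U"
    then obtain r where r: "r > 0" "m.mball s r \<subseteq> U" using U(2) by blast
    obtain k :: nat where k: "2 / r < real k" using reals_Archimedean2 by blast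
    have k2: "2 / (real k + 1) < r" using k r(1) by (simp add: field_simps)
    obtain xs where xs: "D s xs < 1 / (real k + 1)"
      using rat_seq_dense[OF s, of "1 / (real k + 1)"] by (auto simp: D_def)
    have "s' \<in> U" if s': "s' \<in> mass_seqs" "D s' xs < 1 / (real k + 1)" for s'
    proof -
      have "seq_dist s s' \<le> D s xs + D s' xs"
        unfolding seq_dist_eq_suminf(2)[OF s s'(1)] D_def
          suminf_add[OF summable_rat_seq[OF s] summable_rat_seq[OF s'(1)]]
        by (intro suminf_le seq_dist_eq_suminf(1) s s' summable_add summable_rat_seq) auto
      also have "\<dots> < 2 / (real k + 1)" using xs s'(2) by (simp add: field_simps)
      finally have "s' \<in> m.mball s r" using s s' k2 by auto
      then show ?thesis using r by blast
    qed
    then show "\<exists>(xs, k)\<in>P. D s xs < 1 / (real k + 1)" using xs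
        by (intro bexI[of _ "(xs, k)"]) (auto simp: P_def)
  qed (use s in \<open>auto simp: P_def\<close>)
  then have "f -` U \<inter> space M = {x \<in> space M. \<exists>p\<in>P. D (f x) (fst p) < 1 / (real (snd p) + 1)}"
    using f by (auto simp: case_prod_beta)
  also have "\<dots> \<in> sets M" unfolding D_def by measurable
  finally show "f -` U \<inter> space M \<in> sets M" .
qed

locale dislocation =
  fixes \<alpha> :: real and \<nu> :: "(nat \<Rightarrow> real) measure"
  assumes sets_nu: "sets \<nu> = sets (restrict_space seq_borel unit_mass_seqs)"
begin

abbreviation "mark_space \<equiv> (borel :: real measure) \<Otimes>\<^sub>M \<nu>"
abbreviation "marks_space \<equiv> (\<Pi>\<^sub>M u \<in> (UNIV :: nat list set). mark_space)"

lemma space_nu: "space \<nu> = unit_mass_seqs"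
  using sets_eq_imp_space_eq[OF sets_nu]
      by (auto simp: space_restrict_space space_seq_borel unit_mass_seqs_def)

lemma space_mark_space: "space mark_space = UNIV \<times> unit_mass_seqs"
  by (simp add: space_pair_measure space_nu)

lemma space_marks_space: "space marks_space = {X. valid_marks X}"
  by (auto simp: space_PiM space_mark_space valid_marks_def PiE_def Pi_iff mem_Times_iff)

lemma measurable_nu_component [measurable]: "(\<lambda>s. s i) \<in> borel_measurable \<nu>"
  by (subst measurable_cong_sets[OF sets_nu refl])
      (intro measurable_restrict_space1 measurable_seq_borel_component)

lemma measurable_fst_mark [measurable]: "(\<lambda>X. fst (X u)) \<in> borel_measurable marks_space"
  by measurable

lemma measurable_snd_mark [measurable]: "(\<lambda>X. snd (X u) i) \<in> borel_measurable marks_space"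
proof -
  have "(\<lambda>X. snd (X u)) \<in> measurable marks_space \<nu>" by measurable
  from measurable_compose[OF this measurable_nu_component] show ?thesis .
qed

lemma measurable_mass [measurable]: "(\<lambda>X. mass X u) \<in> borel_measurable marks_space"
  by (induction u) auto

lemma measurable_birth [measurable]: "(\<lambda>X. birth \<alpha> X u) \<in> borel_measurable marks_space"
  by (induction u) auto

lemma measurable_bdd [measurable]: "Measurable.pred marks_space (\<lambda>X. bdd_above (range (birth \<alpha> X)))"
proof -
  have "bdd_above (range (birth \<alpha> X)) \<longleftrightarrow> (\<exists>n::nat. \<forall>u. birth \<alpha> X u \<le> real n)" for X
  proof
    assume "bdd_above (range (birth \<alpha> X))"
    then obtain C where C: "birth \<alpha> X u \<le> C" for u by (auto simp: bdd_above_def)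
    obtain n :: nat where "C \<le> real n" using real_arch_simple by blast
    then show "\<exists>n::nat. \<forall>u. birth \<alpha> X u \<le> real n" using C by (meson order_trans)
  qed (auto simp: bdd_above_def)
  then show ?thesis by simp
qed

lemma measurable_subtree_ext [measurable]: "(\<lambda>X. subtree_ext \<alpha> X u) \<in> borel_measurable marks_space"
  unfolding subtree_ext_def
proof (rule borel_measurable_cSUP)
  fix X show "bdd_above (range (\<lambda>v. if bdd_above (range (birth \<alpha> X)) then birth \<alpha> X (v @ u) else
      0))"
  proof (cases "bdd_above (range (birth \<alpha> X))")
    case True
    have "bdd_above (range (\<lambda>v. birth \<alpha> X (v @ u)))" using True by (rule bdd_above_mono) auto
    then show ?thesis using True by simp
  qed simp
qed auto

lemma measurable_lead [measurable]: "(\<lambda>X. lead \<alpha> X u) \<in> measurable marks_space (count_space UNIV)"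
  unfolding lead_def by measurable

lemma measurable_spine [measurable]: "(\<lambda>X. spine \<alpha> X n) \<in> measurable marks_space (count_space UNIV)"
proof (induction n)
  case (Suc n)
  have "(\<lambda>X. lead \<alpha> X u # u) \<in> measurable marks_space (count_space UNIV)" for u
    by (rule measurable_compose[OF measurable_lead]) simp
  from measurable_compose_countable[OF this Suc] show ?case by simp
qed simp

text \<open>A spine node takes countably many values, so evaluation at it preserves
  measurability.\<close>

lemma measurable_at_spine:
  "(\<And>u. (\<lambda>X. f u X) \<in> measurable marks_space N)
      \<Longrightarrow> (\<lambda>X. f (spine \<alpha> X n) X) \<in> measurable marks_space N"
  by (rule measurable_compose_countable[OF _ measurable_spine])

lemma measurable_mass_spine [measurable]:
    "(\<lambda>X. mass X (spine \<alpha> X n)) \<in> borel_measurable marks_space"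
  by (rule measurable_at_spine) simp

lemma measurable_birth_spine [measurable]:
    "(\<lambda>X. birth \<alpha> X (spine \<alpha> X n)) \<in> borel_measurable marks_space"
  by (rule measurable_at_spine) simp

lemma measurable_spine_Z [measurable]: "(\<lambda>X. spine_Z \<alpha> X n) \<in> borel_measurable marks_space"
  unfolding spine_Z_def by measurable

lemma measurable_spine_Theta [measurable]: "(\<lambda>X. spine_Theta \<alpha> X n) \<in> borel_measurable marks_space"
  unfolding spine_Theta_def by measurable

lemma spine_Delta_mass_seqs:
  assumes "X \<in> space marks_space"
  shows "spine_Delta \<alpha> X n \<in> mass_seqs"
  using assms
  by (auto simp: spine_Delta_def space_marks_space valid_marks_def intro: skip_mass_seqs)

lemma measurable_spine_Delta_component [measurable]:
  "(\<lambda>X. spine_Delta \<alpha> X n m) \<in> borel_measurable marks_space"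
proof (cases n)
  case (Suc k)
  have "(\<lambda>X. snd (X u) (skip (lead \<alpha> X u) m)) \<in> borel_measurable marks_space" for u
    by (rule measurable_compose_countable[OF measurable_snd_mark])
      (rule measurable_compose[OF measurable_lead], simp)
  from measurable_at_spine[OF this] show ?thesis by (simp add: spine_Delta_def Suc)
qed (simp add: spine_Delta_def)

lemma measurable_spine_Delta [measurable]:
    "(\<lambda>X. spine_Delta \<alpha> X n) \<in> measurable marks_space seq_borel"
  by (rule measurable_seq_borelI) (use spine_Delta_mass_seqs in auto)

lemma measurable_side_span [measurable]: "(\<lambda>X. side_span \<alpha> X n m) \<in> borel_measurable marks_space"
  unfolding side_span_def by measurable

lemma measurable_side_node [measurable]:
    "(\<lambda>X. side_node \<alpha> X n m) \<in> measurable marks_space (count_space UNIV)"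
  unfolding side_node_def
  by (rule measurable_at_spine) (rule measurable_compose[OF measurable_lead], simp)

lemma measurable_sub [measurable]: "(\<lambda>X. sub X w) \<in> measurable marks_space marks_space"
  unfolding sub_def by (rule measurable_abs_UNIV) simp

lemma measurable_on_spine [measurable]: "Measurable.pred marks_space (\<lambda>X. on_spine \<alpha> X u)"
  by (induction u) auto

text \<open>Joint measurability in the marks and the time is asked for, because side fragmentations
  are read at times which depend on random thresholds.\<close>

lemma measurable_frag:
  assumes [measurable]: "g \<in> measurable M marks_space" "\<tau> \<in> borel_measurable M"
  shows "(\<lambda>x. frag \<alpha> (g x) (\<tau> x)) \<in> measurable M seq_borel"
proof (rule measurable_seq_borelI)
  show "frag \<alpha> (g x) (\<tau> x) \<in> mass_seqs" for x by (simp add: frag_def)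
  fix k
  have [measurable]: "(\<lambda>x. mass (g x) u) \<in> borel_measurable M"
      "(\<lambda>x. birth \<alpha> (g x) u) \<in> borel_measurable M"
    "(\<lambda>x. fst (g x u)) \<in> borel_measurable M" for u
    using measurable_compose[OF assms(1) measurable_mass]
        measurable_compose[OF assms(1) measurable_birth]
      measurable_compose[OF assms(1) measurable_fst_mark] by auto
  have [measurable]: "Measurable.pred M (\<lambda>x. present \<alpha> (g x) (\<tau> x) u)" for u
    unfolding present_def by measurable
  show "(\<lambda>x. frag \<alpha> (g x) (\<tau> x) k) \<in> borel_measurable M"
    unfolding borel_measurable_iff_greater
  proof
    fix c :: real
    show "{w \<in> space M. c < frag \<alpha> (g w) (\<tau> w) k} \<in> sets M"
    proof (cases "c \<ge> 0")
      case True
      show ?thesis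
        unfolding frag_def dec_rearr_gt_iff[OF True] mem_Collect_eq by measurable
    next
      case False
      have "c < frag \<alpha> (g w) (\<tau> w) k" for w
        using mass_seqs_nonneg[OF dec_rearr_in_mass_seqs, of _ _ k] False
        unfolding frag_def by (meson less_le_trans not_le)
      then show ?thesis by simp
    qed
  qed
qed

lemma measurable_rev_path:
  assumes [measurable]: "g \<in> measurable M marks_space" "x \<in> borel_measurable M"
  shows "(\<lambda>\<omega>. rev_path \<alpha> (x \<omega>) (g \<omega>)) \<in> measurable M path_space"
  unfolding rev_path_def path_space_def
proof (rule measurable_restrict)
  fix t :: real
  have [measurable]: "(\<lambda>\<omega>. frag \<alpha> (g \<omega>) (x \<omega> - t)) \<in> measurable M seq_borel"
    by (rule measurable_frag) auto
  show "(\<lambda>\<omega>. if t \<le> x \<omega> then frag \<alpha> (g \<omega>) (x \<omega> - t) else zero_seq) \<in> measurable M seq_borel"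
    by (intro measurable_If) (auto simp: space_seq_borel)
qed

lemma measurable_side_path:
  "(\<lambda>X. side_path \<alpha> X n m) \<in> measurable marks_space path_space"
  unfolding side_path_def
  by (intro measurable_rev_path measurable_side_span measurable_compose_countable[OF
      measurable_sub measurable_side_node])

end

section \<open>Almost sure regularity of the marks\<close>

text \<open>If \<open>y > b\<close>, the factor \<open>(y / b) ^ (p - 1)\<close> exceeds 1. The
  inequality trades a lifetime for its \<open>p\<close>-th power plus a term \<open>b\<close> that
  will be geometric in the generation, so that sums along a path stay bounded.\<close>

lemma le_weighted_power:
  fixes y b :: real
  assumes "0 \<le> y" "0 < b" "1 \<le> p"
  shows "y \<le> b + y ^ p / b ^ (p - 1)"
proof (cases "y \<le> b")
  case True
  then show ?thesis using assms by (simp add: add_increasing2)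
next
  case False
  then have "b ^ (p - 1) \<le> y ^ (p - 1)" using assms by (intro power_mono) auto
  then have "y * b ^ (p - 1) \<le> y ^ p" using assms by (simp add: power_eq_if mult_left_mono)
  then have "y \<le> y ^ p / b ^ (p - 1)" using assms by (simp add: field_simps)
  then show ?thesis using assms by simp
qed

text \<open>The increments of the birth time are added up along the path;
  \<open>drop (length v - k) v @ u\<close> is the node on it that lies \<open>k\<close> generations
  below \<open>u\<close>. The parameter \<open>\<delta>\<close> balances the geometric part against
  the part that involves \<open>h\<close>.\<close>

lemma birth_increment_le:
  fixes \<alpha> :: real
  assumes v: "valid_marks X" "\<And>u. 0 \<le> fst (X u)" and c: "0 < c" "c < 1" and p: "1
      \<le> p" and \<delta>: "0 < \<delta>"
  defines "h \<equiv> \<lambda>v. (mass X v powr (- \<alpha>) * fst (X v)) ^ p / (c ^ length v) ^ (p - 1)"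
  shows "birth \<alpha> X (v @ u) - birth \<alpha> X u
    \<le> \<delta> * (\<Sum>k<length v. c ^ k) + (\<Sum>k<length v. h (drop (length v - k) v @ u)) / \<delta> ^ (p - 1)"
proof (induction v)
  case (Cons i v)
  define y where "y = mass X (v @ u) powr (- \<alpha>) * fst (X (v @ u))"
  have y: "0 \<le> y" using v by (simp add: y_def)
  define b where "b = \<delta> * c ^ length (v @ u)"
  have b: "0 < b" using \<delta> c by (simp add: b_def)
  have "y \<le> b + y ^ p / b ^ (p - 1)" by (rule le_weighted_power[OF y b p])
  also have "y ^ p / b ^ (p - 1) = h (v @ u) / \<delta> ^ (p - 1)"
    unfolding b_def power_mult_distrib by (simp add: h_def y_def mult.commute)
  \<comment> \<open>The generation counted from the root is at least the one counted from
    \<open>u\<close>, and \<open>c < 1\<close>. The weights inside \<open>h\<close> stay absolute,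
    so that one and the same \<open>h\<close> serves every \<open>u\<close>.\<close>
  also have "b \<le> \<delta> * c ^ length v"
    unfolding b_def using c \<delta> by (intro mult_left_mono power_decreasing) auto
  finally have y_le: "y \<le> \<delta> * c ^ length v + h (v @ u) / \<delta> ^ (p - 1)" by simp
  have e: "(\<Sum>k<length v. h (drop (length (i # v) - k) (i # v) @ u))
      = (\<Sum>k<length v. h (drop (length v - k) v @ u))"
    by (intro sum.cong refl) (simp add: Suc_diff_le)
  have "birth \<alpha> X ((i # v) @ u) - birth \<alpha> X u = (birth \<alpha> X (v @ u) - birth \<alpha> X u) + y"
    by (simp add: y_def)
  also have "\<dots> \<le> (\<delta> * (\<Sum>k<length v. c ^ k) + (\<Sum>k<length v. h (drop (length v - k) v @ u)) / \<delta> ^ (p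
      - 1))
      + (\<delta> * c ^ length v + h (v @ u) / \<delta> ^ (p - 1))"
    using Cons y_le by (rule add_mono)
  also have "\<dots> = \<delta> * (\<Sum>k<length (i # v). c ^ k)
      + (\<Sum>k<length (i # v). h (drop (length (i # v) - k) (i # v) @ u)) / \<delta> ^ (p - 1)"
    using e by (simp add: algebra_simps add_divide_distrib)
  finally show ?case .
qed simp

text \<open>
  The tail of the convergent sum controls all subtrees which avoid a large finite set of nodes.
\<close>

lemma birth_oscillation:
  fixes \<alpha> :: real
  assumes v: "valid_marks X" "\<And>u. 0 \<le> fst (X u)" and c: "0 < c" "c < 1" and p: "1 \<le> p"
  defines "h \<equiv> \<lambda>v. (mass X v powr (- \<alpha>) * fst (X v)) ^ p / (c ^ length v) ^ (p - 1)"
  assumes C: "\<And>F. finite F \<Longrightarrow> sum h F \<le> C"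
  shows "bdd_above (range (birth \<alpha> X))"
    and "0 < \<eta> \<Longrightarrow> \<exists>F. finite F \<and> (\<forall>u. (\<forall>w\<in>F. \<not> suffix u w) \<longrightarrow> (\<forall>v. birth \<alpha> X (v @ u)
        \<le> birth \<alpha> X u + \<eta>))"
proof -
  have h0: "0 \<le> h v" for v using c v by (simp add: h_def)
  have geo: "(\<Sum>k<n. c ^ k) \<le> 1 / (1 - c)" for n
  proof -
    have "(1 - c) * (\<Sum>k<n. c ^ k) = 1 - c ^ n" using c by (simp add: sum_gp_strict)
    also have "\<dots> \<le> 1" using c by simp
    finally show ?thesis using c by (simp add: pos_le_divide_eq mult.commute)
  qed
  have chain: "(\<Sum>k<length v. h (drop (length v - k) v @ u))
      = sum h ((\<lambda>k. drop (length v - k) v @ u) ` {..<length v})" for v u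
  proof (subst sum.reindex)
    show "inj_on (\<lambda>k. drop (length v - k) v @ u) {..<length v}"
    proof (rule inj_onI)
      fix k l assume kl: "k \<in> {..<length v}" "l \<in> {..<length v}" "drop (length v - k) v @ u
          = drop (length v - l) v @ u"
      then have "drop (length v - k) v = drop (length v - l) v" by simp
      then have "length (drop (length v - k) v) = length (drop (length v - l) v)" by (rule arg_cong)
      then show "k = l" using kl(1,2) by simp
    qed
  qed simp
  have key: "birth \<alpha> X (v @ u) \<le> birth \<alpha> X u + (\<delta> / (1 - c) + S / \<delta> ^ (p - 1))"
    if "0 < \<delta>" and S: "\<And>F. finite F \<Longrightarrow> \<forall>w\<in>F. suffix u w \<Longrightarrow> sum h F \<le> S" for u v \<delta> S
  proof -
    have "birth \<alpha> X (v @ u) - birth \<alpha> X u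
       \<le> \<delta> * (\<Sum>k<length v. c ^ k) + (\<Sum>k<length v. h (drop (length v - k) v @ u)) / \<delta> ^ (p - 1)"
      unfolding h_def by (rule birth_increment_le[OF v c p that(1)])
    also have "\<dots> \<le> \<delta> * (1 / (1 - c)) + S / \<delta> ^ (p - 1)"
      unfolding chain using that(1)
      by (intro add_mono mult_left_mono divide_right_mono geo S) (auto simp: suffixI)
    finally show ?thesis by simp
  qed
  have "birth \<alpha> X v \<le> 1 / (1 - c) + C / 1 ^ (p - 1)" for v
    using key[of 1 "[]" C v] C by simp
  then show "bdd_above (range (birth \<alpha> X))" by (intro bdd_aboveI2)
  assume \<eta>: "0 < \<eta>"
  \<comment> \<open>The constants \<open>\<delta>\<close> and, below, \<open>\<eta>'\<close> make
    the geometric part and the tail of the sum contribute \<open>\<eta> / 2\<close> each.\<close>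
  define \<delta> where "\<delta> = \<eta> * (1 - c) / 2"
  have \<delta>: "0 < \<delta>" using \<eta> c by (simp add: \<delta>_def)
  have sm: "h summable_on UNIV"
    by (rule nonneg_bdd_above_summable_on) (use h0 C in \<open>auto intro!: bdd_aboveI2\<close>)
  define \<eta>' where "\<eta>' = \<eta> / 2 * \<delta> ^ (p - 1)"
  have \<eta>': "0 < \<eta>'" using \<eta> \<delta> by (simp add: \<eta>'_def)
  obtain F where F: "finite F" "dist (sum h F) (infsum h UNIV) \<le> \<eta>'"
    using has_sum_finite_approximation[OF has_sum_infsum[OF sm] \<eta>'] by blast
  have tail: "sum h G \<le> \<eta>'" if G: "finite G" "F \<inter> G = {}" for G
  proof -
    have "sum h F + sum h G = sum h (F \<union> G)" using F(1) G by (simp add: sum.union_disjoint)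
    also have "\<dots> \<le> infsum h UNIV" using F(1) G h0 by (intro finite_sum_le_infsum[OF sm]) auto
    also have "\<dots> \<le> sum h F + \<eta>'" using F(2) by (simp add: dist_real_def abs_if split: if_splits)
    finally show ?thesis by simp
  qed
  have "birth \<alpha> X (v @ u) \<le> birth \<alpha> X u + \<eta>" if u: "\<forall>w\<in>F. \<not> suffix u w" for u v
  proof -
    have "birth \<alpha> X (v @ u) \<le> birth \<alpha> X u + (\<delta> / (1 - c) + \<eta>' / \<delta> ^ (p - 1))"
      by (rule key[OF \<delta>], rule tail) (use u in auto)
    also have "\<delta> / (1 - c) = \<eta> / 2" using c by (simp add: \<delta>_def field_simps)
    also have "\<eta>' / \<delta> ^ (p - 1) = \<eta> / 2" using \<delta> by (simp add: \<eta>'_def)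
    also have "\<eta> / 2 + \<eta> / 2 = \<eta>" by simp
    finally show ?thesis .
  qed
  then show "\<exists>F. finite F \<and> (\<forall>u. (\<forall>w\<in>F. \<not> suffix u w) \<longrightarrow> (\<forall>v. birth \<alpha> X (v @ u) \<le> birth \<alpha> X u + \<eta>))"
    using F(1) by blast
qed

text \<open>The sum over the words of length \<open>n\<close> factors letter by letter into the
  \<open>n\<close>-th power of the sum of \<open>r\<close>, which leaves a geometric series.\<close>

lemma nn_integral_prod_list:
  fixes r :: "nat \<Rightarrow> ennreal"
  assumes "(\<integral>\<^sup>+i. r i \<partial>count_space UNIV) < 1"
  shows "(\<integral>\<^sup>+v. prod_list (map r v) \<partial>count_space UNIV) < \<infinity>"
proof -
  define \<rho> where "\<rho> = (\<integral>\<^sup>+i. r i \<partial>count_space UNIV)"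
  define T where "T n = (\<integral>\<^sup>+v. prod_list (map r v) * indicator {v. length v
      = n} v \<partial>count_space UNIV)" for n
  have T: "T n = \<rho> ^ n" for n
  proof (induction n)
    case 0
    have "T 0 = (\<Sum>v\<in>{[]}. prod_list (map r v) * indicator {v. length v = 0} v)"
      unfolding T_def by (rule nn_integral_count_space') auto
    then show ?case by simp
  next
    case (Suc n)
    define f where "f v = prod_list (map r v) * indicator {v. length v = Suc n} v" for v
    have inj: "inj_on (\<lambda>(i, v). i # v) (UNIV :: (nat \<times> nat list) set)" by (auto simp: inj_on_def)
    have "T (Suc n) = (\<integral>\<^sup>+v. f v \<partial>count_space (range (\<lambda>(i, v). i # v)))"
      unfolding T_def f_def[symmetric]
    proof (rule nn_integral_count_space_eq)
      fix v :: "nat list" assume "v \<in> UNIV - range (\<lambda>(i, v). i # v)"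
      then have "v = []" by (cases v) (auto simp: image_iff)
      then show "f v = 0" by (simp add: f_def)
    qed auto
    also have "\<dots> = (\<integral>\<^sup>+p. f (case p of (i, v) \<Rightarrow> i # v) \<partial>count_space UNIV)"
      by (rule nn_integral_bij_count_space[OF inj_on_imp_bij_betw[OF inj], symmetric])
    also have "\<dots> = (\<integral>\<^sup>+p. r (fst p) * (prod_list (map r (snd p)) * indicator {v. length v
        = n} (snd p)) \<partial>count_space UNIV)"
      by (intro nn_integral_cong) (auto simp: f_def mult.assoc split: split_indicator)
    also have "\<dots> = (\<integral>\<^sup>+i. \<integral>\<^sup>+v. r i * (prod_list (map r v) * indicator {v. length v
        = n} v) \<partial>count_space UNIV \<partial>count_space UNIV)"
      by (subst nn_integral_fst_count_space[symmetric]) simp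
    also have "\<dots> = (\<integral>\<^sup>+i. r i * T n \<partial>count_space UNIV)"
      by (simp add: nn_integral_cmult T_def)
    also have "\<dots> = \<rho> * T n" by (simp add: nn_integral_multc \<rho>_def)
    finally show ?case using Suc by simp
  qed
  obtain x where x: "0 \<le> x" "\<rho> = ennreal x" "x < 1"
    using assms less_top_ennreal[of \<rho>]
        by (auto simp: \<rho>_def[symmetric] intro: less_trans[OF _ ennreal_one_less_top])
  have "(\<integral>\<^sup>+v. prod_list (map r v) \<partial>count_space UNIV)
      = (\<integral>\<^sup>+v. (\<Sum>n. prod_list (map r v) * indicator {v. length v = n} v) \<partial>count_space UNIV)"
  proof (rule nn_integral_cong)
    fix v :: "nat list"
    have "(\<Sum>n. prod_list (map r v) * indicator {v. length v = n} v) =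
        (\<Sum>n\<in>{length v}. prod_list (map r v) * indicator {v. length v = n} v)"
      by (rule suminf_finite) auto
    then show "prod_list (map r v) = (\<Sum>n. prod_list (map r v) * indicator {v. length v = n} v)"
        by simp
  qed
  also have "\<dots> = (\<Sum>n. T n)" unfolding T_def by (rule nn_integral_suminf) simp
  also have "\<dots> = (\<Sum>n. ennreal (x ^ n))" using x by (simp add: T ennreal_power)
  also have "\<dots> = ennreal (\<Sum>n. x ^ n)" using x by (intro suminf_ennreal2 summable_geometric) auto
  finally show ?thesis by simp
qed

text \<open>A full realisation that depends only on the marks in \<open>A\<close>, so that all
  restrictions take values in the same space. The dummy mark is admissible, with lifetime 0 and no
  loss of mass: a subtree filled with dummies is extinct at the birth of its root.\<close>

definition keep :: "nat list set \<Rightarrow> marks \<Rightarrow> marks" where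
  "keep A X = (\<lambda>u. if u \<in> A then X u else (0, one_seq))"

lemma keep_in [simp]: "u \<in> A \<Longrightarrow> keep A X u = X u"
  by (simp add: keep_def)

lemma keep_notin: "u \<notin> A \<Longrightarrow> keep A X u = (0, one_seq)"
  by (simp add: keep_def)

lemma mass_cong: "(\<And>w. suffix w v \<Longrightarrow> w \<noteq> v \<Longrightarrow> snd (X w) = snd (Y w)) \<Longrightarrow> mass X v = mass Y v"
proof (induction v)
  case (Cons i v)
  have *: "suffix w (i # v) \<and> w \<noteq> i # v" if "suffix w v" for w
    using suffix_length_le[OF that] that by (auto intro: suffix_ConsI)
  have "mass X v = mass Y v" using Cons.prems * by (intro Cons.IH) blast
  moreover have "snd (X v) = snd (Y v)" using Cons.prems[of v] by (simp add: suffix_ConsI)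
  ultimately show ?case by simp
qed simp

lemma birth_cong: "(\<And>w. suffix w v \<Longrightarrow> w \<noteq> v \<Longrightarrow> X w = Y w) \<Longrightarrow> birth \<alpha> X v = birth \<alpha> Y v"
proof (induction v)
  case (Cons i v)
  have *: "suffix w (i # v) \<and> w \<noteq> i # v" if "suffix w v" for w
    using suffix_length_le[OF that] that by (auto intro: suffix_ConsI)
  have "birth \<alpha> X v = birth \<alpha> Y v" using Cons.prems * by (intro Cons.IH) blast
  moreover have "mass X v = mass Y v" using Cons.prems *
      by (intro mass_cong arg_cong[where f = snd]) blast
  moreover have "X v = Y v" using Cons.prems[of v] by (simp add: suffix_ConsI)
  ultimately show ?case by simp
qed simp

lemma one_seq_unit: "one_seq \<in> unit_mass_seqs"
proof -
  have "one_seq sums (\<Sum>i\<in>{0::nat}. one_seq i)"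
    by (rule sums_finite) (auto simp: one_seq_def)
  then have "one_seq sums 1" by (simp add: one_seq_def)
  then show ?thesis
    by (auto simp: unit_mass_seqs_def mass_seqs_def one_seq_def decseq_def sums_iff)
qed

context dislocation
begin

lemma dummy_mark_space: "(0, one_seq) \<in> space mark_space"
  by (simp add: space_mark_space one_seq_unit)

lemma measurable_keep_PiM: "keep A \<in> measurable (\<Pi>\<^sub>M u\<in>A. mark_space) marks_space"
  unfolding keep_def
proof (rule measurable_abs_UNIV)
  fix u show "(\<lambda>X. if u \<in> A then X u else (0, one_seq)) \<in> measurable (\<Pi>\<^sub>M u\<in>A. mark_space)
      mark_space"
    using dummy_mark_space by (cases "u \<in> A") auto
qed

lemma measurable_keep [measurable]: "keep A \<in> measurable marks_space marks_space"
  unfolding keep_def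
proof (rule measurable_abs_UNIV)
  fix u show "(\<lambda>X. if u \<in> A then X u else (0, one_seq)) \<in> measurable marks_space mark_space"
    using dummy_mark_space by (cases "u \<in> A") auto
qed

text \<open>Since the entries sum to 1, an entry equal to 1 forces all others to vanish; the
  exceptional set is exactly the point \<open>one_seq\<close>.\<close>

lemma AE_nu_less_1:
  assumes "emeasure \<nu> {one_seq} = 0"
  shows "AE s in \<nu>. s 0 < 1"
proof -
  have "s = one_seq" if s: "s \<in> unit_mass_seqs" "\<not> s 0 < 1" for s
  proof
    fix i
    note u = unit_mass_seqsD[OF s(1)]
    have "s 0 = 1" using u(6)[of 0] s(2) by simp
    moreover have "s i = 0" if "i \<noteq> 0"
    proof -
      have "sum s {0, i} \<le> suminf s" by (rule sum_le_suminf[OF u(4)]) (auto intro: u(3))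
      then show ?thesis using u(3)[of i] u(5) that \<open>s 0 = 1\<close> by simp
    qed
    ultimately show "s i = one_seq i" by (simp add: one_seq_def)
  qed
  then have "{s \<in> space \<nu>. \<not> s 0 < 1} \<subseteq> {one_seq}" unfolding space_nu by blast
  moreover have "one_seq \<in> {s \<in> space \<nu>. \<not> s 0 < 1}"
    using one_seq_unit by (simp add: space_nu) (simp add: one_seq_def)
  ultimately have "{s \<in> space \<nu>. \<not> s 0 < 1} = {one_seq}" by blast
  moreover have "{s \<in> space \<nu>. \<not> s 0 < 1} \<in> sets \<nu>" by measurable
  ultimately show ?thesis using assms by (intro AE_I[of _ _ "{one_seq}"]) auto
qed

end

section \<open>The random marks\<close>

locale fragmentation = prob_space M + dislocation \<alpha> \<nu>
  for M :: "'a measure" and \<alpha> :: real and \<nu> :: "(nat \<Rightarrow> real) measure" +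
  fixes X :: "'a \<Rightarrow> marks"
  assumes alpha: "\<alpha> < 0"
    and prob_nu: "prob_space \<nu>"
    and nu_one: "emeasure \<nu> {one_seq} = 0"
    and indep: "indep_vars (\<lambda>_. mark_space) (\<lambda>u \<omega>. X \<omega> u) UNIV"
    and law: "\<And>u. distr M mark_space (\<lambda>\<omega>. X \<omega> u) = density lborel (exponential_density 1) \<Otimes>\<^sub>M \<nu>"
begin

abbreviation "expo \<equiv> density lborel (exponential_density 1)"

lemma prob_expo: "prob_space expo"
  by (rule prob_space_exponential_density) simp

lemma measurable_X_node [measurable]: "(\<lambda>\<omega>. X \<omega> u) \<in> measurable M mark_space"
  using indep by (auto simp: indep_vars_def)

lemma measurable_X [measurable]: "X \<in> measurable M marks_space"
  using measurable_abs_UNIV[of "\<lambda>u \<omega>. X \<omega> u", OF measurable_X_node] by simp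

lemma valid_X: "\<omega> \<in> space M \<Longrightarrow> valid_marks (X \<omega>)"
  using measurable_space[OF measurable_X] by (simp add: space_marks_space)

lemma law_fst: "distr M borel (\<lambda>\<omega>. fst (X \<omega> u)) = expo"
proof -
  have "distr M borel (\<lambda>\<omega>. fst (X \<omega> u)) = distr (distr M mark_space (\<lambda>\<omega>. X \<omega> u)) borel fst"
    by (subst distr_distr) (auto simp: comp_def)
  also have "\<dots> = distr (expo \<Otimes>\<^sub>M \<nu>) expo fst"
    unfolding law by (rule distr_cong) auto
  also have "\<dots> = expo" by (rule prob_space.distr_pair_fst[OF prob_nu])
  finally show ?thesis .
qed

lemma law_snd: "distr M \<nu> (\<lambda>\<omega>. snd (X \<omega> u)) = \<nu>"
proof -
  interpret e: prob_space expo by (rule prob_expo)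
  interpret n: prob_space \<nu> by (rule prob_nu)
  interpret p: pair_prob_space expo \<nu> ..
  have "distr M \<nu> (\<lambda>\<omega>. snd (X \<omega> u)) = distr (distr M mark_space (\<lambda>\<omega>. X \<omega> u)) \<nu> snd"
    by (subst distr_distr) (auto simp: comp_def)
  also have "\<dots> = distr (expo \<Otimes>\<^sub>M \<nu>) \<nu> snd"
    unfolding law by (rule distr_cong) auto
  also have "\<dots> = distr (distr (\<nu> \<Otimes>\<^sub>M expo) (expo \<Otimes>\<^sub>M \<nu>) (\<lambda>(x, y). (y, x))) \<nu> snd"
    by (subst p.distr_pair_swap) (rule refl)
  also have "\<dots> = distr (\<nu> \<Otimes>\<^sub>M expo) \<nu> fst"
    by (subst distr_distr) (auto simp: comp_def case_prod_beta)
  also have "\<dots> = \<nu>" by (rule e.distr_pair_fst)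
  finally show ?thesis .
qed

lemma AE_fst_pos: "AE \<omega> in M. \<forall>u. 0 < fst (X \<omega> u)"
  unfolding AE_all_countable
proof
  fix u
  have "AE e in expo. 0 < e"
    using AE_lborel_singleton[of "0::real"]
    by (subst AE_density) (auto simp: erlang_density_def elim!: eventually_mono)
  then have "AE e in distr M borel (\<lambda>\<omega>. fst (X \<omega> u)). 0 < e" unfolding law_fst .
  then show "AE \<omega> in M. 0 < fst (X \<omega> u)" by (subst (asm) AE_distr_iff) auto
qed

lemma AE_snd_less_1: "AE \<omega> in M. \<forall>u i. snd (X \<omega> u) i < 1"
proof -
  have "AE \<omega> in M. \<forall>u. snd (X \<omega> u) 0 < 1"
    unfolding AE_all_countable
  proof
    fix u
    have "AE s in distr M \<nu> (\<lambda>\<omega>. snd (X \<omega> u)). s 0 < 1" unfolding law_snd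
        by (rule AE_nu_less_1[OF nu_one])
    then show "AE \<omega> in M. snd (X \<omega> u) 0 < 1" by (subst (asm) AE_distr_iff) auto
  qed
  then show ?thesis using AE_space
  proof eventually_elim
    case (elim \<omega>)
    have "snd (X \<omega> u) i \<le> snd (X \<omega> u) 0" for u i
      using valid_X[OF elim(2)] unit_mass_seqsD(2)
          by (intro decseqD[of _ 0 i]) (auto simp: valid_marks_def)
    then show ?case using elim(1) by (meson le_less_trans)
  qed
qed

text \<open>Disjoint sets of nodes carry independent marks, and filling the rest with dummies is a
  measurable map applied to each block of marks.\<close>

lemma indep_keep:
  assumes "disjoint_family_on K L"
  shows "indep_vars (\<lambda>_. marks_space) (\<lambda>l \<omega>. keep (K l) (X \<omega>)) L"
proof -
  have "indep_vars (\<lambda>l. \<Pi>\<^sub>M u\<in>K l. mark_space) (\<lambda>l \<omega>. restrict (\<lambda>u. X \<omega> u) (K l)) L"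
    by (rule indep_vars_restrict[OF indep _ assms]) simp
  then have "indep_vars (\<lambda>_. marks_space) (\<lambda>l \<omega>. keep (K l) (restrict (\<lambda>u. X \<omega> u) (K l))) L"
    by (rule indep_vars_compose2) (rule measurable_keep_PiM)
  then show ?thesis by (simp add: keep_def[abs_def] cong: if_cong)
qed

lemma indep_keep2:
  assumes "A \<inter> B = {}"
  shows "indep_var marks_space (\<lambda>\<omega>. keep A (X \<omega>)) marks_space (\<lambda>\<omega>. keep B (X \<omega>))"
proof -
  have "indep_var (\<Pi>\<^sub>M u\<in>A. mark_space) (\<lambda>\<omega>. restrict (\<lambda>u. X \<omega> u) A) (\<Pi>\<^sub>M u\<in>B. mark_space) (\<lambda>\<omega>.
      restrict (\<lambda>u. X \<omega> u) B)"
    by (rule indep_var_restrict[OF indep]) (use assms in auto)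
  then have "indep_var marks_space (keep A \<circ> (\<lambda>\<omega>. restrict (\<lambda>u. X \<omega> u) A)) marks_space (keep B \<circ>
      (\<lambda>\<omega>. restrict (\<lambda>u. X \<omega> u) B))"
    by (rule indep_var_compose) (rule measurable_keep_PiM)+
  moreover have "keep A \<circ> (\<lambda>\<omega>. restrict (\<lambda>u. X \<omega> u) A) = (\<lambda>\<omega>. keep A (X \<omega>))" for A
    by (auto simp: keep_def fun_eq_iff)
  ultimately show ?thesis by simp
qed

text \<open>The mark of \<open>w\<close> is independent of the marks in \<open>A\<close>, so by
  Fubini it may be integrated out first, with its law as a product of the exponential law and
  \<open>\<nu>\<close>.\<close>

lemma nn_integral_keep_node:
  assumes w: "w \<notin> A" and f: "f \<in> borel_measurable (marks_space \<Otimes>\<^sub>M mark_space)"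
  shows "(\<integral>\<^sup>+\<omega>. f (keep A (X \<omega>), X \<omega> w) \<partial>M) = (\<integral>\<^sup>+\<omega>. \<integral>\<^sup>+x. f (keep A (X \<omega>), x) \<partial>(expo \<Otimes>\<^sub>M \<nu>) \<partial>M)"
proof -
  have [measurable]: "(\<lambda>\<omega>. keep A (X \<omega>)) \<in> measurable M marks_space" for A by measurable
  interpret D: prob_space "distr M marks_space (\<lambda>\<omega>. keep {w} (X \<omega>))" by (rule prob_space_distr) simp
  define g where "g = (\<lambda>(Y, Z :: marks). f (Y, Z w))"
  have g[measurable]: "g \<in> borel_measurable (marks_space \<Otimes>\<^sub>M marks_space)"
    unfolding g_def case_prod_beta using f by measurable
  have g': "g \<in> borel_measurable (distr M marks_space (\<lambda>\<omega>. keep A (X \<omega>)) \<Otimes>\<^sub>M distr M marks_space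
      (\<lambda>\<omega>. keep {w} (X \<omega>)))"
    using g by (subst measurable_cong_sets[OF sets_pair_measure_cong[OF sets_distr sets_distr]
        refl])
  have g'': "g \<in> borel_measurable (marks_space \<Otimes>\<^sub>M distr M marks_space (\<lambda>\<omega>. keep {w} (X \<omega>)))"
    using g by (subst measurable_cong_sets[OF sets_pair_measure_cong[OF refl sets_distr] refl])
  have inner: "(\<integral>\<^sup>+Z. g (Y, Z) \<partial>distr M marks_space (\<lambda>\<omega>. keep {w} (X \<omega>)))
      = (\<integral>\<^sup>+x. f (Y, x) \<partial>(expo \<Otimes>\<^sub>M \<nu>))"
    if "Y \<in> space marks_space" for Y
  proof -
    have fY[measurable]: "(\<lambda>x. f (Y, x)) \<in> borel_measurable mark_space" using f that by measurable
    have "(\<integral>\<^sup>+Z. g (Y, Z) \<partial>distr M marks_space (\<lambda>\<omega>. keep {w} (X \<omega>))) = (\<integral>\<^sup>+\<omega>. f (Y, X \<omega> w) \<partial>M)"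
      by (subst nn_integral_distr) (auto simp: g_def that)
    also have "\<dots> = (\<integral>\<^sup>+x. f (Y, x) \<partial>distr M mark_space (\<lambda>\<omega>. X \<omega> w))"
      by (subst nn_integral_distr) auto
    finally show ?thesis unfolding law .
  qed
  have "(\<integral>\<^sup>+\<omega>. f (keep A (X \<omega>), X \<omega> w) \<partial>M) =
      (\<integral>\<^sup>+z. g z \<partial>distr M (marks_space \<Otimes>\<^sub>M marks_space) (\<lambda>\<omega>. (keep A (X \<omega>), keep {w} (X \<omega>))))"
    by (subst nn_integral_distr) (use g in \<open>simp_all add: g_def\<close>)
  also have "distr M (marks_space \<Otimes>\<^sub>M marks_space) (\<lambda>\<omega>. (keep A (X \<omega>), keep {w} (X \<omega>))) =
      distr M marks_space (\<lambda>\<omega>. keep A (X \<omega>)) \<Otimes>\<^sub>M distr M marks_space (\<lambda>\<omega>. keep {w} (X \<omega>))"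
    using indep_keep2[of A "{w}"] w unfolding indep_var_distribution_eq by simp
  also have "(\<integral>\<^sup>+z. g z \<partial>\<dots>) =
      (\<integral>\<^sup>+Y. \<integral>\<^sup>+Z. g (Y, Z) \<partial>distr M marks_space (\<lambda>\<omega>. keep {w} (X \<omega>)) \<partial>distr M marks_space (\<lambda>\<omega>.
          keep A (X \<omega>)))"
    by (rule D.nn_integral_fst[OF g', symmetric])
  also have "\<dots> = (\<integral>\<^sup>+\<omega>. \<integral>\<^sup>+Z. g (keep A (X \<omega>), Z) \<partial>distr M marks_space (\<lambda>\<omega>. keep {w} (X \<omega>)) \<partial>M)"
    by (subst nn_integral_distr) (auto intro!: D.borel_measurable_nn_integral_fst g'')
  also have "\<dots> = (\<integral>\<^sup>+\<omega>. \<integral>\<^sup>+x. f (keep A (X \<omega>), x) \<partial>(expo \<Otimes>\<^sub>M \<nu>) \<partial>M)"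
    by (intro nn_integral_cong inner)
        (rule measurable_space[OF measurable_keep], rule measurable_space[OF measurable_X])
  finally show ?thesis .
qed

end

section \<open>Moments of the lifetimes and absence of ties\<close>

lemma subtree_ext_cong:
  assumes "\<And>v. birth \<alpha> X (v @ u) = birth \<alpha> Y (v @ u)"
    and "bdd_above (range (birth \<alpha> X))" "bdd_above (range (birth \<alpha> Y))"
  shows "subtree_ext \<alpha> X u = subtree_ext \<alpha> Y u"
  using assms by (simp add: subtree_ext_def)

text \<open>Changing only the lifetime of \<open>w\<close> moves the birth times of all its proper
  descendants by the same amount. Used in both directions, the inequality shows that equal
  extinction times force equal lifetimes when the mass is positive.\<close>

lemma subtree_ext_shift_le:
  assumes b: "bounded_marks \<alpha> X" "bounded_marks \<alpha> Y"
    and eq: "\<And>v. v \<noteq> w \<Longrightarrow> X v = Y v" "snd (X w) = snd (Y w)"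
  shows "subtree_ext \<alpha> Y w \<le> subtree_ext \<alpha> X w + mass X w powr (- \<alpha>) * (fst (Y w) - fst (X w))"
proof -
  interpret x: bounded_marks \<alpha> X by fact
  interpret y: bounded_marks \<alpha> Y by fact
  have m: "mass Y v = mass X v" for v
    by (rule mass_cong) (use eq in metis)
  have bw: "birth \<alpha> Y w = birth \<alpha> X w" by (rule birth_cong) (use eq in metis)
  define \<delta> where "\<delta> = mass X w powr (- \<alpha>) * (fst (Y w) - fst (X w))"
  have bc: "birth \<alpha> Y (k # w) = birth \<alpha> X (k # w) + \<delta>" for k
    by (simp add: bw m \<delta>_def algebra_simps)
  have below: "birth \<alpha> Y v = birth \<alpha> X v + \<delta>" if v: "suffix (k # w) v" for k v
  proof -
    obtain z where z: "v = z @ k # w" using v by (auto simp: suffix_def)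
    have "length (y @ k # w) \<noteq> length w" for y by simp
    then have "y @ k # w \<noteq> w" for y by metis
    then have "sub Y (k # w) = sub X (k # w)" using eq by (auto simp: sub_def)
    then show ?thesis
      using birth_append[OF x.valid, of \<alpha> z "k # w"] birth_append[OF y.valid, of \<alpha> z "k # w"]
          bc[of k] m[of "k # w"]
      by (simp only: z)
  qed
  show ?thesis unfolding \<delta>_def[symmetric]
  proof (rule y.E_least)
    fix v assume "suffix w v"
    then show "birth \<alpha> Y v \<le> subtree_ext \<alpha> X w + \<delta>"
    proof (cases rule: suffix_cases_Cons)
      case 1
      \<comment> \<open>The birth of \<open>w\<close> itself does not move, so it is bounded through
        the birth of a child, which does.\<close>
      have "birth \<alpha> Y w \<le> birth \<alpha> Y (0 # w)" by (rule y.birth_Cons_ge)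
      also have "\<dots> = birth \<alpha> X (0 # w) + \<delta>" by (rule bc)
      also have "birth \<alpha> X (0 # w) \<le> subtree_ext \<alpha> X w"
          by (rule x.birth_le_E) (simp add: suffix_ConsI)
      finally show ?thesis using 1 by simp
    next
      case (2 k)
      have "birth \<alpha> X v \<le> subtree_ext \<alpha> X w"
        using x.birth_le_E[of w v] 2 \<open>suffix w v\<close> by simp
      then show ?thesis using below[OF 2] by simp
    qed
  qed
qed

context fragmentation
begin

lemma expo_singleton: "emeasure expo {e} = 0"
  using AE_lborel_singleton[of e]
  by (subst emeasure_density) (auto simp: nn_integral_0_iff_AE elim!: eventually_mono)

lemma nn_integral_node:
  assumes "f \<in> borel_measurable mark_space"
  shows "(\<integral>\<^sup>+\<omega>. f (X \<omega> u) \<partial>M) = (\<integral>\<^sup>+x. f x \<partial>(expo \<Otimes>\<^sub>M \<nu>))"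
  unfolding law[of u, symmetric] by (subst nn_integral_distr) (use assms in auto)

lemma nn_integral_node_mult:
  assumes w: "w \<notin> A" and [measurable]: "f \<in> borel_measurable marks_space"
      "g \<in> borel_measurable mark_space"
  shows "(\<integral>\<^sup>+\<omega>. f (keep A (X \<omega>)) * g (X \<omega> w) \<partial>M)
      = (\<integral>\<^sup>+\<omega>. f (keep A (X \<omega>)) \<partial>M) * (\<integral>\<^sup>+x. g x \<partial>(expo \<Otimes>\<^sub>M \<nu>))"
proof -
  have g': "g \<in> borel_measurable (expo \<Otimes>\<^sub>M \<nu>)"
    by (subst measurable_cong_sets[OF sets_pair_measure_cong[of expo borel \<nu> \<nu>] refl]) auto
  have "(\<integral>\<^sup>+\<omega>. f (keep A (X \<omega>)) * g (X \<omega> w) \<partial>M) =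
    (\<integral>\<^sup>+\<omega>. \<integral>\<^sup>+x. f (keep A (X \<omega>)) * g x \<partial>(expo \<Otimes>\<^sub>M \<nu>) \<partial>M)"
    using nn_integral_keep_node[OF w, of "\<lambda>(Y, x). f Y * g x"] by simp
  also have "\<dots> = (\<integral>\<^sup>+\<omega>. f (keep A (X \<omega>)) * (\<integral>\<^sup>+x. g x \<partial>(expo \<Otimes>\<^sub>M \<nu>)) \<partial>M)"
    by (intro nn_integral_cong nn_integral_cmult g')
  also have "\<dots> = (\<integral>\<^sup>+\<omega>. f (keep A (X \<omega>)) \<partial>M) * (\<integral>\<^sup>+x. g x \<partial>(expo \<Otimes>\<^sub>M \<nu>))"
    by (rule nn_integral_multc) measurable
  finally show ?thesis .
qed

lemma mass_keep_Compl: "mass (keep (- {v}) Y) v = mass Y v"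
  by (rule mass_cong) simp

definition child_moment :: "nat \<Rightarrow> nat \<Rightarrow> ennreal" where
  "child_moment p i = (\<integral>\<^sup>+x. ennreal ((snd x i powr (- \<alpha>)) ^ p) \<partial>(expo \<Otimes>\<^sub>M \<nu>))"

text \<open>The mass of \<open>v\<close> is a function of the marks of its strict ancestors, hence
  independent of the mark of \<open>v\<close>; the induction peels off one factor per
  letter.\<close>

lemma mass_moment:
  "(\<integral>\<^sup>+\<omega>. ennreal ((mass (X \<omega>) v powr (- \<alpha>)) ^ p) \<partial>M) = prod_list (map (child_moment p) v)"
proof (induction v)
  case Nil
  then show ?case by (simp add: emeasure_space_1)
next
  case (Cons i v)
  have [measurable]: "(\<lambda>x. snd x i) \<in> borel_measurable mark_space"
    by (rule measurable_compose[OF measurable_snd measurable_nu_component])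
  have "(\<integral>\<^sup>+\<omega>. ennreal ((mass (X \<omega>) (i # v) powr (- \<alpha>)) ^ p) \<partial>M) =
    (\<integral>\<^sup>+\<omega>. ennreal ((mass (keep (- {v}) (X \<omega>)) v powr (- \<alpha>)) ^ p) * ennreal ((snd (X \<omega> v) i powr
        (- \<alpha>)) ^ p) \<partial>M)"
  proof (intro nn_integral_cong)
    fix \<omega> assume "\<omega> \<in> space M"
    then have "valid_marks (X \<omega>)" by (rule valid_X)
    then show "ennreal ((mass (X \<omega>) (i # v) powr (- \<alpha>)) ^ p) =
       ennreal ((mass (keep (- {v}) (X \<omega>)) v powr (- \<alpha>)) ^ p) * ennreal
           ((snd (X \<omega> v) i powr (- \<alpha>)) ^ p)"
      by (simp add: mass_keep_Compl powr_mult power_mult_distrib ennreal_mult mass_nonneg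
          valid_nonneg)
  qed
  also have "\<dots> = (\<integral>\<^sup>+\<omega>. ennreal ((mass (keep (- {v}) (X \<omega>)) v powr (- \<alpha>)) ^ p) \<partial>M) * child_moment
      p i"
    unfolding child_moment_def by (rule nn_integral_node_mult) auto
  finally show ?case using Cons by (simp add: mass_keep_Compl mult.commute)
qed

text \<open>Lifetimes are positive only almost surely; the absolute value keeps the integrand a
  genuine power at every realisation.\<close>

lemma life_moment: "(\<integral>\<^sup>+x. ennreal (\<bar>fst x\<bar> ^ p) \<partial>(expo \<Otimes>\<^sub>M \<nu>)) < \<infinity>"
proof -
  have "(\<integral>\<^sup>+x. ennreal (\<bar>fst x\<bar> ^ p) \<partial>(expo \<Otimes>\<^sub>M \<nu>)) = (\<integral>\<^sup>+\<omega>. ennreal (\<bar>fst (X \<omega> [])\<bar> ^ p) \<partial>M)"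
    by (rule nn_integral_node[symmetric]) measurable
  also have "\<dots> = (\<integral>\<^sup>+e. ennreal (\<bar>e\<bar> ^ p) \<partial>expo)"
    unfolding law_fst[of "[]", symmetric] by (subst nn_integral_distr) auto
  also have "\<dots> = (\<integral>\<^sup>+e. ennreal (exponential_density 1 e * e ^ p) \<partial>lborel)"
    by (subst nn_integral_density)
      (auto intro!: nn_integral_cong simp: ennreal_mult[symmetric] erlang_density_def)
  also have "\<dots> < \<infinity>" using nn_integral_erlang_ith_moment[of 1 0 p] by simp
  finally show ?thesis .
qed

text \<open>With \<open>b = - \<alpha> * p - 1 > 0\<close>, each term
  \<open>s i powr (1 + b)\<close> is at most \<open>s i * s 0 powr b\<close>, and the
  \<open>s i\<close> sum to 1. So the sum is at most the expectation of \<open>s 0 powr b\<close>,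
  where \<open>s 0 < 1\<close> almost surely.\<close>

lemma sum_child_moment:
  assumes p: "1 < - \<alpha> * real p"
  shows "(\<integral>\<^sup>+i. child_moment p i \<partial>count_space UNIV) < 1"
proof -
  define b where "b = - \<alpha> * real p - 1"
  have [measurable]: "(\<lambda>x. snd x i) \<in> borel_measurable mark_space" for i
    by (rule measurable_compose[OF measurable_snd measurable_nu_component])
  have int: "integrable M (\<lambda>\<omega>. snd (X \<omega> []) 0 powr b)"
  proof (rule integrable_const_bound[where B = 1])
    show "AE \<omega> in M. norm (snd (X \<omega> []) 0 powr b) \<le> 1"
    proof (rule AE_I2)
      fix \<omega> assume "\<omega> \<in> space M"
      then have s: "snd (X \<omega> []) \<in> unit_mass_seqs" using valid_X by (simp add: valid_marks_def)
      show "norm (snd (X \<omega> []) 0 powr b) \<le> 1"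
        using unit_mass_seqsD(3,6)[OF s, of 0] p by (simp add: powr_le1 b_def)
    qed
  qed measurable
  have "(\<integral>\<^sup>+i. child_moment p i \<partial>count_space UNIV) =
     (\<integral>\<^sup>+i. \<integral>\<^sup>+\<omega>. ennreal ((snd (X \<omega> []) i powr (- \<alpha>)) ^ p) \<partial>M \<partial>count_space UNIV)"
    unfolding child_moment_def by (intro nn_integral_cong nn_integral_node[symmetric]) measurable
  also have "\<dots> = (\<integral>\<^sup>+\<omega>. \<integral>\<^sup>+i. ennreal ((snd (X \<omega> []) i powr (- \<alpha>)) ^ p) \<partial>count_space UNIV \<partial>M)"
    by (rule nn_integral_count_space_nn_integral[symmetric]) auto
  also have "\<dots> \<le> (\<integral>\<^sup>+\<omega>. ennreal (snd (X \<omega> []) 0 powr b) \<partial>M)"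
  proof (intro nn_integral_mono)
    fix \<omega> assume "\<omega> \<in> space M"
    define s where "s = snd (X \<omega> [])"
    have s: "s \<in> unit_mass_seqs" using valid_X[OF \<open>\<omega> \<in> space M\<close>]
        by (simp add: s_def valid_marks_def)
    have le: "(s i powr (- \<alpha>)) ^ p \<le> s i * s 0 powr b" for i
    proof (cases "s i = 0")
      case False
      then have si: "0 < s i" using unit_mass_seqsD(3)[OF s, of i] by simp
      have "(s i powr (- \<alpha>)) ^ p = s i powr (1 + b)"
        using si by (simp add: powr_realpow[symmetric] powr_powr b_def)
      also have "\<dots> = s i * s i powr b" using si by (simp add: powr_add)
      also have "\<dots> \<le> s i * s 0 powr b"
        using si decseqD[OF unit_mass_seqsD(2)[OF s], of 0 i] p
            by (intro mult_left_mono powr_mono2) (auto simp: b_def)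
      finally show ?thesis .
    next
      case True
      have "p \<noteq> 0" using p by (intro notI) simp
      then show ?thesis using True by (simp add: zero_power)
    qed
    have "(\<integral>\<^sup>+i. ennreal ((s i powr (- \<alpha>)) ^ p) \<partial>count_space UNIV)
        \<le> (\<integral>\<^sup>+i. ennreal (s i) * ennreal (s 0 powr b) \<partial>count_space UNIV)"
      using le unit_mass_seqsD(3)[OF s]
          by (intro nn_integral_mono) (simp add: ennreal_mult[symmetric] ennreal_leI)
    also have "\<dots> = (\<Sum>i. ennreal (s i)) * ennreal (s 0 powr b)"
      by (subst nn_integral_multc) (simp_all add: nn_integral_count_space_nat)
    also have "(\<Sum>i. ennreal (s i)) = 1"
      using unit_mass_seqsD[OF s] by (subst suminf_ennreal2) auto
    finally show "(\<integral>\<^sup>+i. ennreal ((snd (X \<omega> []) i powr (- \<alpha>)) ^ p) \<partial>count_space UNIV)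
        \<le> ennreal (snd (X \<omega> []) 0 powr b)"
      by (simp add: s_def)
  qed
  also have "\<dots> = ennreal (\<integral>\<omega>. snd (X \<omega> []) 0 powr b \<partial>M)"
  proof (rule nn_integral_eq_integral)
    show "integrable M (\<lambda>\<omega>. snd (X \<omega> []) 0 powr b)" by (rule int)
  qed simp
  also have "\<dots> < 1"
    unfolding ennreal_less_one_iff
  proof (rule expectation_less)
    show "AE \<omega> in M. snd (X \<omega> []) 0 powr b < 1"
      using AE_snd_less_1 AE_space
    proof eventually_elim
      case (elim \<omega>)
      then have s: "snd (X \<omega> []) \<in> unit_mass_seqs" using valid_X by (simp add: valid_marks_def)
      then show ?case
          using elim(1) unit_mass_seqsD(7)[OF s] p powr_less_mono2[of b "snd (X \<omega> []) 0" 1]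
          by (simp add: b_def)
    qed
    show "integrable M (\<lambda>\<omega>. snd (X \<omega> []) 0 powr b)" by (rule int)
  qed
  finally show ?thesis .
qed

lemma AE_bounded_oscillation:
  "AE \<omega> in M. bdd_above (range (birth \<alpha> (X \<omega>))) \<and>
    (\<forall>\<eta>>0. \<exists>F. finite F \<and> (\<forall>u. (\<forall>w\<in>F. \<not> suffix u w) \<longrightarrow>
       (\<forall>v. birth \<alpha> (X \<omega>) (v @ u) \<le> birth \<alpha> (X \<omega>) u + \<eta>)))"
proof -
  obtain p :: nat where p: "1 < - \<alpha> * real p"
    using reals_Archimedean3[of "- \<alpha>"] alpha by (metis mult.commute neg_0_less_iff_less)
  have p1: "1 \<le> p" using p by (cases p) auto
  define R where "R = (\<integral>\<^sup>+i. child_moment p i \<partial>count_space UNIV)"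
  obtain r0 where r0: "0 \<le> r0" "R = ennreal r0" "r0 < 1"
    using sum_child_moment[OF p] less_top_ennreal[of R]
    by (auto simp: R_def[symmetric] intro: less_trans[OF _ ennreal_one_less_top])
  \<comment> \<open>A number strictly between \<open>r0\<close> and 1. As \<open>c\<close> is its
    \<open>p\<close>-th root and \<open>c < 1\<close>, one gets
    \<open>c ^ (p - 1) \<ge> c ^ p = r > r0\<close>, so dividing the child moments by
    \<open>c ^ (p - 1)\<close> leaves their sum below 1.\<close>
  define r where "r = (r0 + 1) / 2"
  have r: "r0 < r" "0 < r" "r < 1" using r0 by (auto simp: r_def)
  define c where "c = r powr (1 / real p)"
  have c: "0 < c" "c < 1" using r p1 powr_less_mono2[of "1 / real p" r 1] by (auto simp: c_def)
  have "c ^ p = r" using r p1 by (simp add: c_def powr_realpow[symmetric] powr_powr)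
  then have cp: "r0 < c ^ (p - 1)" using power_decreasing[of "p - 1" p c] c r by simp
  define d where "d = ennreal (1 / c ^ (p - 1))"
  have "(\<integral>\<^sup>+i. child_moment p i * d \<partial>count_space UNIV) = R * d"
    by (simp add: nn_integral_multc R_def)
  also have "\<dots> = ennreal (r0 / c ^ (p - 1))" using r0 c by (simp add: d_def ennreal_mult[symmetric])
  also have "\<dots> < 1" using cp c by (simp add: ennreal_less_one_iff)
  finally have fin: "(\<integral>\<^sup>+v. prod_list (map (\<lambda>i. child_moment p i * d) v) \<partial>count_space UNIV) < \<infinity>"
    by (rule nn_integral_prod_list)
  define K where "K = (\<integral>\<^sup>+x. ennreal (\<bar>fst x\<bar> ^ p) \<partial>(expo \<Otimes>\<^sub>M \<nu>))"
  define h where "h \<omega> v = (mass (X \<omega>) v powr (- \<alpha>) * \<bar>fst (X \<omega> v)\<bar>) ^ p / (c ^ length v) ^ (p -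
      1)" for \<omega> v
  have [measurable]: "(\<lambda>\<omega>. h \<omega> v) \<in> borel_measurable M" for v unfolding h_def by measurable
  have h0: "0 \<le> h \<omega> v" for \<omega> v using c by (simp add: h_def)
  have hv: "(\<integral>\<^sup>+\<omega>. ennreal (h \<omega> v) \<partial>M) = prod_list (map (\<lambda>i. child_moment p i * d) v) * K" for v
  proof -
    have dv: "ennreal (1 / (c ^ length v) ^ (p - 1)) * prod_list (map (child_moment p) v)
        = prod_list (map (\<lambda>i. child_moment p i * d) v)"
    proof (induction v)
      case (Cons i v)
      have "ennreal (1 / (c ^ length (i # v)) ^ (p - 1))
          = d * ennreal (1 / (c ^ length v) ^ (p - 1))"
        using c by (simp add: d_def ennreal_mult[symmetric] power_mult_distrib)
      then show ?case using Cons by (simp add: ac_simps)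
    qed simp
    have "(\<integral>\<^sup>+\<omega>. ennreal (h \<omega> v) \<partial>M) = (\<integral>\<^sup>+\<omega>. ennreal (1 / (c ^ length v) ^ (p - 1)) *
        (ennreal ((mass (keep (- {v}) (X \<omega>)) v powr (- \<alpha>)) ^ p) * ennreal (\<bar>fst (X \<omega> v)\<bar> ^ p)) \<partial>M)"
      using c by (intro nn_integral_cong)
        (simp add: h_def mass_keep_Compl power_mult_distrib ennreal_mult[symmetric])
    also have "\<dots> = ennreal (1 / (c ^ length v) ^ (p - 1)) *
        (\<integral>\<^sup>+\<omega>. ennreal ((mass (keep (- {v}) (X \<omega>)) v powr (- \<alpha>)) ^ p) * ennreal (\<bar>fst (X \<omega> v)\<bar> ^
            p) \<partial>M)"
      by (rule nn_integral_cmult) measurable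
    also have "(\<integral>\<^sup>+\<omega>. ennreal ((mass (keep (- {v}) (X \<omega>)) v powr (- \<alpha>)) ^ p) * ennreal (\<bar>fst (X \<omega>
        v)\<bar> ^ p) \<partial>M)
        = (\<integral>\<^sup>+\<omega>. ennreal ((mass (keep (- {v}) (X \<omega>)) v powr (- \<alpha>)) ^ p) \<partial>M) * K"
      unfolding K_def by (rule nn_integral_node_mult) auto
    also have "\<dots> = prod_list (map (child_moment p) v) * K"
        by (simp add: mass_keep_Compl mass_moment)
    finally show ?thesis using dv by (simp add: mult.assoc[symmetric])
  qed
  have "(\<integral>\<^sup>+\<omega>. \<integral>\<^sup>+v. ennreal (h \<omega> v) \<partial>count_space UNIV \<partial>M)
      = (\<integral>\<^sup>+v. \<integral>\<^sup>+\<omega>. ennreal (h \<omega> v) \<partial>M \<partial>count_space UNIV)"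
    by (rule nn_integral_count_space_nn_integral) auto
  also have "\<dots> = (\<integral>\<^sup>+v. prod_list (map (\<lambda>i. child_moment p i * d) v) \<partial>count_space UNIV) * K"
    unfolding hv by (rule nn_integral_multc) simp
  also have "\<dots> < \<infinity>" using fin life_moment[of p] by (simp add: K_def ennreal_mult_less_top)
  \<comment> \<open>A finite expectation makes the weighted sum over all nodes finite almost surely,
    and a bound on its finite partial sums is what \<open>birth_oscillation\<close>
    requires.\<close>
  finally have "AE \<omega> in M. (\<integral>\<^sup>+v. ennreal (h \<omega> v) \<partial>count_space UNIV) \<noteq> \<infinity>"
  proof (intro nn_integral_noteq_infinite)
    have "(\<lambda>(v, \<omega>). ennreal (h \<omega> v)) \<in> borel_measurable (count_space UNIV \<Otimes>\<^sub>M M)"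
      by (rule measurable_pair_measure_countable1) auto
    then have "(\<lambda>(\<omega>, v). ennreal (h \<omega> v)) \<in> borel_measurable (M \<Otimes>\<^sub>M count_space UNIV)"
      by (subst measurable_pair_swap_iff) (simp add: case_prod_beta)
    then show "(\<lambda>\<omega>. \<integral>\<^sup>+v. ennreal (h \<omega> v) \<partial>count_space UNIV) \<in> borel_measurable M"
      by (intro sigma_finite_measure.borel_measurable_nn_integral
          sigma_finite_measure_count_space) simp
  qed simp
  then show ?thesis using AE_fst_pos AE_space
  proof eventually_elim
    case (elim \<omega>)
    have valid: "valid_marks (X \<omega>)" by (rule valid_X) fact
    have nn: "0 \<le> fst (X \<omega> u)" for u using elim(2) by (auto intro: less_imp_le)
    obtain C where C: "0 \<le> C" "(\<integral>\<^sup>+v. ennreal (h \<omega> v) \<partial>count_space UNIV) = ennreal C"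
      using elim(1) by (cases "\<integral>\<^sup>+v. ennreal (h \<omega> v) \<partial>count_space UNIV") auto
    have sum: "(\<Sum>v\<in>F. (mass (X \<omega>) v powr (- \<alpha>) * fst (X \<omega> v)) ^ p / (c ^ length v) ^ (p - 1))
        \<le> C" if F: "finite F" for F
    proof -
      have "ennreal (sum (h \<omega>) F) = (\<Sum>v\<in>F. ennreal (h \<omega> v))" using h0 by (simp add: sum_ennreal)
      also have "\<dots> = (\<integral>\<^sup>+v. ennreal (h \<omega> v) * indicator F v \<partial>count_space UNIV)"
        by (subst nn_integral_count_space'[OF F]) auto
      also have "\<dots> \<le> (\<integral>\<^sup>+v. ennreal (h \<omega> v) \<partial>count_space UNIV)"
        by (intro nn_integral_mono) (auto split: split_indicator)
      finally have "sum (h \<omega>) F \<le> C" using C by simp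
      then show ?thesis using nn by (simp add: h_def)
    qed
    show ?case
    proof (intro conjI allI impI)
      show "bdd_above (range (birth \<alpha> (X \<omega>)))" by (rule birth_oscillation(1)[OF valid nn c p1 sum])
      fix \<eta> :: real assume "0 < \<eta>"
      then show "\<exists>F. finite F \<and> (\<forall>u. (\<forall>w\<in>F. \<not> suffix u w) \<longrightarrow>
          (\<forall>v. birth \<alpha> (X \<omega>) (v @ u) \<le> birth \<alpha> (X \<omega>) u + \<eta>))"
        by - (rule birth_oscillation(2)[OF valid nn c p1], rule sum)
    qed
  qed
qed

text \<open>
  The exponential time of one of the two tied nodes shifts its extinction time, but does not
  affect the other one, so for each value of the remaining marks a tie occurs at no more than
  one value of it.
\<close>

lemma AE_no_tie:
  assumes "i \<noteq> j"
  shows "AE \<omega> in M. 0 < mass (X \<omega>) (i # u) \<longrightarrow> subtree_ext \<alpha> (X \<omega>) (i # u) \<noteq> subtree_ext \<alpha> (X \<omega>) (j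
      # u)"
proof -
  define w where "w = i # u"
  \<comment> \<open>Boundedness and nonnegative lifetimes are part of \<open>P\<close>, so that two
    realisations which satisfy it and differ at \<open>w\<close> both have bounded marks. These two
    parts hold almost surely and are discharged at the end.\<close>
  define P where "P Y \<longleftrightarrow> bdd_above (range (birth \<alpha> Y)) \<and> (\<forall>v. 0 \<le> fst (Y v)) \<and> 0 < mass Y w \<and>
      subtree_ext \<alpha> Y w = subtree_ext \<alpha> Y (j # u)" for Y
  have [measurable]: "Measurable.pred marks_space P"
  proof -
    have [measurable]: "(\<lambda>Y. mass Y w) \<in> borel_measurable marks_space"
      "(\<lambda>Y. subtree_ext \<alpha> Y w) \<in> borel_measurable marks_space"
          by (rule measurable_mass measurable_subtree_ext)+
    have "P = (\<lambda>Y. bdd_above (range (birth \<alpha> Y)) \<and> (\<forall>v. 0 \<le> fst (Y v)) \<and> 0 < mass Y w \<and>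
      \<not> subtree_ext \<alpha> Y w < subtree_ext \<alpha> Y (j # u) \<and> \<not> subtree_ext \<alpha> Y (j # u) < subtree_ext \<alpha> Y
          w)"
      by (auto simp: P_def fun_eq_iff)
    moreover have "Measurable.pred marks_space \<dots>"
      supply measurable_seq_borel_component[measurable del] measurable_nu_component[measurable del]
      by measurable
    ultimately show ?thesis by (simp only:)
  qed
  have upd[measurable]: "(\<lambda>z. (fst z)(w := snd z)) \<in> measurable (marks_space \<Otimes>\<^sub>M mark_space)
      marks_space"
    unfolding fun_upd_def
  proof (rule measurable_abs_UNIV)
    fix v show "(\<lambda>z. if v = w then snd z else fst z v) \<in> measurable (marks_space \<Otimes>\<^sub>M mark_space)
        mark_space"
      by (cases "v = w") auto
  qed
  have unique: "e1 = e2" if Y: "Y \<in> space marks_space" "s \<in> unit_mass_seqs"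
    and P: "P (Y(w := (e1, s)))" "P (Y(w := (e2, s)))" for Y s e1 e2
  proof -
    define Z where "Z e = Y(w := (e, s))" for e
    have vZ: "valid_marks (Z e)" for e using Y
        by (auto simp: valid_marks_def space_marks_space Z_def)
    have Z: "bounded_marks \<alpha> (Z e)" "0 < mass (Z e) w" "subtree_ext \<alpha> (Z e) w
        = subtree_ext \<alpha> (Z e) (j # u)"
      if "e \<in> {e1, e2}" for e
      using that P vZ[of e] unfolding P_def Z_def[symmetric] by (auto simp: bounded_marks_def)
    have "birth \<alpha> (Z e1) (v @ j # u) = birth \<alpha> (Z e2) (v @ j # u)" for v
    proof (rule birth_cong)
      fix x assume "suffix x (v @ j # u)"
      moreover have "suffix (j # u) (v @ j # u)" by (rule suffixI) simp
      ultimately have "x \<noteq> w" using suffix_Cons_same[of i u "v @ j # u" j] assms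
          by (auto simp: w_def)
      then show "Z e1 x = Z e2 x" by (simp add: Z_def)
    qed
    then have "subtree_ext \<alpha> (Z e1) (j # u) = subtree_ext \<alpha> (Z e2) (j # u)"
      using Z(1)[of e1] Z(1)[of e2] by (intro subtree_ext_cong) (auto simp: bounded_marks_def)
    then have same: "subtree_ext \<alpha> (Z e1) w = subtree_ext \<alpha> (Z e2) w"
        using Z(3)[of e1] Z(3)[of e2] by simp
    have *: "0 \<le> mass (Z e) w powr (- \<alpha>) * (e' - e)" if "e \<in> {e1, e2}" "e' \<in> {e1, e2}" for e e'
    proof -
      have "subtree_ext \<alpha> (Z e') w \<le> subtree_ext \<alpha> (Z e) w + mass (Z e) w powr (- \<alpha>) * (fst (Z e'
          w) - fst (Z e w))"
        by (rule subtree_ext_shift_le[OF Z(1) Z(1)]) (use that in \<open>auto simp: Z_def\<close>)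
      then show ?thesis using same that by (auto simp: Z_def)
    qed
    have "e \<le> e'" if "e \<in> {e1, e2}" "e' \<in> {e1, e2}" for e e'
      using *[OF that] Z(2)[OF that(1)] by (simp add: zero_le_mult_iff)
    then show ?thesis by (auto intro: antisym)
  qed
  interpret e: prob_space expo by (rule prob_expo)
  interpret n: prob_space \<nu> by (rule prob_nu)
  interpret p: pair_prob_space expo \<nu> ..
  define f where "f z = (indicator {Y. P Y} ((fst z)(w := snd z)) :: ennreal)" for z
  have f[measurable]: "f \<in> borel_measurable (marks_space \<Otimes>\<^sub>M mark_space)"
    unfolding f_def indicator_def mem_Collect_eq by measurable
  have inner: "(\<integral>\<^sup>+x. f (Y, x) \<partial>(expo \<Otimes>\<^sub>M \<nu>)) = 0" if Y: "Y \<in> space marks_space" for Y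
  proof -
    have s: "sets (expo \<Otimes>\<^sub>M \<nu>) = sets mark_space" by (rule sets_pair_measure_cong) auto
    have fY: "(\<lambda>x. f (Y, x)) \<in> borel_measurable (expo \<Otimes>\<^sub>M \<nu>)"
      using Y by (subst measurable_cong_sets[OF s refl]) measurable
    have "(\<integral>\<^sup>+x. f (Y, x) \<partial>(expo \<Otimes>\<^sub>M \<nu>)) = (\<integral>\<^sup>+s. \<integral>\<^sup>+e. f (Y, e, s) \<partial>expo \<partial>\<nu>)"
      using fY by (subst p.nn_integral_snd[symmetric]) auto
    also have "\<dots> = (\<integral>\<^sup>+s. 0 \<partial>\<nu>)"
    proof (rule nn_integral_cong)
      fix s assume s: "s \<in> space \<nu>"
      show "(\<integral>\<^sup>+e. f (Y, e, s) \<partial>expo) = 0"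
      proof (cases "\<exists>e0. P (Y(w := (e0, s)))")
        case True
        then obtain e0 where e0: "P (Y(w := (e0, s)))" ..
        have "(\<integral>\<^sup>+e. f (Y, e, s) \<partial>expo) \<le> (\<integral>\<^sup>+e. indicator {e0} e \<partial>expo)"
        proof (rule nn_integral_mono)
          fix e
          show "f (Y, e, s) \<le> indicator {e0} e"
          proof (cases "P (Y(w := (e, s)))")
            case True
            then have "e = e0" using s by (intro unique[OF Y _ True e0]) (simp add: space_nu)
            then show ?thesis by (simp add: f_def indicator_def)
          qed (simp add: f_def)
        qed
        also have "\<dots> = emeasure expo {e0}" by (rule nn_integral_indicator) simp
        finally show ?thesis by (simp add: expo_singleton)
      next
        case False
        then have "f (Y, e, s) = 0" for e by (simp add: f_def)
        then show ?thesis by simp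
      qed
    qed
    finally show ?thesis by simp
  qed
  have eq0: "f (keep (- {w}) (X \<omega>), X \<omega> w) = indicator {\<omega> \<in> space M. P (X \<omega>)} \<omega>" if "\<omega> \<in> space M"
      for \<omega>
  proof -
    have "(keep (- {w}) (X \<omega>))(w := X \<omega> w) = X \<omega>" by (auto simp: fun_eq_iff keep_def)
    then show ?thesis using that by (simp add: f_def indicator_def)
  qed
  have [measurable]: "{\<omega> \<in> space M. P (X \<omega>)} \<in> sets M" by measurable
  have "emeasure M {\<omega> \<in> space M. P (X \<omega>)} = (\<integral>\<^sup>+\<omega>. indicator {\<omega> \<in> space M. P (X \<omega>)} \<omega> \<partial>M)"
    by (rule nn_integral_indicator[symmetric]) measurable
  also have "\<dots> = (\<integral>\<^sup>+\<omega>. f (keep (- {w}) (X \<omega>), X \<omega> w) \<partial>M)"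
    by (intro nn_integral_cong eq0[symmetric])
  also have "\<dots> = (\<integral>\<^sup>+\<omega>. \<integral>\<^sup>+x. f (keep (- {w}) (X \<omega>), x) \<partial>(expo \<Otimes>\<^sub>M \<nu>) \<partial>M)"
    by (rule nn_integral_keep_node) auto
  also have "\<dots> = (\<integral>\<^sup>+\<omega>. 0 \<partial>M)"
    by (intro nn_integral_cong inner)
        (rule measurable_space[OF measurable_keep], rule measurable_space[OF measurable_X])
  finally have "emeasure M {\<omega> \<in> space M. P (X \<omega>)} = 0" by simp
  then have "AE \<omega> in M. \<not> P (X \<omega>)" by (intro AE_I[of _ _ "{\<omega> \<in> space M. P (X \<omega>)}"]) auto
  then show ?thesis using AE_fst_pos AE_bounded_oscillation
    by eventually_elim (auto simp: P_def w_def intro: less_imp_le simp del: mass.simps)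
qed

lemma AE_good: "AE \<omega> in M. good_marks \<alpha> (X \<omega>)"
proof -
  have "AE \<omega> in M. \<forall>u i j. i \<noteq> j \<longrightarrow> 0 < mass (X \<omega>) (i # u) \<longrightarrow>
      subtree_ext \<alpha> (X \<omega>) (i # u) \<noteq> subtree_ext \<alpha> (X \<omega>) (j # u)"
    unfolding AE_all_countable using AE_no_tie by (auto simp: AE_all_countable simp del: mass.simps)
  then show ?thesis using AE_fst_pos AE_snd_less_1 AE_bounded_oscillation AE_space
  proof eventually_elim
    case (elim \<omega>)
    show ?case
    proof (intro good_marks.intro bounded_marks.intro good_marks_axioms.intro)
      show "valid_marks (X \<omega>)" using elim by (intro valid_X)
      show "0 \<le> fst (X \<omega> u)" for u using elim(2) by (auto intro: less_imp_le)
    qed (use elim alpha in \<open>auto simp del: mass.simps\<close>)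
  qed
qed

end

section \<open>Cutting off the side subtrees\<close>

definition below :: "nat list set \<Rightarrow> nat list set" where
  "below W = {v. \<exists>w\<in>W. suffix w v}"

text \<open>Siblings of the nodes on the path from the root to \<open>u\<close>, the root excepted.
  The condition \<open>v \<noteq> u\<close> leaves the subtree of \<open>u\<close>
  untouched.\<close>

definition side_set :: "nat list \<Rightarrow> nat list set \<Rightarrow> bool" where
  "side_set u W \<longleftrightarrow> (\<forall>w\<in>W. \<not> suffix w u \<and> (\<exists>j v. w = j # v \<and> suffix v u \<and> v \<noteq> u))"

locale cut_marks = bounded_marks +
  fixes u :: "nat list" and W :: "nat list set"
  assumes side: "side_set u W"
begin

definition "Y = keep (- below W) X"

lemma not_below:
  assumes "suffix v u \<or> suffix u v"
  shows "v \<notin> below W"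
proof
  assume "v \<in> below W"
  then obtain w j x where w: "w \<in> W" "suffix w v" "\<not> suffix w u" "w = j # x" "suffix x u" "x \<noteq> u"
    using side by (auto simp: below_def side_set_def)
  have "length x < length u" using w(5,6) suffix_length_le[OF w(5)] suffix_same_length[of x u u]
      by fastforce
  then have "length w \<le> length u" using w(4) by simp
  then show False using assms w(2,3) suffix_length_suffix[OF w(2)] suffix_order.trans by blast
qed

lemma Y_eq: "v \<notin> below W \<Longrightarrow> Y v = X v"
  by (simp add: Y_def)

lemma below_closed: "w \<in> below W \<Longrightarrow> suffix w v \<Longrightarrow> v \<in> below W"
  by (auto simp: below_def intro: suffix_order.trans)

lemma mass_Y: "(\<And>w. suffix w v \<Longrightarrow> w \<noteq> v \<Longrightarrow> w \<notin> below W) \<Longrightarrow> mass Y v = \<M> v"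
  by (rule mass_cong) (simp add: Y_eq)

lemma birth_Y: "(\<And>w. suffix w v \<Longrightarrow> w \<noteq> v \<Longrightarrow> w \<notin> below W) \<Longrightarrow> birth \<alpha> Y v = B v"
  by (rule birth_cong) (simp add: Y_eq)

text \<open>A removed node has lifetime 0, so its children inherit its birth time, while every other
  node keeps its mass and lifetime. Hence cutting only brings births forward, and boundedness passes
  to the cut tree.\<close>

lemma birth_Y_le: "birth \<alpha> Y v \<le> B v"
proof (induction v)
  case (Cons i v)
  show ?case
  proof (cases "v \<in> below W")
    case True
    then have "birth \<alpha> Y (i # v) = birth \<alpha> Y v" by (simp add: Y_def keep_notin)
    also have "\<dots> \<le> B v" by (rule Cons)
    also have "\<dots> \<le> B (i # v)" by (rule birth_Cons_ge)
    finally show ?thesis .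
  next
    case False
    then have "mass Y v = \<M> v" using below_closed by (intro mass_Y) blast
    then show ?thesis using Cons False by (simp add: Y_eq)
  qed
qed simp

lemma bounded_Y: "bounded_marks \<alpha> Y"
proof
  show "valid_marks Y" using valid one_seq_unit by (auto simp: valid_marks_def Y_def keep_def)
  show "0 \<le> fst (Y v)" for v using fst_nonneg by (auto simp: Y_def keep_def)
  obtain C where "\<And>v. B v \<le> C" using bdd by (auto simp: bdd_above_def)
  then show "bdd_above (range (birth \<alpha> Y))" using birth_Y_le
      by (intro bdd_aboveI2[of _ _ C]) (meson order_trans)
qed

sublocale Y: bounded_marks \<alpha> Y
  by (rule bounded_Y)

lemma E_Y_le: "subtree_ext \<alpha> Y v \<le> E v"
  by (rule Y.E_least) (meson birth_Y_le birth_le_E order_trans)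

lemma comparable:
  assumes "suffix v u \<or> suffix u v"
  shows "Y v = X v" "mass Y v = \<M> v" "birth \<alpha> Y v = B v"
proof -
  have *: "w \<notin> below W" if "suffix w v" for w using below_closed[OF _ that] not_below[OF assms]
      by blast
  then show "Y v = X v" "mass Y v = \<M> v" "birth \<alpha> Y v = B v"
    by (auto intro: mass_Y birth_Y Y_eq)
qed

text \<open>Mass and birth time of a node are determined by its strict ancestors; those of
  \<open>w\<close> lie on the path to \<open>u\<close> and are never removed. So the cut tree still
  knows at what time and with what mass each removed subtree started.\<close>

lemma at_side:
  assumes "w \<in> W"
  shows "mass Y w = \<M> w" "birth \<alpha> Y w = B w"
proof -
  obtain j v where w: "w = j # v" "suffix v u" using side assms by (auto simp: side_set_def)
  have "x \<notin> below W" if "suffix x w" "x \<noteq> w" for x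
    using that w not_below[of x] by (auto simp: suffix_Cons intro: suffix_order.trans)
  then show "mass Y w = \<M> w" "birth \<alpha> Y w = B w" by (auto intro: mass_Y birth_Y)
qed

lemma E_Y_eq:
  assumes "\<And>x. suffix v x \<Longrightarrow> x \<notin> below W"
  shows "subtree_ext \<alpha> Y v = E v"
proof (rule subtree_ext_cong[OF _ Y.bdd bdd])
  fix z
  show "birth \<alpha> Y (z @ v) = B (z @ v)"
    using assms[of "z @ v"] below_closed[of _ "z @ v"] by (intro birth_Y) (auto simp: suffixI)
qed

lemma E_Y_below_u: "suffix u v \<Longrightarrow> subtree_ext \<alpha> Y v = E v"
  by (rule E_Y_eq, rule not_below) (blast intro: suffix_order.trans)

text \<open>Every removed root is itself a child of a node on the path. If it were strictly below
  \<open>j # v\<close>, its parent would be so or equal to it, and the path would run through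
  \<open>j # v\<close>; but the path goes through \<open>i # v\<close>.\<close>

lemma E_Y_sibling:
  assumes i: "suffix (i # v) u" and j: "j \<noteq> i" "j # v \<notin> W"
  shows "subtree_ext \<alpha> Y (j # v) = E (j # v)"
proof (rule E_Y_eq, rule notI)
  fix x assume x: "suffix (j # v) x" and "x \<in> below W"
  then obtain w k y where w: "w \<in> W" "suffix w x" "\<not> suffix w u" "w = k # y" "suffix y u"
    using side by (auto simp: below_def side_set_def)
  have vu: "suffix v u" using i by (rule suffix_ConsD)
  show False
  proof (cases "length w \<le> length (j # v)")
    case True
    then have "suffix w (j # v)" using suffix_length_suffix[OF w(2) x] by simp
    then have "suffix w v" using w(1) j(2) by (auto simp: suffix_Cons)
    then show False using w(3) vu suffix_order.trans by blast
  next
    case False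
    then have "suffix (j # v) w" using suffix_length_suffix[OF x w(2)] by simp
    then have "suffix (j # v) y" using w(1,4) j(2) by (auto simp: suffix_Cons)
    then have "suffix (j # v) u" using w(5) suffix_order.trans by blast
    then show False using suffix_Cons_same[OF i] j(1) by blast
  qed
qed

lemma side_sibling:
  assumes "w \<in> W"
  obtains i j v where "w = j # v" "suffix (i # v) u" "j \<noteq> i"
proof -
  obtain j v where w: "w = j # v" "suffix v u" "v \<noteq> u" "\<not> suffix w u" using side assms
      by (auto simp: side_set_def)
  obtain i where "suffix (i # v) u" using w(2,3) by (auto elim: suffix_cases_Cons)
  then show ?thesis using that w by metis
qed

lemma on_spine_imp_side_less:
  assumes "on_spine \<alpha> X u" "w \<in> W"
  shows "E w < E u"
proof -
  obtain i j v where w: "w = j # v" "suffix (i # v) u" "j \<noteq> i" using side_sibling[OF assms(2)] .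
  have "on_spine \<alpha> X (i # v)" using on_spine_suffix[OF assms(1) w(2)] .
  then have "E w < E (i # v)" using w by simp
  also have "\<dots> = E u" using on_spine_E[OF \<open>on_spine \<alpha> X (i # v)\<close>] on_spine_E[OF assms(1)] by simp
  finally show ?thesis .
qed

text \<open>Along a path that follows the spine all extinction times equal \<open>E u\<close>, and
  this value survives the cut because the subtree of \<open>u\<close> is intact. The siblings can
  only die earlier than before.\<close>

lemma on_spine_Y:
  assumes "on_spine \<alpha> X u"
  shows "on_spine \<alpha> Y u"
proof -
  have "on_spine \<alpha> Y x" if "suffix x u" for x
    using that
  proof (induction x)
    case (Cons i v)
    have x: "on_spine \<alpha> X (i # v)" using on_spine_suffix[OF assms Cons.prems] .
    have "subtree_ext \<alpha> Y (j # v) < subtree_ext \<alpha> Y (i # v)" if "j \<noteq> i" for j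
    proof -
      have "subtree_ext \<alpha> Y (j # v) \<le> E (j # v)" by (rule E_Y_le)
      also have "\<dots> < E (i # v)" using x that by simp
      also have "\<dots> = E u" using on_spine_E[OF x] on_spine_E[OF assms] by simp
      also have "\<dots> = subtree_ext \<alpha> Y u" by (rule E_Y_below_u[symmetric]) simp
      also have "\<dots> \<le> subtree_ext \<alpha> Y (i # v)" by (rule Y.E_antimono[OF Cons.prems])
      finally show ?thesis .
    qed
    then show ?case using Cons by (auto dest: suffix_ConsD)
  qed simp
  then show ?thesis by simp
qed

text \<open>Only the siblings in \<open>W\<close> may have lost lifetime by the cut; for these the
  hypothesis supplies the comparison, and for the others the cut tree does.\<close>

lemma on_spine_X:
  assumes "on_spine \<alpha> Y u" "\<And>w. w \<in> W \<Longrightarrow> E w < E u"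
  shows "on_spine \<alpha> X u"
proof -
  have "on_spine \<alpha> X x" if "suffix x u" for x
    using that
  proof (induction x)
    case (Cons i v)
    have y: "on_spine \<alpha> Y (i # v)" using Y.on_spine_suffix[OF assms(1) Cons.prems] .
    have "E (j # v) < E (i # v)" if "j \<noteq> i" for j
    proof (cases "j # v \<in> W")
      case True
      then have "E (j # v) < E u" by (rule assms(2))
      also have "\<dots> \<le> E (i # v)" by (rule E_antimono[OF Cons.prems])
      finally show ?thesis .
    next
      case False
      have "E (j # v) = subtree_ext \<alpha> Y (j # v)" using E_Y_sibling[OF Cons.prems that False] by simp
      also have "\<dots> < subtree_ext \<alpha> Y (i # v)" using y that by simp
      also have "\<dots> \<le> E (i # v)" by (rule E_Y_le)
      finally show ?thesis .
    qed
    then show ?case using Cons by (auto dest: suffix_ConsD)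
  qed simp
  then show ?thesis by simp
qed

lemma ext_Y:
  assumes "on_spine \<alpha> Y u"
  shows "subtree_ext \<alpha> Y [] = E u"
  using Y.on_spine_E[OF assms] E_Y_below_u[of u] by simp

text \<open>Up to the generation of \<open>u\<close> both spines are the path to \<open>u\<close>,
  and from there on both follow the common subtree of \<open>u\<close>.\<close>

lemma spine_Y:
  assumes "on_spine \<alpha> X u"
  shows "spine \<alpha> Y n = spine \<alpha> X n" "suffix (spine \<alpha> X n) u \<or> suffix u (spine \<alpha> X n)"
proof -
  have x: "spine \<alpha> X (length u) = u" by (rule on_spine_spine[OF assms])
  have y: "spine \<alpha> Y (length u) = u" by (rule Y.on_spine_spine[OF on_spine_Y[OF assms]])
  have "spine \<alpha> Y n = spine \<alpha> X n \<and> (suffix (spine \<alpha> X n) u \<or> suffix u (spine \<alpha> X n))"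
  proof (cases "n \<le> length u")
    case True
    have "suffix (spine \<alpha> X n) u" "suffix (spine \<alpha> Y n) u"
      using suffix_spine[OF True, of \<alpha> X] suffix_spine[OF True, of \<alpha> Y] x y by simp_all
    then show ?thesis using suffix_same_length[of "spine \<alpha> X n" u "spine \<alpha> Y n"] by simp
  next
    case False
    then have "length u \<le> n" by simp
    then show ?thesis
    proof (induction n rule: dec_induct)
      case base
      then show ?case using x y by simp
    next
      case (step n)
      have s: "suffix u (spine \<alpha> X n)" using suffix_spine[OF step(1), of \<alpha> X] x by simp
      then have "subtree_ext \<alpha> Y (j # spine \<alpha> X n) = E (j # spine \<alpha> X n)" for j
        by (intro E_Y_below_u suffix_ConsI)
      then have "lead \<alpha> Y (spine \<alpha> X n) = lead \<alpha> X (spine \<alpha> X n)" by (simp add: lead_def)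
      then show ?case using step(3) s by (simp add: suffix_ConsI)
    qed
  qed
  then show "spine \<alpha> Y n = spine \<alpha> X n" "suffix (spine \<alpha> X n) u \<or> suffix u (spine \<alpha> X n)" by auto
qed

text \<open>Every spine node is comparable with \<open>u\<close>, hence keeps its mark, mass and
  birth time; the extinction time of the whole tree is that of the subtree of
  \<open>u\<close>.\<close>

lemma spine_data_Y:
  assumes "on_spine \<alpha> X u"
  shows "spine_Z \<alpha> Y = spine_Z \<alpha> X" "spine_Theta \<alpha> Y = spine_Theta \<alpha> X" "spine_Delta \<alpha> Y
      = spine_Delta \<alpha> X"
    "side_node \<alpha> Y = side_node \<alpha> X" "side_span \<alpha> Y = side_span \<alpha> X"
proof -
  note s = spine_Y[OF assms] and c = comparable[OF spine_Y(2)[OF assms]]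
  have ext: "subtree_ext \<alpha> Y [] = E []"
    using ext_Y[OF on_spine_Y[OF assms]] on_spine_E[OF assms] by simp
  have lead: "lead \<alpha> Y (spine \<alpha> X n) = lead \<alpha> X (spine \<alpha> X n)" for n
    using s(1)[of "Suc n"] s(1)[of n] by simp
  show "spine_Z \<alpha> Y = spine_Z \<alpha> X"
    by (simp only: fun_eq_iff spine_Z_def s c ext simp_thms)
  show *: "spine_Theta \<alpha> Y = spine_Theta \<alpha> X"
    by (simp only: fun_eq_iff spine_Theta_def s c simp_thms)
  show **: "spine_Delta \<alpha> Y = spine_Delta \<alpha> X"
    by (simp only: fun_eq_iff spine_Delta_def s c lead simp_thms)
  show "side_node \<alpha> Y = side_node \<alpha> X"
    by (simp only: fun_eq_iff side_node_def s lead simp_thms)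
  show "side_span \<alpha> Y = side_span \<alpha> X"
    by (simp only: fun_eq_iff side_span_def * ** \<open>spine_Z \<alpha> Y = spine_Z \<alpha> X\<close> simp_thms)
qed

end

text \<open>
  The node which is the side node \<open>(n, m)\<close> as soon as the spine starts with the path to \<open>u\<close>.
\<close>

definition sibling_node :: "nat list \<Rightarrow> nat \<times> nat \<Rightarrow> nat list" where
  "sibling_node u = (\<lambda>(n, m). skip (hd (drop (length u - n) u)) m # tl (drop (length u - n) u))"

lemma drop_split:
  assumes "1 \<le> n" "n \<le> length u"
  obtains i v where "drop (length u - n) u = i # v" "length v = n - 1" "suffix (i # v) u"
proof -
  have "length (drop (length u - n) u) = n" using assms by simp
  then obtain i v where iv: "drop (length u - n) u = i # v" using assms
      by (cases "drop (length u - n) u") auto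
  have "length (i # v) = n" using iv assms by (metis \<open>length (drop (length u - n) u) = n\<close>)
  then show ?thesis using that iv suffix_drop[of "length u - n" u] by auto
qed

lemma sibling_node_unique:
  assumes n: "1 \<le> n" "n \<le> length u" "1 \<le> n'" "n' \<le> length u"
    and s: "suffix (sibling_node u (n, m)) x" "suffix (sibling_node u (n', m')) x"
  shows "n = n' \<and> m = m'"
proof -
  have le: "\<not> n < n'" if n: "1 \<le> n" "n \<le> length u" "1 \<le> n'" "n' \<le> length u"
    and s: "suffix (sibling_node u (n, m)) x" "suffix (sibling_node u (n', m')) x" for n m n' m'
  proof
    assume "n < n'"
    obtain i v where v: "drop (length u - n) u = i # v" "length v = n - 1" "suffix (i # v) u"
      using drop_split[OF n(1,2)] .
    obtain i' v' where v': "drop (length u - n') u = i' # v'" "length v'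
        = n' - 1" "suffix (i' # v') u"
      using drop_split[OF n(3,4)] .
    have "suffix (i # v) v'"
      using suffix_length_suffix[OF v(3) suffix_ConsD[OF v'(3)]] v(2) v'(2) \<open>n < n'\<close> n(1) by simp
    moreover have "suffix v' x" using s(2) by (simp add: sibling_node_def v') (rule suffix_ConsD)
    ultimately have "suffix (i # v) x" by (rule suffix_order.trans)
    moreover have "suffix (skip i m # v) x" using s(1) by (simp add: sibling_node_def v)
    ultimately have "i = skip i m" by (rule suffix_Cons_same)
    then show False using skip_neq[of i m] by simp
  qed
  have "n = n'" using le[OF n s] le[OF n(3,4,1,2) s(2,1)] by simp
  moreover have "m = m'"
  proof -
    obtain i v where v: "drop (length u - n) u = i # v" using drop_split[OF n(1,2)] .
    have "skip i m = skip i m'"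
      using s suffix_Cons_same[of "skip i m" v x "skip i m'"]
          by (simp add: sibling_node_def v flip: \<open>n = n'\<close>)
    then show ?thesis using inj_skip by (auto dest: injD)
  qed
  ultimately show ?thesis ..
qed

lemma side_set_sibling_nodes:
  assumes "\<And>n m. (n, m) \<in> J \<Longrightarrow> 1 \<le> n \<and> n \<le> length u"
  shows "side_set u (sibling_node u ` J)"
  unfolding side_set_def
proof (intro ballI)
  fix w assume "w \<in> sibling_node u ` J"
  then obtain n m where nm: "(n, m) \<in> J" "w = sibling_node u (n, m)" by auto
  then have n: "1 \<le> n" "n \<le> length u" using assms by auto
  obtain i v where v: "drop (length u - n) u = i # v" "length v = n - 1" "suffix (i # v) u"
    using drop_split[OF n] .
  have w: "w = skip i m # v" by (simp add: nm sibling_node_def v)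
  have "\<not> suffix w u" using suffix_Cons_same[OF v(3), of "skip i m"] skip_neq[of i m] unfolding w
      by auto
  moreover have "v \<noteq> u" using v(2) n by auto
  ultimately show "\<not> suffix w u \<and> (\<exists>j v. w = j # v \<and> suffix v u \<and> v \<noteq> u)"
    using w suffix_ConsD[OF v(3)] by auto
qed

lemma (in bounded_marks) side_node_eq_sibling_node:
  assumes "on_spine \<alpha> X u" "1 \<le> n" "n \<le> length u"
  shows "side_node \<alpha> X n m = sibling_node u (n, m)"
proof -
  have "suffix (spine \<alpha> X n) u"
    using suffix_spine[OF assms(3), of \<alpha> X] on_spine_spine[OF assms(1)] by simp
  then have "drop (length u - n) u = spine \<alpha> X n"
    using suffix_same_length[OF suffix_drop, of "spine \<alpha> X n" u "length u - n"] assms by simp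
  moreover obtain k where "n = Suc k" using assms by (cases n) auto
  ultimately show ?thesis by (simp add: sibling_node_def side_node_def)
qed

lemma (in bounded_marks) side_ext_less_iff:
  assumes "0 < \<M> w"
  shows "subtree_ext \<alpha> (sub X w) [] < \<M> w powr \<alpha> * (c - B w) \<longleftrightarrow> E w < c"
  unfolding E_sub[OF assms] using assms by (simp add: mult_less_cancel_left_pos)

text \<open>On the clock of a removed subtree, dying before \<open>E u\<close> means dying before
  the threshold computed from the cut tree, since the extinction time of the cut tree is
  \<open>E u\<close> once its spine passes through \<open>u\<close>. The gain is a separation of
  variables: each condition on the right involves the cut tree and at most one removed
  subtree.\<close>

lemma cut_criterion:
  assumes X: "bounded_marks \<alpha> X" and J: "\<And>n m. (n, m) \<in> J \<Longrightarrow> 1 \<le> n \<and> n \<le> length u"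
  defines "Y \<equiv> keep (- below (sibling_node u ` J)) X"
  shows "(on_spine \<alpha> X u \<and> (\<forall>(n, m)\<in>J. 0 < spine_Delta \<alpha> X n m)) \<longleftrightarrow>
    on_spine \<alpha> Y u \<and> (\<forall>(n, m)\<in>J. 0 < spine_Delta \<alpha> Y n m) \<and>
    (\<forall>(n, m)\<in>J. subtree_ext \<alpha> (sub X (sibling_node u (n, m))) [] < side_span \<alpha> Y n m)"
proof -
  interpret bounded_marks \<alpha> X by fact
  interpret c: cut_marks \<alpha> X u "sibling_node u ` J"
    by unfold_locales (rule side_set_sibling_nodes[OF J])
  have Y: "c.Y = Y" by (simp add: c.Y_def Y_def)
  have key: "subtree_ext \<alpha> (sub X (sibling_node u (n, m))) [] < side_span \<alpha> Y n m
      \<longleftrightarrow> E (sibling_node u (n, m)) < E u"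
    if on: "on_spine \<alpha> Y u" and D: "0 < spine_Delta \<alpha> Y n m" and nm: "(n, m) \<in> J" for n m
  proof -
    interpret Y: bounded_marks \<alpha> Y using c.bounded_Y unfolding Y .
    obtain k where k: "n = Suc k" "Suc k \<le> length u" using J[OF nm] by (cases n) auto
    have sp: "suffix (spine \<alpha> Y i) u" if "i \<le> length u" for i
      using suffix_spine[OF that, of \<alpha> Y] Y.on_spine_spine[OF on] by simp
    have pos: "0 < mass Y (spine \<alpha> Y k)" "0 < mass Y (spine \<alpha> Y (Suc k))"
      using k(2)
          by (auto intro!: Y.on_spine_mass_pos Y.on_spine_suffix[OF on] sp simp del: spine.simps)
    have node: "side_node \<alpha> Y (Suc k) m = sibling_node u (n, m)"
      using Y.side_node_eq_sibling_node[OF on _ k(2)] k(1) by simp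
    have w: "sibling_node u (n, m) \<in> sibling_node u ` J" using nm by simp
    note p = Y.side_node_props_of_pos[OF pos D[unfolded k(1)], unfolded node]
    have mB: "mass Y (sibling_node u (n, m)) = \<M> (sibling_node u (n, m))"
      "birth \<alpha> Y (sibling_node u (n, m)) = B (sibling_node u (n, m))"
      using c.at_side[OF w] unfolding Y by auto
    have "side_span \<alpha> Y n m = \<M> (sibling_node u (n, m)) powr \<alpha> * (E u - B (sibling_node u (n, m)))"
      using p(3,4) c.ext_Y on mB unfolding Y k(1) by (simp del: spine.simps mass.simps birth.simps)
    moreover have "0 < \<M> (sibling_node u (n, m))" using p(2) unfolding mB .
    ultimately show ?thesis using side_ext_less_iff by simp
  qed
  show ?thesis
  proof
    assume x: "on_spine \<alpha> X u \<and> (\<forall>(n, m)\<in>J. 0 < spine_Delta \<alpha> X n m)"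
    then have y: "on_spine \<alpha> Y u" "spine_Delta \<alpha> Y = spine_Delta \<alpha> X"
      using c.on_spine_Y c.spine_data_Y(3) unfolding Y by auto
    then show "on_spine \<alpha> Y u \<and> (\<forall>(n, m)\<in>J. 0 < spine_Delta \<alpha> Y n m) \<and>
      (\<forall>(n, m)\<in>J. subtree_ext \<alpha> (sub X (sibling_node u (n, m))) [] < side_span \<alpha> Y n m)"
      using x key c.on_spine_imp_side_less by auto
  next
    assume y: "on_spine \<alpha> Y u \<and> (\<forall>(n, m)\<in>J. 0 < spine_Delta \<alpha> Y n m) \<and>
      (\<forall>(n, m)\<in>J. subtree_ext \<alpha> (sub X (sibling_node u (n, m))) [] < side_span \<alpha> Y n m)"
    have x: "on_spine \<alpha> X u"
    proof (rule c.on_spine_X)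
      show "on_spine \<alpha> c.Y u" using y unfolding Y by simp
      fix w assume "w \<in> sibling_node u ` J"
      then obtain n m where nm: "(n, m) \<in> J" "w = sibling_node u (n, m)" by auto
      then have "0 < spine_Delta \<alpha> Y n m" "subtree_ext \<alpha> (sub X w) [] < side_span \<alpha> Y n m" using y
          by auto
      then show "E w < E u" using key y nm by blast
    qed
    then show "on_spine \<alpha> X u \<and> (\<forall>(n, m)\<in>J. 0 < spine_Delta \<alpha> X n m)"
      using c.spine_data_Y(3)[OF x] y unfolding Y by simp
  qed
qed

section \<open>Conditional law of the side fragmentations\<close>

text \<open>The joint law is a product measure; integrating the coordinate \<open>a\<close> last,
  the others factor for each fixed value of it.\<close>

lemma (in prob_space) nn_integral_indep_vars_prod:
  assumes I: "finite I" "a \<notin> I"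
    and rv: "\<And>i. V i \<in> measurable M S"
    and ind: "indep_vars (\<lambda>_. S) V (insert a I)"
    and f[measurable]: "f \<in> borel_measurable S"
    and h: "\<And>i. i \<in> I \<Longrightarrow> h i \<in> borel_measurable (S \<Otimes>\<^sub>M S)"
  shows "(\<integral>\<^sup>+\<omega>. f (V a \<omega>) * (\<Prod>i\<in>I. h i (V a \<omega>, V i \<omega>)) \<partial>M) =
    (\<integral>\<^sup>+\<omega>. f (V a \<omega>) * (\<Prod>i\<in>I. \<integral>\<^sup>+z. h i (V a \<omega>, z) \<partial>distr M S (V i)) \<partial>M)"
proof -
  define D where "D i = distr M S (V i)" for i
  have D: "prob_space (D i)" for i unfolding D_def by (rule prob_space_distr[OF rv])
  interpret D: product_sigma_finite D
    by (intro product_sigma_finite.intro prob_space_imp_sigma_finite D)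
  have sets_D: "sets (D i) = sets S" for i by (simp add: D_def)
  define F where "F x = f (x a) * (\<Prod>i\<in>I. h i (x a, x i))" for x
  let ?P = "\<Pi>\<^sub>M i\<in>insert a I. S"
  have F[measurable]: "F \<in> borel_measurable ?P"
  proof -
    have "(\<lambda>x. h i (x a, x i)) \<in> borel_measurable ?P" if "i \<in> I" for i
      using that by (intro measurable_compose[OF _ h[OF that]]) measurable
    then show ?thesis unfolding F_def
        by (intro borel_measurable_times_ennreal borel_measurable_prod_ennreal) auto
  qed
  have F': "F \<in> borel_measurable (\<Pi>\<^sub>M i\<in>insert a I. D i)"
    using F by (subst measurable_cong_sets[OF sets_PiM_cong[OF refl sets_D] refl])
  have hD: "(\<lambda>z. h i (y, z)) \<in> borel_measurable (D i)" if "i \<in> I" "y \<in> space S" for i y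
    using measurable_compose[OF measurable_Pair1'[OF that(2)] h[OF that(1)]]
    by (subst measurable_cong_sets[OF sets_D refl])
  have hint: "(\<lambda>y. \<integral>\<^sup>+z. h i (y, z) \<partial>D i) \<in> borel_measurable S" if "i \<in> I" for i
  proof -
    have "h i \<in> borel_measurable (S \<Otimes>\<^sub>M D i)"
      using h[OF that]
          by (subst measurable_cong_sets[OF sets_pair_measure_cong[OF refl sets_D] refl])
    then show ?thesis
      by (rule sigma_finite_measure.borel_measurable_nn_integral_fst[OF
          prob_space_imp_sigma_finite[OF D]])
  qed
  have "(\<integral>\<^sup>+\<omega>. f (V a \<omega>) * (\<Prod>i\<in>I. h i (V a \<omega>, V i \<omega>)) \<partial>M) = (\<integral>\<^sup>+\<omega>. F (\<lambda>i\<in>insert a I. V i \<omega>) \<partial>M)"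
    unfolding F_def by (intro nn_integral_cong arg_cong2[where f = "(*)"] prod.cong) auto
  also have "\<dots> = (\<integral>\<^sup>+x. F x \<partial>distr M ?P (\<lambda>\<omega>. \<lambda>i\<in>insert a I. V i \<omega>))"
    by (subst nn_integral_distr) (auto intro!: measurable_restrict rv)
  also have "distr M ?P (\<lambda>\<omega>. \<lambda>i\<in>insert a I. V i \<omega>) = (\<Pi>\<^sub>M i\<in>insert a I. D i)"
    unfolding D_def by (subst indep_vars_iff_distr_eq_PiM'[symmetric]) (use ind rv in auto)
  also have "(\<integral>\<^sup>+x. F x \<partial>(\<Pi>\<^sub>M i\<in>insert a I. D i))
      = (\<integral>\<^sup>+y. \<integral>\<^sup>+x. F (x(a := y)) \<partial>(\<Pi>\<^sub>M i\<in>I. D i) \<partial>D a)"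
    by (rule D.product_nn_integral_insert_rev[OF I F'])
  also have "\<dots> = (\<integral>\<^sup>+y. f y * (\<Prod>i\<in>I. \<integral>\<^sup>+z. h i (y, z) \<partial>D i) \<partial>D a)"
  proof (rule nn_integral_cong)
    fix y assume "y \<in> space (D a)"
    then have y: "y \<in> space S" by (simp add: D_def)
    have "(\<integral>\<^sup>+x. F (x(a := y)) \<partial>(\<Pi>\<^sub>M i\<in>I. D i))
        = (\<integral>\<^sup>+x. f y * (\<Prod>i\<in>I. h i (y, x i)) \<partial>(\<Pi>\<^sub>M i\<in>I. D i))"
      unfolding F_def using I(2)
          by (intro nn_integral_cong arg_cong2[where f = "(*)"] prod.cong) auto
    also have "\<dots> = f y * (\<integral>\<^sup>+x. (\<Prod>i\<in>I. h i (y, x i)) \<partial>(\<Pi>\<^sub>M i\<in>I. D i))"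
      using hD[OF _ y] by (intro nn_integral_cmult borel_measurable_prod_ennreal)
        (rule measurable_compose[OF measurable_component_singleton])
    also have "(\<integral>\<^sup>+x. (\<Prod>i\<in>I. h i (y, x i)) \<partial>(\<Pi>\<^sub>M i\<in>I. D i)) = (\<Prod>i\<in>I. \<integral>\<^sup>+z. h i (y, z) \<partial>D i)"
      by (rule D.product_nn_integral_prod[OF I(1) hD[OF _ y]])
    finally show "(\<integral>\<^sup>+x. F (x(a := y)) \<partial>(\<Pi>\<^sub>M i\<in>I. D i)) = f y * (\<Prod>i\<in>I. \<integral>\<^sup>+z. h i (y, z) \<partial>D i)" .
  qed
  also have "\<dots> = (\<integral>\<^sup>+\<omega>. f (V a \<omega>) * (\<Prod>i\<in>I. \<integral>\<^sup>+z. h i (V a \<omega>, z) \<partial>D i) \<partial>M)"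
    unfolding D_def[of a]
    by (rule nn_integral_distr[OF rv])
        (auto intro!: borel_measurable_times_ennreal borel_measurable_prod_ennreal hint)
  finally show ?thesis unfolding D_def .
qed

context fragmentation
begin

text \<open>The marks are i.i.d., so relabelling the nodes by the injection
  \<open>v \<mapsto> v @ w\<close> leaves the product law unchanged.\<close>

lemma law_sub: "distr M marks_space (\<lambda>\<omega>. sub (X \<omega>) w) = distr M marks_space X"
proof -
  have law_PiM: "distr M marks_space (\<lambda>\<omega> v. Z v \<omega>) = (\<Pi>\<^sub>M v\<in>UNIV. expo \<Otimes>\<^sub>M \<nu>)"
    if ind: "indep_vars (\<lambda>_. mark_space) Z UNIV" and Z: "\<And>v. distr M mark_space (Z v) = expo \<Otimes>\<^sub>M \<nu>"
    for Z :: "nat list \<Rightarrow> 'a \<Rightarrow> real \<times> (nat \<Rightarrow> real)"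
  proof -
    have rv: "\<And>v. random_variable mark_space (Z v)" using ind by (auto simp: indep_vars_def)
    show ?thesis
      using ind indep_vars_iff_distr_eq_PiM'[of UNIV Z "\<lambda>_. mark_space"] rv Z
          by (simp add: restrict_def)
  qed
  have "indep_vars (\<lambda>v. \<Pi>\<^sub>M u\<in>{v @ w}. mark_space) (\<lambda>v \<omega>. restrict (\<lambda>u. X \<omega> u) {v @ w}) UNIV"
    by (rule indep_vars_restrict[OF indep]) (auto simp: disjoint_family_on_def)
  then have "indep_vars (\<lambda>_. mark_space) (\<lambda>v \<omega>. restrict (\<lambda>u. X \<omega> u) {v @ w} (v @ w)) UNIV"
    by (rule indep_vars_compose2[where Y = "\<lambda>v R. R (v @ w)"]) auto
  then have "indep_vars (\<lambda>_. mark_space) (\<lambda>v \<omega>. X \<omega> (v @ w)) UNIV" by simp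
  then show ?thesis
    using law_PiM[of "\<lambda>v \<omega>. X \<omega> (v @ w)"] law_PiM[OF indep] law by (simp add: sub_def)
qed

definition side_pair :: "marks \<Rightarrow> nat \<times> nat \<Rightarrow> real \<times> marks" where
  "side_pair Y j = (side_span \<alpha> Y (fst j) (snd j), sub Y (side_node \<alpha> Y (fst j) (snd j)))"

definition sides_positive :: "(nat \<times> nat) set \<Rightarrow> marks \<Rightarrow> bool" where
  "sides_positive J Y \<longleftrightarrow> (\<forall>(n, m)\<in>J. 0 < spine_Delta \<alpha> Y n m)"

lemma measurable_sides_positive [measurable]:
  assumes "finite J"
  shows "Measurable.pred marks_space (sides_positive J)"
  unfolding sides_positive_def case_prod_beta
  using countable_finite[OF assms] by measurable

lemma measurable_side_pair [measurable]:
    "(\<lambda>Y. side_pair Y j) \<in> measurable marks_space (borel \<Otimes>\<^sub>M marks_space)"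
  unfolding side_pair_def
  by (intro measurable_Pair measurable_side_span measurable_compose_countable[OF measurable_sub
      measurable_side_node])

text \<open>By \<open>cut_criterion\<close> the integrand becomes a function of the cut tree times,
  for each \<open>j\<close>, a function of the cut tree and one removed subtree. The removed
  subtrees are independent of the cut tree and distributed like the whole tree, so each is replaced
  by a copy \<open>X \<omega>'\<close>; its extinction before the threshold becomes an indicator in
  the inner integral. \<open>G_cong\<close> lets \<open>G\<close> be evaluated on the cut
  tree.\<close>

lemma side_identity_at:
  assumes J: "finite J" "\<And>n m. (n, m) \<in> J \<Longrightarrow> 1 \<le> n \<and> n \<le> length u"
    and \<phi>: "\<And>j. j \<in> J \<Longrightarrow> \<phi> j \<in> borel_measurable (borel \<Otimes>\<^sub>M marks_space)"
    and G[measurable]: "G \<in> borel_measurable marks_space"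
    and G_cong: "\<And>Y Z. spine_Z \<alpha> Y = spine_Z \<alpha> Z \<Longrightarrow> spine_Theta \<alpha> Y = spine_Theta \<alpha> Z \<Longrightarrow>
      spine_Delta \<alpha> Y = spine_Delta \<alpha> Z \<Longrightarrow> G Y = G Z"
  defines "Y \<equiv> \<lambda>\<omega>. keep (- below (sibling_node u ` J)) (X \<omega>)"
  shows "(\<integral>\<^sup>+\<omega>. indicator {Y. spine \<alpha> Y (length u) = u \<and> sides_positive J Y} (X \<omega>) * G (X \<omega>) *
      (\<Prod>j\<in>J. \<phi> j (side_pair (X \<omega>) j)) \<partial>M) =
    (\<integral>\<^sup>+\<omega>. indicator {Y. on_spine \<alpha> Y u \<and> sides_positive J Y} (Y \<omega>) * G (Y \<omega>) *
      (\<Prod>j\<in>J. \<integral>\<^sup>+\<omega>'. \<phi> j (side_span \<alpha> (Y \<omega>) (fst j) (snd j), X \<omega>') *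
        indicator {z. subtree_ext \<alpha> z [] < side_span \<alpha> (Y \<omega>) (fst j) (snd j)} (X \<omega>') \<partial>M) \<partial>M)"
proof -
  define w where "w = sibling_node u"
  \<comment> \<open>\<open>None\<close> labels the nodes of the cut tree and \<open>Some j\<close>
    those of the removed subtree at \<open>w j\<close>. These sets are disjoint, hence carry
    independent marks.\<close>
  define K where "K l = (case l of None \<Rightarrow> - below (w ` J) | Some j \<Rightarrow> {v. suffix (w j) v})" for l
  define V where "V l \<omega> = keep (K l) (X \<omega>)" for l \<omega>
  have V_None: "V None = Y" by (simp add: V_def[abs_def] K_def Y_def w_def)
  have [measurable]: "V l \<in> measurable M marks_space" for l unfolding V_def by measurable
  have disj: "disjoint_family_on K (insert None (Some ` J))"
    unfolding disjoint_family_on_def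
  proof (intro ballI impI)
    fix a b assume ab: "a \<in> insert None (Some ` J)" "b \<in> insert None (Some ` J)" "a \<noteq> b"
    have "j = j'" if "j \<in> J" "j' \<in> J" "suffix (w j) v" "suffix (w j') v" for j j' v
    proof -
      obtain n m n' m' where j: "j = (n, m)" "j' = (n', m')" by (cases j, cases j') auto
      show ?thesis using sibling_node_unique[of n u n' m v m'] that J(2)[of n m] J(2)[of n' m']
          unfolding j w_def by auto
    qed
    then show "K a \<inter> K b = {}" using ab by (auto simp: K_def below_def)
  qed
  have ind: "indep_vars (\<lambda>_. marks_space) V (insert None (Some ` J))"
    unfolding V_def[abs_def] by (rule indep_keep[OF disj])
  have sub_V: "sub (V (Some j) \<omega>) (w j) = sub (X \<omega>) (w j)" for j \<omega>
    by (simp add: sub_def V_def K_def suffixI)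
  define f where "f Z = indicator {Y. on_spine \<alpha> Y u \<and> sides_positive J Y} Z * G Z" for Z
  have [measurable]: "f \<in> borel_measurable marks_space"
    unfolding f_def indicator_def mem_Collect_eq using J(1) by measurable
  define g where "g j p = \<phi> j (side_span \<alpha> (fst p) (fst j) (snd j), snd p) *
    indicator {z. subtree_ext \<alpha> z [] < side_span \<alpha> (fst p) (fst j) (snd j)} (snd p)" for j p
  have span_fst: "(\<lambda>p. side_span \<alpha> (fst p) n m) \<in> borel_measurable (marks_space \<Otimes>\<^sub>M marks_space)"
      for n m
    by (rule measurable_compose[OF measurable_fst measurable_side_span])
  have ext_snd: "(\<lambda>p. subtree_ext \<alpha> (snd p) []) \<in> borel_measurable (marks_space \<Otimes>\<^sub>M marks_space)"
    by (rule measurable_compose[OF measurable_snd measurable_subtree_ext])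
  have g: "g j \<in> borel_measurable (marks_space \<Otimes>\<^sub>M marks_space)" if "j \<in> J" for j
  proof -
    have "(\<lambda>p. \<phi> j (side_span \<alpha> (fst p) (fst j) (snd j), snd p)) \<in> borel_measurable (marks_space
        \<Otimes>\<^sub>M marks_space)"
      by (rule measurable_compose[OF measurable_Pair[OF span_fst measurable_snd] \<phi>[OF that]])
    moreover have "Measurable.pred (marks_space \<Otimes>\<^sub>M marks_space)
        (\<lambda>p. subtree_ext \<alpha> (snd p) [] < side_span \<alpha> (fst p) (fst j) (snd j))"
      unfolding pred_def by (rule borel_measurable_less[OF ext_snd span_fst])
    ultimately show ?thesis unfolding g_def[abs_def] indicator_def mem_Collect_eq by measurable
  qed
  define h where "h l p = g (the l) (fst p, sub (snd p) (w (the l)))" for l p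
  have h: "h l \<in> borel_measurable (marks_space \<Otimes>\<^sub>M marks_space)" if "l \<in> Some ` J" for l
  proof -
    have "(\<lambda>p. (fst p, sub (snd p) (w (the l)))) \<in> measurable (marks_space \<Otimes>\<^sub>M marks_space)
        (marks_space \<Otimes>\<^sub>M marks_space)"
      by (intro measurable_Pair measurable_fst measurable_compose[OF measurable_snd measurable_sub])
    from measurable_compose[OF this g] show ?thesis using that unfolding h_def by auto
  qed
  have "(\<integral>\<^sup>+\<omega>. indicator {Y. spine \<alpha> Y (length u) = u \<and> sides_positive J Y} (X \<omega>) * G (X \<omega>) *
      (\<Prod>j\<in>J. \<phi> j (side_pair (X \<omega>) j)) \<partial>M) = (\<integral>\<^sup>+\<omega>. f (V None \<omega>) *
          (\<Prod>l\<in>Some ` J. h l (V None \<omega>, V l \<omega>)) \<partial>M)"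
  proof (rule nn_integral_cong_AE)
    show "AE \<omega> in M. indicator {Y. spine \<alpha> Y (length u) = u \<and> sides_positive J Y} (X \<omega>) * G (X \<omega>) *
      (\<Prod>j\<in>J. \<phi> j (side_pair (X \<omega>) j)) = f (V None \<omega>) * (\<Prod>l\<in>Some ` J. h l (V None \<omega>, V l \<omega>))"
      using AE_good
    proof eventually_elim
      case (elim \<omega>)
      interpret good_marks \<alpha> "X \<omega>" by fact
      interpret c: cut_marks \<alpha> "X \<omega>" u "w ` J"
        by unfold_locales (use side_set_sibling_nodes[OF J(2)] in \<open>simp add: w_def\<close>)
      have cY: "c.Y = Y \<omega>" unfolding c.Y_def unfolding Y_def w_def by (rule refl)
      have prod: "(\<Prod>l\<in>Some ` J. h l (V None \<omega>, V l \<omega>)) = (\<Prod>j\<in>J. g j (Y \<omega>, sub (X \<omega>) (w j)))"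
        by (subst prod.reindex) (auto simp: h_def V_None sub_V)
      have crit: "(spine \<alpha> (X \<omega>) (length u) = u \<and> sides_positive J (X \<omega>)) \<longleftrightarrow>
          (on_spine \<alpha> (Y \<omega>) u \<and> sides_positive J (Y \<omega>)) \<and>
          (\<forall>(n, m)\<in>J. subtree_ext \<alpha> (sub (X \<omega>) (w (n, m))) [] < side_span \<alpha> (Y \<omega>) n m)"
        using cut_criterion[OF bounded_marks_axioms J(2), of J]
            unfolding on_spine_iff sides_positive_def Y_def w_def
        by auto
      show ?case
      proof (cases "spine \<alpha> (X \<omega>) (length u) = u \<and> sides_positive J (X \<omega>)")
        case True
        then have on: "on_spine \<alpha> (X \<omega>) u" by (simp add: on_spine_iff)
        note d = c.spine_data_Y[OF on, unfolded cY]
        have "g j (Y \<omega>, sub (X \<omega>) (w j)) = \<phi> j (side_pair (X \<omega>) j)" if j: "j \<in> J" for j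
        proof -
          obtain n m where nm: "j = (n, m)" by (cases j)
          have "side_node \<alpha> (X \<omega>) n m = w j"
            using side_node_eq_sibling_node[OF on, of n m] J(2) j nm by (simp add: w_def)
          moreover have "subtree_ext \<alpha> (sub (X \<omega>) (w (n, m))) [] < side_span \<alpha> (Y \<omega>) n m"
            using True crit j nm by auto
          ultimately show ?thesis by (simp add: g_def side_pair_def nm d)
        qed
        moreover have "G (Y \<omega>) = G (X \<omega>)" by (rule G_cong[OF d(1,2,3)])
        ultimately show ?thesis
          using True crit unfolding V_None f_def by (simp add: prod[unfolded V_None])
      next
        case False
        show ?thesis
        proof (cases "on_spine \<alpha> (Y \<omega>) u \<and> sides_positive J (Y \<omega>)")
          case True
          \<comment> \<open>The cut tree meets its conditions but the whole tree does not, so some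
            removed subtree lasts at least as long as its threshold; its factor, and with it the
            product, vanishes.\<close>
          then obtain n m where nm: "(n, m) \<in> J"
              "\<not> subtree_ext \<alpha> (sub (X \<omega>) (w (n, m))) [] < side_span \<alpha> (Y \<omega>) n m"
            using False crit by auto
          then have "g (n, m) (Y \<omega>, sub (X \<omega>) (w (n, m))) = 0" by (simp add: g_def)
          then have "(\<Prod>j\<in>J. g j (Y \<omega>, sub (X \<omega>) (w j))) = 0" using J(1) nm(1)
              by (auto intro!: prod_zero)
          then show ?thesis using False unfolding prod by simp
        next
          case no: False
          then show ?thesis using False unfolding V_None f_def by auto
        qed
      qed
    qed
  qed
  also have "\<dots> = (\<integral>\<^sup>+\<omega>. f (V None \<omega>) * (\<Prod>l\<in>Some ` J. \<integral>\<^sup>+z. h l (V None \<omega>, z) \<partial>distr M marks_space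
      (V l)) \<partial>M)"
    by (rule nn_integral_indep_vars_prod) (use J(1) ind h in auto)
  also have "\<dots> = (\<integral>\<^sup>+\<omega>. f (Y \<omega>) * (\<Prod>j\<in>J. \<integral>\<^sup>+\<omega>'. g j (Y \<omega>, X \<omega>') \<partial>M) \<partial>M)"
  proof (rule nn_integral_cong)
    fix \<omega> assume "\<omega> \<in> space M"
    then have Y: "Y \<omega> \<in> space marks_space"
      unfolding V_None[symmetric] by (rule measurable_space[rotated]) measurable
    have "(\<integral>\<^sup>+z. h (Some j) (Y \<omega>, z) \<partial>distr M marks_space (V (Some j)))
        = (\<integral>\<^sup>+\<omega>'. g j (Y \<omega>, X \<omega>') \<partial>M)"
      if j: "j \<in> J" for j
    proof -
      have hj: "(\<lambda>z. h (Some j) (Y \<omega>, z)) \<in> borel_measurable marks_space"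
        using j by (intro measurable_compose[OF measurable_Pair1'[OF Y] h]) simp
      have gj: "(\<lambda>z. g j (Y \<omega>, z)) \<in> borel_measurable marks_space"
        by (rule measurable_compose[OF measurable_Pair1'[OF Y] g[OF j]])
      have "(\<integral>\<^sup>+z. h (Some j) (Y \<omega>, z) \<partial>distr M marks_space (V (Some j)))
          = (\<integral>\<^sup>+\<omega>'. g j (Y \<omega>, sub (X \<omega>') (w j)) \<partial>M)"
        by (subst nn_integral_distr) (use hj in \<open>auto simp: h_def sub_V\<close>)
      also have "\<dots> = (\<integral>\<^sup>+z. g j (Y \<omega>, z) \<partial>distr M marks_space (\<lambda>\<omega>. sub (X \<omega>) (w j)))"
        by (subst nn_integral_distr) (use gj in auto)
      also have "\<dots> = (\<integral>\<^sup>+\<omega>'. g j (Y \<omega>, X \<omega>') \<partial>M)"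
        unfolding law_sub by (subst nn_integral_distr) (use gj in auto)
      finally show ?thesis .
    qed
    then show "f (V None \<omega>) * (\<Prod>l\<in>Some ` J. \<integral>\<^sup>+z. h l (V None \<omega>, z) \<partial>distr M marks_space (V l)) =
      f (Y \<omega>) * (\<Prod>j\<in>J. \<integral>\<^sup>+\<omega>'. g j (Y \<omega>, X \<omega>') \<partial>M)"
      by (subst prod.reindex) (auto simp: V_None)
  qed
  finally show ?thesis by (simp add: f_def g_def)
qed

text \<open>After the reduction at a fixed node, \<open>\<phi>\<close> enters only through its
  integrals over extinction before a given \<open>x\<close>. Functions with the same such integrals
  may therefore be exchanged, which is how conditional laws come in.\<close>

lemma side_identity:
  assumes J: "finite J" "\<And>n m. (n, m) \<in> J \<Longrightarrow> 1 \<le> n"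
    and \<phi>: "\<And>j. j \<in> J \<Longrightarrow> \<phi> j \<in> borel_measurable (borel \<Otimes>\<^sub>M marks_space)"
    and \<psi>: "\<And>j. j \<in> J \<Longrightarrow> \<psi> j \<in> borel_measurable (borel \<Otimes>\<^sub>M marks_space)"
    and eq: "\<And>j x. j \<in> J \<Longrightarrow>
      (\<integral>\<^sup>+\<omega>. \<phi> j (x, X \<omega>) * indicator {z. subtree_ext \<alpha> z [] < x} (X \<omega>) \<partial>M) =
      (\<integral>\<^sup>+\<omega>. \<psi> j (x, X \<omega>) * indicator {z. subtree_ext \<alpha> z [] < x} (X \<omega>) \<partial>M)"
    and G[measurable]: "G \<in> borel_measurable marks_space"
    and G_cong: "\<And>Y Z. spine_Z \<alpha> Y = spine_Z \<alpha> Z \<Longrightarrow> spine_Theta \<alpha> Y = spine_Theta \<alpha> Z \<Longrightarrow>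
      spine_Delta \<alpha> Y = spine_Delta \<alpha> Z \<Longrightarrow> G Y = G Z"
  shows "(\<integral>\<^sup>+\<omega>. indicator {Y. sides_positive J Y} (X \<omega>) * G (X \<omega>) * (\<Prod>j\<in>J. \<phi> j (side_pair (X \<omega>)
      j)) \<partial>M) =
    (\<integral>\<^sup>+\<omega>. indicator {Y. sides_positive J Y} (X \<omega>) * G (X \<omega>) * (\<Prod>j\<in>J. \<psi> j (side_pair (X \<omega>) j)) \<partial>M)"
proof -
  \<comment> \<open>A generation so deep that all side nodes with index in \<open>J\<close> branch
    off before it. Each realisation has exactly one spine node in generation \<open>L\<close>, so
    summing over its nodes restores the full integral.\<close>
  define L where "L = Max (insert 0 (fst ` J))"
  have L: "n \<le> L" if "(n, m) \<in> J" for n m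
    unfolding L_def using J(1) that by (intro Max_ge) force+
  define H where "H \<theta> u \<omega> = indicator {Y. spine \<alpha> Y (length u) = u
      \<and> sides_positive J Y} (X \<omega>) * G (X \<omega>) *
      (\<Prod>j\<in>J. \<theta> j (side_pair (X \<omega>) j))" for \<theta> :: "nat \<times> nat \<Rightarrow> real \<times> marks \<Rightarrow> ennreal" and u \<omega>
  have split: "(\<integral>\<^sup>+\<omega>. indicator {Y. sides_positive J Y} (X \<omega>) * G (X \<omega>) * (\<Prod>j\<in>J. \<theta> j (side_pair (X
      \<omega>) j)) \<partial>M) =
      (\<integral>\<^sup>+u. \<integral>\<^sup>+\<omega>. H \<theta> u \<omega> \<partial>M \<partial>count_space {u. length u = L})"
    if \<theta>: "\<And>j. j \<in> J \<Longrightarrow> \<theta> j \<in> borel_measurable (borel \<Otimes>\<^sub>M marks_space)" for \<theta>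
  proof -
    have "(\<lambda>\<omega>. \<theta> j (side_pair (X \<omega>) j)) \<in> borel_measurable M" if "j \<in> J" for j
      by (rule measurable_compose[OF _ \<theta>[OF that]]) measurable
    then have prod: "(\<lambda>\<omega>. \<Prod>j\<in>J. \<theta> j (side_pair (X \<omega>) j)) \<in> borel_measurable M"
      by (rule borel_measurable_prod_ennreal)
    have H: "H \<theta> u \<in> borel_measurable M" for u
    proof -
      have "Measurable.pred marks_space (\<lambda>Y. spine \<alpha> Y (length u) = u \<and> sides_positive J Y)"
        using J(1) by measurable
      from measurable_compose[OF measurable_X this]
      have "Measurable.pred M (\<lambda>\<omega>. spine \<alpha> (X \<omega>) (length u) = u \<and> sides_positive J (X \<omega>))" .
      then show ?thesis unfolding H_def[abs_def] indicator_def mem_Collect_eq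
        using prod by measurable
    qed
    have "(\<integral>\<^sup>+u. H \<theta> u \<omega> \<partial>count_space {u. length u = L}) =
        indicator {Y. sides_positive J Y} (X \<omega>) * G (X \<omega>) * (\<Prod>j\<in>J. \<theta> j (side_pair (X \<omega>) j))" for \<omega>
    proof -
      have "(\<integral>\<^sup>+u. H \<theta> u \<omega> \<partial>count_space {u. length u = L}) = (\<Sum>u\<in>{spine \<alpha> (X \<omega>) L}. H \<theta> u \<omega>)"
        by (rule nn_integral_count_space') (auto simp: H_def)
      then show ?thesis by (simp add: H_def indicator_def)
    qed
    then show ?thesis
      by (subst nn_integral_count_space_nn_integral[symmetric]) (simp_all add: H)
  qed
  have "(\<integral>\<^sup>+\<omega>. H \<phi> u \<omega> \<partial>M) = (\<integral>\<^sup>+\<omega>. H \<psi> u \<omega> \<partial>M)" if "length u = L" for u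
  proof -
    have J': "\<And>n m. (n, m) \<in> J \<Longrightarrow> 1 \<le> n \<and> n \<le> length u" using J(2) L that by auto
    define Y where "Y \<omega> = keep (- below (sibling_node u ` J)) (X \<omega>)" for \<omega>
    define R where "R \<theta> = (\<integral>\<^sup>+\<omega>. indicator {Y. on_spine \<alpha> Y u
        \<and> sides_positive J Y} (Y \<omega>) * G (Y \<omega>) *
      (\<Prod>j\<in>J. \<integral>\<^sup>+\<omega>'. \<theta> j (side_span \<alpha> (Y \<omega>) (fst j) (snd j), X \<omega>') *
        indicator {z. subtree_ext \<alpha> z [] < side_span \<alpha> (Y \<omega>) (fst j) (snd j)} (X \<omega>') \<partial>M) \<partial>M)"
      for \<theta> :: "nat \<times> nat \<Rightarrow> real \<times> marks \<Rightarrow> ennreal"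
    have at: "(\<integral>\<^sup>+\<omega>. H \<theta> u \<omega> \<partial>M) = R \<theta>"
      if "\<And>j. j \<in> J \<Longrightarrow> \<theta> j \<in> borel_measurable (borel \<Otimes>\<^sub>M marks_space)" for \<theta>
      unfolding H_def R_def Y_def
    proof (rule side_identity_at)
      show "G Y = G Z" if "spine_Z \<alpha> Y = spine_Z \<alpha> Z" "spine_Theta \<alpha> Y = spine_Theta \<alpha> Z"
        "spine_Delta \<alpha> Y = spine_Delta \<alpha> Z" for Y Z using that by (rule G_cong)
      show "1 \<le> n \<and> n \<le> length u" if "(n, m) \<in> J" for n m using that by (rule J')
    qed (rule J(1) that G | assumption)+
    have "R \<phi> = R \<psi>"
      unfolding R_def by (intro nn_integral_cong arg_cong2[where f = "(*)"] prod.cong refl eq)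
    then show ?thesis using at[of \<phi>] at[of \<psi>] \<phi> \<psi> by simp
  qed
  then have "(\<integral>\<^sup>+u. \<integral>\<^sup>+\<omega>. H \<phi> u \<omega> \<partial>M \<partial>count_space {u. length u = L}) =
      (\<integral>\<^sup>+u. \<integral>\<^sup>+\<omega>. H \<psi> u \<omega> \<partial>M \<partial>count_space {u. length u = L})"
    by (rule nn_integral_cong) simp
  then show ?thesis using split[of \<phi>] split[of \<psi>] \<phi> \<psi> by simp
qed

end

text \<open>Preimages under \<open>f\<close> and \<open>g\<close> differ by a subset of a null set.
  This turns the functionals of the statement into random variables on the completed space.\<close>

lemma measurable_completion_AE:
  assumes g: "g \<in> measurable M N" and eq: "AE x in M. f x = g x" and f: "\<And>x. x \<in> space M
      \<Longrightarrow> f x \<in> space N"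
  shows "f \<in> measurable (completion M) N"
proof (rule measurableI)
  fix A assume A: "A \<in> sets N"
  show "f -` A \<inter> space (completion M) \<in> sets (completion M)"
  proof (rule completion.in_sets_AE)
    show "g -` A \<inter> space M \<in> sets (completion M)"
      using measurable_sets[OF g A] by (rule sets_completionI_sets)
    show "AE x in completion M. (x \<in> g -` A \<inter> space M) = (x \<in> f -` A \<inter> space (completion M))"
      using AE_completion[OF eq] by eventually_elim simp
  qed auto
qed (use f in simp)

lemma emeasure_completion_eq: "A \<in> sets M \<Longrightarrow> emeasure (completion M) A = emeasure M A"
  by (simp add: emeasure_completion)

section \<open>Laws conditioned on extinction before a threshold\<close>

context fragmentation
begin

definition span_prob :: "real \<Rightarrow> (real \<Rightarrow> nat \<Rightarrow> real) set \<Rightarrow> ennreal" where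
  "span_prob x A = emeasure M {\<omega> \<in> space M. subtree_ext \<alpha> (X \<omega>) [] < x \<and> rev_path \<alpha> x (X \<omega>) \<in> A}"

text \<open>Elementary conditional probability. When extinction before \<open>x\<close> has
  probability 0, the quotient is 0, in agreement with \<open>uniform_measure\<close>.\<close>

definition cond_law :: "real \<Rightarrow> (real \<Rightarrow> nat \<Rightarrow> real) set \<Rightarrow> ennreal" where
  "cond_law x A = span_prob x A / span_prob x (space path_space)"

lemma measurable_life [measurable]: "(\<lambda>\<omega>. subtree_ext \<alpha> (X \<omega>) []) \<in> borel_measurable M"
  by (rule measurable_compose[OF measurable_X measurable_subtree_ext])

lemma measurable_rev_path_X: "(\<lambda>\<omega>. rev_path \<alpha> x (X \<omega>)) \<in> measurable M path_space"
  by (rule measurable_rev_path) auto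

lemma span_prob_event [measurable]:
  assumes "A \<in> sets path_space"
  shows "{\<omega> \<in> space M. subtree_ext \<alpha> (X \<omega>) [] < x \<and> rev_path \<alpha> x (X \<omega>) \<in> A} \<in> sets M"
proof -
  have "{\<omega> \<in> space M. rev_path \<alpha> x (X \<omega>) \<in> A} \<in> sets M"
    using measurable_sets[OF measurable_rev_path_X assms]
        by (simp add: vimage_def Int_def conj_commute)
  then show ?thesis by measurable
qed

lemma span_prob_space: "span_prob x (space path_space)
    = emeasure M {\<omega> \<in> space M. subtree_ext \<alpha> (X \<omega>) [] < x}"
  unfolding span_prob_def using measurable_space[OF measurable_rev_path_X]
      by (intro arg_cong[where f = "emeasure M"]) auto

lemma span_prob_le: "A \<in> sets path_space \<Longrightarrow> span_prob x A \<le> span_prob x (space path_space)"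
  unfolding span_prob_space unfolding span_prob_def by (intro emeasure_mono) auto

lemma cond_law_mult:
  assumes "A \<in> sets path_space"
  shows "cond_law x A * span_prob x (space path_space) = span_prob x A"
proof (cases "span_prob x (space path_space) = 0")
  case True
  then show ?thesis using span_prob_le[OF assms, of x] by simp
next
  case False
  have "span_prob x (space path_space) \<noteq> \<infinity>" unfolding span_prob_def by simp
  then show ?thesis using False
      by (simp add: cond_law_def ennreal_divide_times ennreal_divide_self less_top)
qed

lemma cond_law_le_1:
  assumes "A \<in> sets path_space"
  shows "cond_law x A \<le> 1"
proof (cases "span_prob x (space path_space) = 0")
  case True
  then show ?thesis using span_prob_le[OF assms, of x] by (simp add: cond_law_def)
next
  case False
  then show ?thesis using span_prob_le[OF assms, of x]
    unfolding cond_law_def by (intro divide_le_posI_ennreal) (auto simp: zero_less_iff_neq_zero)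
qed

text \<open>The event is the section at \<open>x\<close> of a jointly measurable set; dependence on
  \<open>x\<close> matters because random thresholds will be inserted.\<close>

lemma measurable_span_prob:
  assumes "A \<in> sets path_space"
  shows "(\<lambda>x. span_prob x A) \<in> borel_measurable borel"
proof -
  have X: "(\<lambda>p. X (snd p)) \<in> measurable (borel \<Otimes>\<^sub>M M) marks_space" by measurable
  have "(\<lambda>p. rev_path \<alpha> (fst p) (X (snd p))) \<in> measurable (borel \<Otimes>\<^sub>M M) path_space"
    by (rule measurable_rev_path[OF X]) simp
  from measurable_sets[OF this assms]
  have "{p \<in> space (borel \<Otimes>\<^sub>M M). rev_path \<alpha> (fst p) (X (snd p)) \<in> A} \<in> sets (borel \<Otimes>\<^sub>M M)"
    by (simp add: vimage_def Int_def conj_commute)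
  then have "{p \<in> space (borel \<Otimes>\<^sub>M M). subtree_ext \<alpha> (X (snd p)) [] < fst p
      \<and> rev_path \<alpha> (fst p) (X (snd p)) \<in> A}
      \<in> sets (borel \<Otimes>\<^sub>M M)" (is "?Q \<in> _")
    by measurable
  then have "(\<lambda>x. emeasure M (Pair x -` ?Q)) \<in> borel_measurable borel"
    by (rule measurable_emeasure_Pair)
  moreover have "Pair x -` ?Q = {\<omega> \<in> space M. subtree_ext \<alpha> (X \<omega>) [] < x
      \<and> rev_path \<alpha> x (X \<omega>) \<in> A}" for x
    by (auto simp: space_pair_measure)
  ultimately show ?thesis by (simp add: span_prob_def)
qed

lemma measurable_cond_law:
  assumes "A \<in> sets path_space"
  shows "(\<lambda>x. cond_law x A) \<in> borel_measurable borel"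
  unfolding cond_law_def
  by (intro borel_measurable_divide_ennreal measurable_span_prob assms sets.top)

text \<open>Here \<open>\<phi>\<close> is the indicator of the path event and \<open>\<psi>\<close>
  the conditional law, which does not depend on the side subtree. Both integrate to
  \<open>span_prob\<close> over extinction before \<open>x\<close>, so \<open>side_identity\<close>
  exchanges them.\<close>

lemma side_path_identity:
  assumes J: "finite J" "\<And>n m. (n, m) \<in> J \<Longrightarrow> 1 \<le> n"
    and A: "\<And>j. j \<in> J \<Longrightarrow> A j \<in> sets path_space"
    and G: "G \<in> borel_measurable marks_space"
    and G_cong: "\<And>Y Z. spine_Z \<alpha> Y = spine_Z \<alpha> Z \<Longrightarrow> spine_Theta \<alpha> Y = spine_Theta \<alpha> Z \<Longrightarrow>
      spine_Delta \<alpha> Y = spine_Delta \<alpha> Z \<Longrightarrow> G Y = G Z"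
  shows "(\<integral>\<^sup>+\<omega>. indicator {Y. sides_positive J Y} (X \<omega>) * G (X \<omega>) *
      (\<Prod>j\<in>J. indicator (A j) (side_path \<alpha> (X \<omega>) (fst j) (snd j))) \<partial>M) =
    (\<integral>\<^sup>+\<omega>. indicator {Y. sides_positive J Y} (X \<omega>) * G (X \<omega>) *
      (\<Prod>j\<in>J. cond_law (side_span \<alpha> (X \<omega>) (fst j) (snd j)) (A j)) \<partial>M)"
proof -
  define \<phi> where "\<phi> j p = (indicator (A j) (rev_path \<alpha> (fst p) (snd p)) :: ennreal)" for j ::
      "nat \<times> nat" and p
  define \<psi> where "\<psi> j p = cond_law (fst p) (A j)" for j :: "nat \<times> nat" and p :: "real \<times> marks"
  have "(\<integral>\<^sup>+\<omega>. indicator {Y. sides_positive J Y} (X \<omega>) * G (X \<omega>) * (\<Prod>j\<in>J. \<phi> j (side_pair (X \<omega>) j))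
      \<partial>M) =
    (\<integral>\<^sup>+\<omega>. indicator {Y. sides_positive J Y} (X \<omega>) * G (X \<omega>) * (\<Prod>j\<in>J. \<psi> j (side_pair (X \<omega>) j)) \<partial>M)"
  proof (rule side_identity)
    show "G Y = G Z" if "spine_Z \<alpha> Y = spine_Z \<alpha> Z" "spine_Theta \<alpha> Y = spine_Theta \<alpha> Z"
      "spine_Delta \<alpha> Y = spine_Delta \<alpha> Z" for Y Z using that by (rule G_cong)
    show "\<phi> j \<in> borel_measurable (borel \<Otimes>\<^sub>M marks_space)" if "j \<in> J" for j
      unfolding \<phi>_def[abs_def]
      by (rule measurable_compose[OF measurable_rev_path borel_measurable_indicator[OF A[OF
          that]]]) auto
    show "\<psi> j \<in> borel_measurable (borel \<Otimes>\<^sub>M marks_space)" if "j \<in> J" for j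
      unfolding \<psi>_def[abs_def]
          by (rule measurable_compose[OF measurable_fst measurable_cond_law[OF A[OF that]]])
    fix j x assume j: "j \<in> J"
    have "(\<integral>\<^sup>+\<omega>. \<phi> j (x, X \<omega>) * indicator {z. subtree_ext \<alpha> z [] < x} (X \<omega>) \<partial>M) =
        (\<integral>\<^sup>+\<omega>. indicator {\<omega> \<in> space M. subtree_ext \<alpha> (X \<omega>) [] < x \<and> rev_path \<alpha> x (X \<omega>) \<in> A j} \<omega> \<partial>M)"
      by (rule nn_integral_cong) (auto simp: \<phi>_def indicator_def)
    also have "\<dots> = span_prob x (A j)"
      unfolding span_prob_def by (rule nn_integral_indicator[OF span_prob_event[OF A[OF j]]])
    also have "\<dots> = cond_law x (A j) * span_prob x (space path_space)"
      using cond_law_mult[OF A[OF j]] by simp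
    also have "\<dots> = cond_law x (A j) * (\<integral>\<^sup>+\<omega>. indicator {\<omega> \<in> space M. subtree_ext \<alpha> (X \<omega>) [] < x} \<omega>
        \<partial>M)"
      unfolding span_prob_space by (subst nn_integral_indicator) measurable
    also have "\<dots> = (\<integral>\<^sup>+\<omega>. cond_law x (A j) * indicator {\<omega> \<in> space M. subtree_ext \<alpha> (X \<omega>) [] < x} \<omega>
        \<partial>M)"
      by (rule nn_integral_cmult[symmetric]) measurable
    also have "\<dots> = (\<integral>\<^sup>+\<omega>. \<psi> j (x, X \<omega>) * indicator {z. subtree_ext \<alpha> z [] < x} (X \<omega>) \<partial>M)"
      by (rule nn_integral_cong) (simp add: \<psi>_def indicator_def)
    finally show "(\<integral>\<^sup>+\<omega>. \<phi> j (x, X \<omega>) * indicator {z. subtree_ext \<alpha> z [] < x} (X \<omega>) \<partial>M) =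
      (\<integral>\<^sup>+\<omega>. \<psi> j (x, X \<omega>) * indicator {z. subtree_ext \<alpha> z [] < x} (X \<omega>) \<partial>M)" .
  qed (use J G in auto)
  then show ?thesis by (simp add: \<phi>_def \<psi>_def side_pair_def side_path_def)
qed

abbreviation "P \<equiv> completion M"

lemma prob_P: "prob_space P"
  by (rule prob_spaceI) (simp add: emeasure_completion_eq emeasure_space_1)

lemma AE_good_P: "AE \<omega> in P. good_marks \<alpha> (X \<omega>)"
  using AE_good by (rule AE_completion)

lemma AE_ext_time: "AE \<omega> in M. ext_time \<alpha> (X \<omega>) = subtree_ext \<alpha> (X \<omega>) []"
  using AE_good by eventually_elim (auto simp: good_marks_def bounded_marks.ext_time_eq)

text \<open>\<open>ext_time\<close> in the conditioning event may be replaced by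
  \<open>subtree_ext\<close> at the root, as the two agree almost surely.\<close>

lemma emeasure_rev_cond_law:
  assumes A: "A \<in> sets path_space"
  shows "emeasure (rev_cond_law P \<alpha> X x) A = cond_law x A"
proof -
  define S where "S = {\<omega> \<in> space P. ext_time \<alpha> (X \<omega>) < x}"
  have ext: "(\<lambda>\<omega>. ext_time \<alpha> (X \<omega>)) \<in> borel_measurable P"
    by (rule measurable_completion_AE[OF measurable_life AE_ext_time]) simp
  then have S: "S \<in> sets P" unfolding S_def by measurable
  have f: "(\<lambda>\<omega>. rev_path \<alpha> x (X \<omega>)) \<in> measurable P path_space"
    by (rule measurable_completion[OF measurable_rev_path_X])
  have "emeasure (rev_cond_law P \<alpha> X x) A =
      emeasure (uniform_measure P S) ((\<lambda>\<omega>. rev_path \<alpha> x (X \<omega>)) -` A \<inter> space P)"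
    unfolding rev_cond_law_def S_def[symmetric] rev_path_def[symmetric]
    using f A by (subst emeasure_distr) (auto simp: measurable_def)
  also have "\<dots> = emeasure P (S \<inter> ((\<lambda>\<omega>. rev_path \<alpha> x (X \<omega>)) -` A \<inter> space P)) / emeasure P S"
    by (rule emeasure_uniform_measure[OF S measurable_sets[OF f A]])
  also have "emeasure P (S \<inter> ((\<lambda>\<omega>. rev_path \<alpha> x (X \<omega>)) -` A \<inter> space P)) = span_prob x A"
    unfolding span_prob_def emeasure_completion_eq[OF span_prob_event[OF A], symmetric]
  proof (rule emeasure_eq_AE)
    show "AE \<omega> in P. (\<omega> \<in> S \<inter> ((\<lambda>\<omega>. rev_path \<alpha> x (X \<omega>)) -` A \<inter> space P)) =
      (\<omega> \<in> {\<omega> \<in> space M. subtree_ext \<alpha> (X \<omega>) [] < x \<and> rev_path \<alpha> x (X \<omega>) \<in> A})"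
      using AE_completion[OF AE_ext_time] by eventually_elim (auto simp: S_def)
    show "S \<inter> ((\<lambda>\<omega>. rev_path \<alpha> x (X \<omega>)) -` A \<inter> space P) \<in> sets P" using S measurable_sets[OF f A]
        by blast
    show "{\<omega> \<in> space M. subtree_ext \<alpha> (X \<omega>) [] < x \<and> rev_path \<alpha> x (X \<omega>) \<in> A} \<in> sets P"
      by (rule sets_completionI_sets[OF span_prob_event[OF A]])
  qed
  also have "emeasure P S = span_prob x (space path_space)"
    unfolding span_prob_space
  proof -
    have *: "{\<omega> \<in> space M. subtree_ext \<alpha> (X \<omega>) [] < x} \<in> sets M" by measurable
    show "emeasure P S = emeasure M {\<omega> \<in> space M. subtree_ext \<alpha> (X \<omega>) [] < x}"
      unfolding emeasure_completion_eq[OF *, symmetric]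
    proof (rule emeasure_eq_AE)
      show "AE \<omega> in P. (\<omega> \<in> S) = (\<omega> \<in> {\<omega> \<in> space M. subtree_ext \<alpha> (X \<omega>) [] < x})"
        using AE_completion[OF AE_ext_time] by eventually_elim (auto simp: S_def)
    qed (use S * in \<open>auto intro: sets_completionI_sets\<close>)
  qed
  finally show ?thesis by (simp add: cond_law_def)
qed

definition data_space :: "(nat \<Rightarrow> real \<times> real \<times> (nat \<Rightarrow> real)) measure" where
  "data_space = (\<Pi>\<^sub>M n \<in> UNIV. borel \<Otimes>\<^sub>M (borel \<Otimes>\<^sub>M seq_borel))"

definition marks_data :: "marks \<Rightarrow> nat \<Rightarrow> real \<times> real \<times> (nat \<Rightarrow> real)" where
  "marks_data Y = (\<lambda>n. (spine_Z \<alpha> Y n, spine_Theta \<alpha> Y n, spine_Delta \<alpha> Y n))"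

definition spine_data :: "'a \<Rightarrow> nat \<Rightarrow> real \<times> real \<times> (nat \<Rightarrow> real)" where
  "spine_data \<omega> = (\<lambda>n. (Zn \<alpha> (X \<omega>) n, Theta \<alpha> (X \<omega>) n, Delta \<alpha> (X \<omega>) n))"

lemma measurable_marks_data: "marks_data \<in> measurable marks_space data_space"
  unfolding marks_data_def data_space_def by (rule measurable_abs_UNIV) measurable

lemma spine_data_eq: "good_marks \<alpha> (X \<omega>) \<Longrightarrow> spine_data \<omega> = marks_data (X \<omega>)"
  by (simp add: spine_data_def marks_data_def good_marks.Zn_eq good_marks.Theta_eq
      good_marks.Delta_eq)

lemma spine_data_space: "spine_data \<omega> \<in> space data_space"
proof -
  have "Delta \<alpha> (X \<omega>) n \<in> mass_seqs" for n by (simp add: Delta_def Let_def)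
  then show ?thesis
    by (auto simp: spine_data_def data_space_def space_PiM space_pair_measure space_seq_borel)
qed

lemma measurable_spine_data: "spine_data \<in> measurable P data_space"
proof (rule measurable_completion_AE)
  show "(\<lambda>\<omega>. marks_data (X \<omega>)) \<in> measurable M data_space"
    by (rule measurable_compose[OF measurable_X measurable_marks_data])
  show "AE \<omega> in M. spine_data \<omega> = marks_data (X \<omega>)"
    using AE_good by eventually_elim (rule spine_data_eq)
qed (rule spine_data_space)

lemma spine_algebra_eq: "spine_algebra P \<alpha> X = vimage_algebra (space P) spine_data data_space"
  unfolding spine_algebra_def spine_data_def[abs_def] data_space_def ..

lemma sets_spine_algebra: "sets (spine_algebra P \<alpha> X)
    = {spine_data -` B \<inter> space P | B. B \<in> sets data_space}"
  unfolding spine_algebra_eq using spine_data_space by (intro sets_vimage_algebra2) auto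

lemma subalgebra_spine: "subalgebra P (spine_algebra P \<alpha> X)"
  unfolding subalgebra_def sets_spine_algebra using measurable_sets[OF measurable_spine_data]
  by (auto simp: spine_algebra_eq)

lemma measurable_spine_algebra: "spine_data \<in> measurable (spine_algebra P \<alpha> X) data_space"
  unfolding spine_algebra_eq using spine_data_space by (intro measurable_vimage_algebra1) auto

end

section \<open>Conditional independence given the spine data\<close>

context fragmentation
begin

definition data_mass :: "(nat \<Rightarrow> real \<times> real \<times> (nat \<Rightarrow> real)) \<Rightarrow> nat \<Rightarrow> real" where
  "data_mass d n = (\<Prod>k = 0..n. fst (snd (d k)))"

text \<open>Multiplying \<open>Zn\<close> by the mass to the power \<open>- \<alpha>\<close> gives
  the time left until extinction, and the mass is the product of the \<open>Theta\<close>. So the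
  random index \<open>N_int\<close> is a function of the data.\<close>

definition data_N :: "real \<Rightarrow> (nat \<Rightarrow> real \<times> real \<times> (nat \<Rightarrow> real)) \<Rightarrow> nat" where
  "data_N \<epsilon> d = (LEAST n. fst (d (Suc n)) * data_mass d (Suc n) powr (- \<alpha>) < \<epsilon>)"

definition data_span :: "(nat \<Rightarrow> real \<times> real \<times> (nat \<Rightarrow> real)) \<Rightarrow> nat \<times> nat \<Rightarrow> real" where
  "data_span d j =
     snd (snd (d (fst j))) (snd j) powr \<alpha> * fst (snd (d (fst j))) powr (- \<alpha>) * fst (d (fst j))"

lemma measurable_data [measurable]:
  "(\<lambda>d. fst (d n)) \<in> borel_measurable data_space"
  "(\<lambda>d. fst (snd (d n))) \<in> borel_measurable data_space"
  "(\<lambda>d. snd (snd (d n)) m) \<in> borel_measurable data_space"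
proof -
  have d: "(\<lambda>d. d n) \<in> measurable data_space (borel \<Otimes>\<^sub>M (borel \<Otimes>\<^sub>M seq_borel))"
    unfolding data_space_def by (rule measurable_component_singleton) simp
  show "(\<lambda>d. fst (d n)) \<in> borel_measurable data_space" using d by measurable
  show "(\<lambda>d. fst (snd (d n))) \<in> borel_measurable data_space" using d by measurable
  have "(\<lambda>d. snd (snd (d n))) \<in> measurable data_space seq_borel" using d by measurable
  from measurable_compose[OF this measurable_seq_borel_component]
  show "(\<lambda>d. snd (snd (d n)) m) \<in> borel_measurable data_space" .
qed

lemma measurable_data_N [measurable]: "data_N \<epsilon> \<in> measurable data_space (count_space UNIV)"
  unfolding data_N_def data_mass_def by measurable

lemma measurable_data_span [measurable]: "(\<lambda>d. data_span d j) \<in> borel_measurable data_space"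
  unfolding data_span_def by measurable

lemma data_of_good:
  assumes "good_marks \<alpha> (X \<omega>)"
  shows "data_N \<epsilon> (spine_data \<omega>) = spine_N \<alpha> \<epsilon> (X \<omega>)" "data_span (spine_data \<omega>) j
      = side_span \<alpha> (X \<omega>) (fst j) (snd j)"
proof -
  interpret good_marks \<alpha> "X \<omega>" by fact
  have "data_mass (spine_data \<omega>) n = mass (X \<omega>) (sp n)" for n
    by (simp add: data_mass_def spine_data_def prod_Theta)
  moreover have "fst (spine_data \<omega> n) * mass (X \<omega>) (sp n) powr (- \<alpha>) = \<zeta> - T n" for n
    using mass_spine_pos[of n] by (simp add: spine_data_def Zn_eq spine_Z_def powr_minus)
  ultimately show "data_N \<epsilon> (spine_data \<omega>) = spine_N \<alpha> \<epsilon> (X \<omega>)"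
    by (simp only: data_N_def spine_N_def)
  show "data_span (spine_data \<omega>) j = side_span \<alpha> (X \<omega>) (fst j) (snd j)"
    by (simp add: data_span_def spine_data_def side_span_def Zn_eq Theta_eq Delta_eq)
qed

lemma N_int_of_good:
  assumes "good_marks \<alpha> (X \<omega>)" "0 < \<epsilon>"
  shows "N_int \<alpha> \<epsilon> (X \<omega>) = int (data_N \<epsilon> (spine_data \<omega>))"
  using data_of_good(1)[OF assms(1)] good_marks.N_int_eq[OF assms] by simp

definition side_process :: "real \<Rightarrow> int \<times> nat \<Rightarrow> 'a \<Rightarrow> real \<Rightarrow> nat \<Rightarrow> real" where
  "side_process \<epsilon> j \<omega> = side_path \<alpha> (X \<omega>) (nat (N_int \<alpha> \<epsilon> (X \<omega>) + fst j)) (snd j)"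

lemma measurable_side_process:
  assumes "0 < \<epsilon>"
  shows "side_process \<epsilon> j \<in> measurable P path_space"
proof -
  have "(\<lambda>\<omega>. N_int \<alpha> \<epsilon> (X \<omega>)) \<in> measurable P (count_space UNIV)"
  proof (rule measurable_completion_AE)
    have "(\<lambda>\<omega>. data_N \<epsilon> (marks_data (X \<omega>))) \<in> measurable M (count_space UNIV)"
      by (rule measurable_compose[OF measurable_compose[OF measurable_X measurable_marks_data]
          measurable_data_N])
    then show "(\<lambda>\<omega>. int (data_N \<epsilon> (marks_data (X \<omega>)))) \<in> measurable M (count_space UNIV)"
      by (rule measurable_compose) simp
    show "AE \<omega> in M. N_int \<alpha> \<epsilon> (X \<omega>) = int (data_N \<epsilon> (marks_data (X \<omega>)))"
      using AE_good by eventually_elim (simp add: N_int_of_good assms spine_data_eq)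
  qed simp
  moreover have "(\<lambda>\<omega>. side_path \<alpha> (X \<omega>) (nat (k + fst j)) (snd j)) \<in> measurable P path_space" for k
    by (rule measurable_completion[OF measurable_compose[OF measurable_X measurable_side_path]])
  ultimately show ?thesis
    unfolding side_process_def[abs_def] by (rule measurable_compose_countable[rotated])
qed

text \<open>As \<open>N_int\<close> is determined by the data, one may work on each event
  \<open>N_int = n0\<close>, where the index \<open>(i, m)\<close> designates the fixed side node
  \<open>(n0 + i, m)\<close>. There the conditional probability is identified by integrating over
  the sets of the spine algebra, to which \<open>side_path_identity\<close> applies.\<close>

lemma cond_indep_side_process:
  assumes \<epsilon>: "0 < \<epsilon>"
  shows "cond_indep_with_laws P (spine_algebra P \<alpha> X) path_space
     (\<lambda>\<omega>. {(i, m). \<epsilon> \<le> ext_time \<alpha> (X \<omega>) \<and> - N_int \<alpha> \<epsilon> (X \<omega>) + 1 \<le> i \<and>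
             Delta \<alpha> (X \<omega>) (nat (N_int \<alpha> \<epsilon> (X \<omega>) + i)) m > 0})
     (side_process \<epsilon>)
     (\<lambda>(i, m) \<omega>. let n = nat (N_int \<alpha> \<epsilon> (X \<omega>) + i) in
        rev_cond_law P \<alpha> X
          (Delta \<alpha> (X \<omega>) n m powr \<alpha> * Theta \<alpha> (X \<omega>) n powr (- \<alpha>) * Zn \<alpha> (X \<omega>) n))"
    (is "cond_indep_with_laws P ?\<G> path_space ?act _ ?\<kappa>")
  unfolding cond_indep_with_laws_def
proof (intro conjI allI impI)
  show "subalgebra P ?\<G>" by (rule subalgebra_spine)
  show "side_process \<epsilon> j \<in> measurable P path_space" for j by (rule measurable_side_process[OF \<epsilon>])
next
  fix J :: "(int \<times> nat) set" and A :: "int \<times> nat \<Rightarrow> (real \<Rightarrow> nat \<Rightarrow> real) set"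
  assume J: "finite J" and "\<forall>j\<in>J. A j \<in> sets path_space"
  then have A: "A j \<in> sets path_space" if "j \<in> J" for j using that by blast
  interpret P: prob_space P by (rule prob_P)
  interpret G: finite_measure_subalgebra P ?\<G>
    by unfold_locales (rule subalgebra_spine)
  define Ev where "Ev = {\<omega> \<in> space P. \<forall>j\<in>J. side_process \<epsilon> j \<omega> \<in> A j}"
  have Ev: "Ev \<in> sets P"
    unfolding Ev_def using J measurable_sets[OF measurable_side_process[OF \<epsilon>] A]
    by (intro sets.sets_Collect_finite_All) (auto simp: vimage_def Int_def conj_commute)
  have measure_\<kappa>: "measure (?\<kappa> j \<omega>) (A j) =
      enn2real (cond_law (data_span (spine_data \<omega>) (nat (N_int \<alpha> \<epsilon> (X \<omega>) + fst j), snd j)) (A j))"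
    if "j \<in> J" for j \<omega>
    using emeasure_rev_cond_law[OF A[OF that]]
    by (simp add: measure_def Let_def data_span_def spine_data_def case_prod_beta)
  have "AE \<omega> in P. N_int \<alpha> \<epsilon> (X \<omega>) = int n0 \<longrightarrow> J \<subseteq> ?act \<omega> \<longrightarrow>
      real_cond_exp P ?\<G> (indicator Ev) \<omega> = (\<Prod>j\<in>J. measure (?\<kappa> j \<omega>) (A j))" for n0
  proof (cases "\<forall>j\<in>J. 1 \<le> int n0 + fst j")
    case False
    \<comment> \<open>An index with \<open>n0 + i < 1\<close> violates the lower bound on active
      indices, so the premise \<open>J \<subseteq> ?act \<omega>\<close> fails.\<close>
    then show ?thesis by (intro AE_I2) force
  next
    case True
    define \<sigma> where "\<sigma> j = (nat (int n0 + fst j), snd j)" for j :: "int \<times> nat"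
    define \<tau> where "\<tau> j = (int (fst j) - int n0, snd j)" for j :: "nat \<times> nat"
    have \<tau>\<sigma>: "\<tau> (\<sigma> j) = j" if "j \<in> J" for j using True that by (auto simp: \<sigma>_def \<tau>_def prod_eq_iff)
    have inj: "inj_on \<sigma> J" by (rule inj_on_inverseI[of _ \<tau>]) (rule \<tau>\<sigma>)
    have J1: "1 \<le> n" if "(n, m) \<in> \<sigma> ` J" for n m using that True by (auto simp: \<sigma>_def)
    \<comment> \<open>The event that \<open>N_int = n0\<close> and that all side nodes of
      \<open>J\<close> have positive mass, expressed through the data; its preimage \<open>C\<close>
      thus belongs to the spine algebra.\<close>
    define B0 where "B0 = {d \<in> space data_space. data_N \<epsilon> d = n0 \<and>
      (\<forall>j\<in>\<sigma> ` J. 0 < snd (snd (d (fst j))) (snd j))}"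
    have B0: "B0 \<in> sets data_space"
    proof -
      have "countable (\<sigma> ` J)" using J by (intro countable_finite) simp
      then show ?thesis unfolding B0_def by measurable
    qed
    define C where "C = spine_data -` B0 \<inter> space P"
    have C: "C \<in> sets ?\<G>" using B0 by (auto simp: C_def sets_spine_algebra)
    then have C': "C \<in> sets P" using subalgebra_spine by (auto simp: subalgebra_def)
    have good_C: "\<omega> \<in> C \<longleftrightarrow> N_int \<alpha> \<epsilon> (X \<omega>) = int n0 \<and> sides_positive (\<sigma> ` J) (X \<omega>)"
      if "good_marks \<alpha> (X \<omega>)" "\<omega> \<in> space M" for \<omega>
    proof -
      interpret good_marks \<alpha> "X \<omega>" by fact
      have "snd (snd (spine_data \<omega> n)) m = spine_Delta \<alpha> (X \<omega>) n m" for n m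
        by (simp add: spine_data_def Delta_eq)
      then show ?thesis
        using that(2) spine_data_space[of \<omega>]
        unfolding C_def B0_def sides_positive_def
        by (auto simp: N_int_of_good[OF that(1) \<epsilon>])
    qed
    define c where "c \<omega> j = cond_law (data_span (spine_data \<omega>) (\<sigma> j)) (A j)" for \<omega> j
    have c_real: "ennreal (enn2real (c \<omega> j)) = c \<omega> j" "enn2real (c \<omega> j) \<le> 1" if "j \<in> J" for \<omega> j
    proof -
      have "c \<omega> j \<le> 1" unfolding c_def by (rule cond_law_le_1[OF A[OF that]])
      then show "ennreal (enn2real (c \<omega> j)) = c \<omega> j" "enn2real (c \<omega> j) \<le> 1"
        by (auto intro!: ennreal_enn2real enn2real_leI simp: less_le_trans[OF _ _]
            le_less_trans[OF _ ennreal_one_less_top])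
    qed
    \<comment> \<open>The candidate for the conditional expectation of \<open>f\<close> below: the
      conditional laws at thresholds that are functions of the data, restricted to
      \<open>C\<close>.\<close>
    define g where "g \<omega> = indicator C \<omega> * (\<Prod>j\<in>J. enn2real (c \<omega> j))" for \<omega>
    have g_meas: "g \<in> borel_measurable ?\<G>"
    proof -
      have "(\<lambda>\<omega>. c \<omega> j) \<in> borel_measurable ?\<G>" if "j \<in> J" for j
        unfolding c_def
        by (rule measurable_compose[OF measurable_compose[OF measurable_spine_algebra
            measurable_data_span]
              measurable_cond_law[OF A[OF that]]])
      then have "(\<lambda>\<omega>. enn2real (c \<omega> j)) \<in> borel_measurable ?\<G>" if "j \<in> J" for j
        using that by (intro borel_measurable_enn2real) auto
      then show ?thesis unfolding g_def[abs_def] using C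
        by (intro borel_measurable_times borel_measurable_prod borel_measurable_indicator)
    qed
    have g_meas': "g \<in> borel_measurable P"
        by (rule measurable_from_subalg[OF subalgebra_spine g_meas])
    have g_bounds: "0 \<le> g \<omega>" "g \<omega> \<le> 1" for \<omega>
    proof -
      show "0 \<le> g \<omega>" by (auto simp: g_def intro!: mult_nonneg_nonneg prod_nonneg)
      have "(\<Prod>j\<in>J. enn2real (c \<omega> j)) \<le> 1" using c_real(2) by (intro prod_le_1) auto
      then show "g \<omega> \<le> 1" by (auto simp: g_def indicator_def)
    qed
    define f where "f \<omega> = (indicator C \<omega> * indicator Ev \<omega> :: real)" for \<omega>
    have f_meas: "f \<in> borel_measurable P" unfolding f_def[abs_def] using C' Ev by measurable
    have f_bounds: "0 \<le> f \<omega>" "f \<omega> \<le> 1" for \<omega> by (auto simp: f_def indicator_def)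
    have int: "integrable P f" "integrable P g"
      using f_bounds g_bounds f_meas g_meas' by (auto intro!: P.integrable_const_bound[where B = 1])
    have key: "(\<integral>\<^sup>+\<omega>. ennreal (indicator S \<omega> * f \<omega>) \<partial>P) = (\<integral>\<^sup>+\<omega>. ennreal (indicator S \<omega> * g \<omega>) \<partial>P)"
      if S: "S \<in> sets ?\<G>" for S
    proof -
      obtain B where B: "B \<in> sets data_space" "S = spine_data -` B \<inter> space P"
        using S by (auto simp: sets_spine_algebra)
      \<comment> \<open>Membership in \<open>S\<close> and in \<open>C\<close> depends on the data
        alone, so \<open>H\<close> can serve as the test function \<open>G\<close> of
        \<open>side_path_identity\<close>.\<close>
      define H where "H Y = (indicator (B \<inter> B0) (marks_data Y) :: ennreal)" for Y
      have H: "H \<in> borel_measurable marks_space"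
        unfolding H_def[abs_def] using B(1) B0
        by (intro measurable_compose[OF measurable_marks_data] borel_measurable_indicator) auto
      have "(\<integral>\<^sup>+\<omega>. ennreal (indicator S \<omega> * f \<omega>) \<partial>M) =
        (\<integral>\<^sup>+\<omega>. indicator {Y. sides_positive (\<sigma> ` J) Y} (X \<omega>) * H (X \<omega>) *
          (\<Prod>j\<in>\<sigma> ` J. indicator (A (\<tau> j)) (side_path \<alpha> (X \<omega>) (fst j) (snd j))) \<partial>M)"
      proof (rule nn_integral_cong_AE)
        show "AE \<omega> in M. ennreal (indicator S \<omega> * f \<omega>)
            = indicator {Y. sides_positive (\<sigma> ` J) Y} (X \<omega>) * H (X \<omega>) *
          (\<Prod>j\<in>\<sigma> ` J. indicator (A (\<tau> j)) (side_path \<alpha> (X \<omega>) (fst j) (snd j)))"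
          using AE_good AE_space
        proof eventually_elim
          case (elim \<omega>)
          note data = spine_data_eq[OF elim(1)]
          show ?case
          proof (cases "\<omega> \<in> S \<inter> C")
            case True
            then have N: "N_int \<alpha> \<epsilon> (X \<omega>) = int n0" "sides_positive (\<sigma> ` J) (X \<omega>)"
              using good_C[OF elim] by auto
            have side: "side_path \<alpha> (X \<omega>) (fst (\<sigma> j)) (snd (\<sigma> j)) = side_process \<epsilon> j \<omega>" for j
              by (simp add: side_process_def \<sigma>_def N)
            have "(\<Prod>j\<in>\<sigma> ` J. indicator (A (\<tau> j)) (side_path \<alpha> (X \<omega>) (fst j) (snd j))) =
                (\<Prod>j\<in>J. indicator (A j) (side_process \<epsilon> j \<omega>) :: ennreal)"
              by (subst prod.reindex[OF inj]) (simp add: \<tau>\<sigma> side)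
            also have "\<dots> = indicator Ev \<omega>"
            proof (cases "\<omega> \<in> Ev")
              case True
              then show ?thesis by (simp add: Ev_def)
            next
              case False
              then obtain j where "j \<in> J" "side_process \<epsilon> j \<omega> \<notin> A j"
                using elim(2) by (auto simp: Ev_def)
              then have "\<exists>j\<in>J. (indicator (A j) (side_process \<epsilon> j \<omega>) :: ennreal) = 0"
                by (intro bexI[of _ j]) simp_all
              then show ?thesis using False J prod_zero[OF J] by simp
            qed
            finally show ?thesis
              using True N by (simp add: f_def H_def B C_def data ennreal_indicator[symmetric])
          next
            case False
            then show ?thesis using elim(2) by (auto simp: f_def H_def B C_def data indicator_def)
          qed
        qed
      qed
      also have "\<dots> = (\<integral>\<^sup>+\<omega>. indicator {Y. sides_positive (\<sigma> ` J) Y} (X \<omega>) * H (X \<omega>) *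
          (\<Prod>j\<in>\<sigma> ` J. cond_law (side_span \<alpha> (X \<omega>) (fst j) (snd j)) (A (\<tau> j))) \<partial>M)"
      proof (rule side_path_identity)
        show "H Y = H Z" if "spine_Z \<alpha> Y = spine_Z \<alpha> Z" "spine_Theta \<alpha> Y = spine_Theta \<alpha> Z"
          "spine_Delta \<alpha> Y = spine_Delta \<alpha> Z" for Y Z using that by (simp add: H_def marks_data_def)
        show "A (\<tau> j) \<in> sets path_space" if "j \<in> \<sigma> ` J" for j using that A \<tau>\<sigma> by auto
      qed (use J J1 H in auto)
      also have "\<dots> = (\<integral>\<^sup>+\<omega>. ennreal (indicator S \<omega> * g \<omega>) \<partial>M)"
      proof (rule nn_integral_cong_AE)
        show "AE \<omega> in M. indicator {Y. sides_positive (\<sigma> ` J) Y} (X \<omega>) * H (X \<omega>) *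
          (\<Prod>j\<in>\<sigma> ` J. cond_law (side_span \<alpha> (X \<omega>) (fst j) (snd j)) (A (\<tau> j))) = ennreal
              (indicator S \<omega> * g \<omega>)"
          using AE_good AE_space
        proof eventually_elim
          case (elim \<omega>)
          note data = spine_data_eq[OF elim(1)]
          show ?case
          proof (cases "\<omega> \<in> S \<inter> C")
            case True
            then have N: "sides_positive (\<sigma> ` J) (X \<omega>)" using good_C[OF elim] by auto
            have "(\<Prod>j\<in>\<sigma> ` J. cond_law (side_span \<alpha> (X \<omega>) (fst j) (snd j)) (A (\<tau> j)))
                = (\<Prod>j\<in>J. c \<omega> j)"
              by (subst prod.reindex[OF inj])
                  (auto simp: \<tau>\<sigma> c_def data_of_good(2)[OF elim(1)] intro!: prod.cong)
            also have "\<dots> = ennreal (\<Prod>j\<in>J. enn2real (c \<omega> j))"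
              by (subst prod_ennreal[symmetric]) (auto simp: c_real intro!: prod.cong)
            finally show ?thesis using True N by (simp add: g_def H_def B C_def data)
          next
            case False
            then show ?thesis using elim(2) by (auto simp: g_def H_def B C_def data indicator_def)
          qed
        qed
      qed
      finally show ?thesis by (simp only: nn_integral_completion)
    qed
    have "AE \<omega> in P. real_cond_exp P ?\<G> f \<omega> = g \<omega>"
    proof (rule G.real_cond_exp_charact[OF _ int g_meas])
      fix S assume S: "S \<in> sets ?\<G>"
      then have S': "S \<in> sets P" using subalgebra_spine by (auto simp: subalgebra_def)
      have "(\<integral>\<omega>. indicator S \<omega> * f \<omega> \<partial>P) = (\<integral>\<omega>. indicator S \<omega> * g \<omega> \<partial>P)"
        using key[OF S] f_bounds g_bounds S' f_meas g_meas'
        by (subst (1 2) integral_eq_nn_integral) (auto intro!: borel_measurable_times)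
      then show "set_lebesgue_integral P S f = set_lebesgue_integral P S g"
        by (simp add: set_lebesgue_integral_def)
    qed
    \<comment> \<open>Since \<open>C\<close> lies in the spine algebra, its indicator can be pulled
      out of the conditional expectation; on \<open>C\<close> it equals 1 and the conditional
      probability of \<open>Ev\<close> itself remains.\<close>
    moreover have "AE \<omega> in P. real_cond_exp P ?\<G> f \<omega>
        = indicator C \<omega> * real_cond_exp P ?\<G> (indicator Ev) \<omega>"
      unfolding f_def[abs_def]
      by (rule G.real_cond_exp_mult) (use C Ev int(1) in \<open>auto simp: f_def[abs_def]\<close>)
    ultimately show ?thesis using AE_good_P AE_space
    proof eventually_elim
      case (elim \<omega>)
      show ?case
      proof (intro impI)
        assume N: "N_int \<alpha> \<epsilon> (X \<omega>) = int n0" and act: "J \<subseteq> ?act \<omega>"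
        interpret good_marks \<alpha> "X \<omega>" by fact
        have "sides_positive (\<sigma> ` J) (X \<omega>)"
          unfolding sides_positive_def using act by (auto simp: \<sigma>_def N Delta_eq)
        then have "\<omega> \<in> C" using good_C[OF elim(3)] N elim(4) by simp
        then have "real_cond_exp P ?\<G> (indicator Ev) \<omega> = (\<Prod>j\<in>J. enn2real (c \<omega> j))"
          using elim(1,2) by (simp add: g_def)
        also have "\<dots> = (\<Prod>j\<in>J. measure (?\<kappa> j \<omega>) (A j))"
          by (intro prod.cong refl) (simp only: measure_\<kappa> c_def \<sigma>_def N)
        finally show "real_cond_exp P ?\<G> (indicator Ev) \<omega> = (\<Prod>j\<in>J. measure (?\<kappa> j \<omega>) (A j))" .
      qed
    qed
  qed
  \<comment> \<open>The countably many exceptional null sets are united. On good realisations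
    \<open>N_int\<close> is nonnegative, so it equals some \<open>n0\<close>.\<close>
  then have "AE \<omega> in P. \<forall>n0. N_int \<alpha> \<epsilon> (X \<omega>) = int n0 \<longrightarrow> J \<subseteq> ?act \<omega> \<longrightarrow>
      real_cond_exp P ?\<G> (indicator Ev) \<omega> = (\<Prod>j\<in>J. measure (?\<kappa> j \<omega>) (A j))"
    unfolding AE_all_countable by blast
  then show "AE \<omega> in P. J \<subseteq> ?act \<omega> \<longrightarrow>
      real_cond_exp P ?\<G> (indicator {\<omega> \<in> space P. \<forall>j\<in>J. side_process \<epsilon> j \<omega> \<in> A j}) \<omega> =
        (\<Prod>j\<in>J. measure (?\<kappa> j \<omega>) (A j))"
    unfolding Ev_def[symmetric] using AE_good_P
    by eventually_elim (use N_int_of_good[OF _ \<epsilon>] in blast)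
qed

end

theorem proposition5p1:
  fixes \<alpha> \<epsilon> :: real
    and \<nu> :: "(nat \<Rightarrow> real) measure"
    and M :: "'a measure"
    and X :: "'a \<Rightarrow> marks"
  assumes alpha: "\<alpha> < 0"
    and nu: "prob_space \<nu>" "sets \<nu> = sets (restrict_space seq_borel unit_mass_seqs)"
      "emeasure \<nu> {one_seq} = 0"
    and M: "prob_space M"
    and indep: "prob_space.indep_vars M (\<lambda>_. borel \<Otimes>\<^sub>M \<nu>) (\<lambda>u \<omega>. X \<omega> u) UNIV"
    and law: "\<And>u. distr M (borel \<Otimes>\<^sub>M \<nu>) (\<lambda>\<omega>. X \<omega> u)
                   = density lborel (exponential_density 1) \<Otimes>\<^sub>M \<nu>"
    and eps: "\<epsilon> > 0"
  shows "(AE \<omega> in completion M. N_eps \<alpha> \<epsilon> (X \<omega>) \<noteq> - \<infinity> \<longleftrightarrow> \<epsilon> \<le> ext_time \<alpha> (X \<omega>)) \<and>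
    (\<exists>Fbar :: int \<times> nat \<Rightarrow> 'a \<Rightarrow> real \<Rightarrow> nat \<Rightarrow> real.
       cond_indep_with_laws (completion M) (spine_algebra (completion M) \<alpha> X) path_space
         (\<lambda>\<omega>. {(i, m). \<epsilon> \<le> ext_time \<alpha> (X \<omega>) \<and> - N_int \<alpha> \<epsilon> (X \<omega>) + 1 \<le> i \<and>
                 Delta \<alpha> (X \<omega>) (nat (N_int \<alpha> \<epsilon> (X \<omega>) + i)) m > 0})
         Fbar
         (\<lambda>(i, m) \<omega>. let n = nat (N_int \<alpha> \<epsilon> (X \<omega>) + i) in
            rev_cond_law (completion M) \<alpha> X
              (Delta \<alpha> (X \<omega>) n m powr \<alpha> * Theta \<alpha> (X \<omega>) n powr (- \<alpha>) * Zn \<alpha> (X \<omega>) n))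
     \<and> (AE \<omega> in completion M. \<epsilon> \<le> ext_time \<alpha> (X \<omega>) \<longrightarrow>
         (\<forall>t. 0 < t \<and> t \<le> ext_time \<alpha> (X \<omega>) / \<epsilon> \<longrightarrow>
           (\<exists>!k. is_K_eps \<alpha> \<epsilon> (X \<omega>) t k) \<and>
           (let N = N_int \<alpha> \<epsilon> (X \<omega>);
                K = (THE k. is_K_eps \<alpha> \<epsilon> (X \<omega>) t k)
            in frag \<alpha> (X \<omega>) (ext_time \<alpha> (X \<omega>) - \<epsilon> * t) =
               dec_rearr
                 (insert None (Some ` {(i, m, l). - N + 1 \<le> i \<and> i \<le> K}))
                 (\<lambda>p. case p of
                    None \<Rightarrow> Theta_prod \<alpha> (X \<omega>) (N + K)
                  | Some (i, m, l) \<Rightarrow>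
                      Theta_prod \<alpha> (X \<omega>) (N + i - 1) * Delta \<alpha> (X \<omega>) (nat (N + i)) m *
                      Fbar (i, m) \<omega>
                        (\<epsilon> * t * Theta_prod \<alpha> (X \<omega>) (N + i - 1) powr \<alpha>
                           * Delta \<alpha> (X \<omega>) (nat (N + i)) m powr \<alpha>) l)))))"
proof -
  interpret fragmentation M \<alpha> \<nu> X
    by (intro fragmentation.intro dislocation.intro fragmentation_axioms.intro M)
      (use alpha nu indep law in auto)
  show ?thesis
  \<comment> \<open>The witness consists of functionals of the same marks, so the rewriting of the
    process holds path by path and not only in law.\<close>
  proof (intro conjI exI[of _ "side_process \<epsilon>"], goal_cases)
    case 1
    show ?case using AE_good_P
    proof eventually_elim
      case (elim \<omega>)
      interpret good_marks \<alpha> "X \<omega>" by fact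
      show ?case by (simp add: N_eps_eq[OF eps] ext_time_eq)
    qed
  next
    case 2
    show ?case by (rule cond_indep_side_process[OF eps])
  next
    case 3
    show ?case using AE_good_P
    proof eventually_elim
      case (elim \<omega>)
      interpret good_marks \<alpha> "X \<omega>" by fact
      show ?case
        unfolding Let_def side_process_def fst_conv snd_conv ext_time_eq
        using ex1_K_eps[OF eps] frag_decomposition[OF eps theI'[OF ex1_K_eps[OF eps]]] by blast
    qed
  qed
qed

end
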